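(* Let $k\in\mathbb{C}$ be the wavenumber, let $p\ge 0$ be the integer polynomial degree, and let $\tau$ be the complex-valued stabilization parameter, assumed to be constant on each element boundary $\partial K$, $K\in\mathcal{T}_h$ (its value may differ from element to element). Suppose that $$\operatorname{Re}(\tau)\neq 0 \ \text{ whenever } \operatorname{Im}(k)=0,\qquad\text{and}\qquad \operatorname{Im}(k)\operatorname{Re}(\tau)\le 0\ \text{ whenever } \operatorname{Im}(k)\neq 0 .$$ Then, with all problems, spaces and forms as defined in the context: (Maxwell case) The local Maxwell element problem on each $K\in\mathcal{T}_h$ and the condensed global Maxwell problem are both unisolvent. That is, the local problem has exactly one solution $(\vec E,\vec H)\in Y(K)\times Y(K)$ for any given data $\hat E$ and $\vec J$, and the only $\hat E\in N_h$ satisfying $a(\hat E,\eta)=0$ for all $\eta\in N_h$ is $\hat E=\vec 0$. (Helmholtz case) Under the same condition, the local Helmholtz element problem on each $K\in\mathcal{T}_h$ and the condensed global Helmholtz problem are also unisolvent. That is, the local problem has exactly one solution $(\vec u,\phi)\in V(K)\times W(K)$ for any given data $\hat\phi$ and $f$, and the only $\hat\phi\in M_h$ satisfying $b(\hat\phi,\eta)=0$ for all $\eta\in M_h$ is $\hat\phi=0$.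
   Context: Notation. $\hat\imath$ is the imaginary unit. All function spaces are complex-valued. For a domain $D$, $\mathcal{P}_p(D)$ denotes polynomials of degree at most $p$ on $D$ and $\mathcal{Q}_p(D)$ polynomials of degree at most $p$ in each variable. $(\cdot,\cdot)_K$ and $\langle\cdot,\cdot\rangle_{\partial K}$ denote the (sesquilinear, conjugate-linear in the second argument) $L^2$ inner products on $K$ and $\partial K$; $\vec n$ is the outward unit normal on $\partial K$. For a vector field $\vec v$ on $\partial K$, its tangential component is $\vec v_t=(\vec n\times\vec v)\times\vec n$. Maxwell case. $\Omega\subset\mathbb{R}^3$, and $\mathcal{T}_h$ is a cubic or tetrahedral mesh of $\Omega$ by disjoint elements $K$, with $\overline\Omega=\bigcup_{K\in\mathcal{T}_h}\overline K$; $\mathcal{F}_h$ is the collection of mesh faces. On tetrahedra, $Y(K)=(\mathcal{P}_p(K))^3$ and $N(F)=\{\hat\eta\in(\mathcal{P}_p(F))^3:\hat\eta\cdot\vec n=0\}$; on cubes, $Y(K)=(\mathcal{Q}_p(K))^3$ and $N(F)=\{\hat\eta\in(\mathcal{Q}_p(F))^3:\hat\eta\cdot\vec n=0\}$. Set $$Y_h=\{\vec v\in (L^2(\Omega))^3:\vec v|_K\in Y(K)\ \forall K\in\mathcal{T}_h\},$$ $$N_h=\{\hat\eta\in (L^2(\mathcal{F}_h))^3:\hat\eta|_F\in N(F)\ \forall F\in\mathcal{F}_h,\ \hat\eta|_{\partial\Omega}=\vec 0\}.$$ Local Maxwell element problem on $K$: given $\hat E$ on $\partial K$ (with $\hat E|_F\in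 N(F)$ for each face $F$ of $K$) and $\vec J\in (L^2(K))^3$, find $(\vec E,\vec H)\in Y(K)\times Y(K)$ such that for all $\vec v,\vec w\in Y(K)$ $$\hat\imath k(\vec E,\vec v)_K-(\vec\nabla\times\vec H,\vec v)_K+\langle\tau\vec E\times\vec n,\vec v\times\vec n\rangle_{\partial K}=\langle\tau\hat E\times\vec n,\vec v\times\vec n\rangle_{\partial K}-(\vec J,\vec v)_K,$$ $$-(\vec E,\vec\nabla\times\vec w)_K-\hat\imath k(\vec H,\vec w)_K=-\langle\hat E,\vec n\times\vec w\rangle_{\partial K}.$$ Condensed global Maxwell problem (all sources zero): for $\Lambda\in N_h$, let $(\vec E^\Lambda,\vec H^\Lambda)\in Y_h\times Y_h$ be such that on each $K$ its restriction solves the local Maxwell element problem with $\hat E=\Lambda|_{\partial K}$ and $\vec J=\vec 0$. Define the numerical flux $\hat H^\Lambda\times\vec n=\vec H^\Lambda\times\vec n+\tau(\vec E^\Lambda-\Lambda)_t$ on each $\partial K$, and $$a(\Lambda,\eta)=\sum_{K\in\mathcal{T}_h}\langle\hat H^\Lambda\times\vec n,\eta\rangle_{\partial K},\qquad \Lambda,\eta\in N_h.$$ The condensed global problem is: find $\hat E\in N_h$ with $a(\hat E,\eta)=0$ for all $\eta\in N_h$. Helmholtz case. $\Omega\subset\mathbb{R}^2$, and $\mathcal{T}_h$ is a square or triangular mesh of $\Omega$ by disjoint elements $K$, with $\overline\Omega=\bigcup_{K\in\mathcal{T}_h}\overline K$; $\mathcal{F}_h$ is the collection of edges. On triangles, $V(K)=(\mathcal{P}_p(K))^2$,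 $W(K)=\mathcal{P}_p(K)$; on squares, $V(K)=(\mathcal{Q}_p(K))^2$, $W(K)=\mathcal{Q}_p(K)$; in both cases $M(F)=\mathcal{P}_p(F)$. Set $$V_h=\{\vec v\in(L^2(\Omega))^2:\vec v|_K\in V(K)\ \forall K\in\mathcal{T}_h\},\qquad W_h=\{\psi\in L^2(\Omega):\psi|_K\in W(K)\ \forall K\in\mathcal{T}_h\},$$ $$M_h=\Big\{\hat\psi\in L^2\Big(\bigcup_{F\in\mathcal{F}_h}F\Big):\hat\psi|_F\in M(F)\ \forall F\in\mathcal{F}_h,\ \hat\psi|_{\partial\Omega}=0\Big\}.$$ Local Helmholtz element problem on $K$: given $\hat\phi$ on $\partial K$ (with $\hat\phi|_F\in M(F)$ for each edge $F$ of $K$) and $f\in L^2(K)$, find $(\vec u,\phi)\in V(K)\times W(K)$ such that for all $\vec v\in V(K)$, $\psi\in W(K)$ $$\hat\imath k(\vec u,\vec v)_K-(\phi,\vec\nabla\cdot\vec v)_K=-\langle\hat\phi,\vec v\cdot\vec n\rangle_{\partial K},$$ $$-(\vec\nabla\cdot\vec u,\psi)_K-\langle\tau\phi,\psi\rangle_{\partial K}-\hat\imath k(\phi,\psi)_K=-\langle\tau\hat\phi,\psi\rangle_{\partial K}-(f,\psi)_K.$$ Condensed global Helmholtz problem (all sources zero): for $\Lambda\in M_h$, let $(\vec u^\Lambda,\phi^\Lambda)\in V_h\times W_h$ be such that on each $K$ its restriction solves the local Helmholtz element problem with $\hat\phi=\Lambda|_{\partial K}$ and $f=0$. Define the numerical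 flux $\hat u^\Lambda\cdot\vec n=\vec u^\Lambda\cdot\vec n+\tau(\phi^\Lambda-\Lambda)$ on each $\partial K$, and $$b(\Lambda,\eta)=\sum_{K\in\mathcal{T}_h}\langle\hat u^\Lambda\cdot\vec n,\eta\rangle_{\partial K},\qquad \Lambda,\eta\in M_h.$$ The condensed global problem is: find $\hat\phi\in M_h$ with $b(\hat\phi,\eta)=0$ for all $\eta\in M_h$.
   Formalization: Proved for k≠0; the global claims also assume, for real k, that Re(τ) has the same sign on elements sharing a face, and, for Maxwell with non-real k, that the τ values of two elements sharing a face do not sum to 0. Meshes are face-to-face; squares and cubes are axis-parallel. *)

theory Defs
  imports "HOL-Analysis.Analysis"
begin

text \<open>
  One type for both families of meshes: \<open>Simplicial\<close> covers triangles and tetrahedra,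
  \<open>Cubic\<close> covers squares and cubes. The latter are parallel to the axes, since
  polynomials of bounded degree in each variable refer to the coordinates of the space.
  Elements are open sets; they are determined by their closures.
\<close>

datatype cell_kind = Simplicial | Cubic

fun is_cell :: "cell_kind \<Rightarrow> (real^'n) set \<Rightarrow> bool" where
  "is_cell Simplicial K \<longleftrightarrow> (\<exists>S. int CARD('n) simplex S \<and> K = interior S)"
| "is_cell Cubic K \<longleftrightarrow> (\<exists>a h. 0 < h \<and> K = box a (\<chi> i. a $ i + h))"

definition faces :: "(real^'n) set \<Rightarrow> (real^'n) set set" where
  "faces K = {F. F facet_of closure K}"

definition adjacent :: "(real^'n) set \<Rightarrow> (real^'n) set \<Rightarrow> bool" where
  "adjacent K K' \<longleftrightarrow> K \<noteq> K' \<and> faces K \<inter> faces K' \<noteq> {}"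

text \<open>
  The last conjunct is geometric conformity: two closed elements meet in a (possibly
  empty) common face of some dimension. By symmetry the intersection is a face of both.
\<close>

definition is_mesh :: "cell_kind \<Rightarrow> (real^'n) set \<Rightarrow> (real^'n) set set \<Rightarrow> bool" where
  "is_mesh c \<Omega> \<T> \<longleftrightarrow>
     open \<Omega> \<and> finite \<T> \<and> (\<forall>K\<in>\<T>. is_cell c K \<and> K \<subseteq> \<Omega>) \<and>
     closure \<Omega> = (\<Union>K\<in>\<T>. closure K) \<and>
     (\<forall>K\<in>\<T>. \<forall>K'\<in>\<T>. K \<noteq> K' \<longrightarrow> K \<inter> K' = {}) \<and>
     (\<forall>K\<in>\<T>. \<forall>K'\<in>\<T>. closure K \<inter> closure K' face_of closure K)"

definition mesh_faces :: "(real^'n) set set \<Rightarrow> (real^'n) set set" where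
  "mesh_faces \<T> = (\<Union>K\<in>\<T>. faces K)"

definition unit_normal :: "(real^'n) set \<Rightarrow> real^'n \<Rightarrow> bool" where
  "unit_normal F n \<longleftrightarrow> norm n = 1 \<and> (\<forall>x\<in>F. \<forall>y\<in>F. n \<bullet> (x - y) = 0)"

definition outward_normal :: "(real^'n) set \<Rightarrow> (real^'n) set \<Rightarrow> real^'n" where
  "outward_normal K F = (THE n. unit_normal F n \<and> (\<forall>x\<in>F. \<forall>y\<in>K. n \<bullet> y \<le> n \<bullet> x))"

text \<open>
  Surface measure on a face \<open>F\<close>, a bounded piece of a hyperplane: the area of a subset
  is the volume of the slab of thickness 1 over it. So the measure is the image
  of Lebesgue measure on the slab under the orthogonal projection to the hyperplane.
\<close>

definition face_measure :: "(real^'n) set \<Rightarrow> (real^'n) measure" where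
  "face_measure F =
     distr (restrict_space lborel
              {y. closest_point (affine hull F) y \<in> F \<and> infdist y (affine hull F) \<le> 1 / 2})
           borel (closest_point (affine hull F))"

definition hdot :: "complex^'n \<Rightarrow> complex^'n \<Rightarrow> complex" where
  "hdot u v = (\<Sum>i\<in>UNIV. u $ i * cnj (v $ i))"

definition cvec :: "real^'n \<Rightarrow> complex^'n" where
  "cvec n = (\<chi> i. of_real (n $ i))"

definition ccross :: "complex^3 \<Rightarrow> complex^3 \<Rightarrow> complex^3" where
  "ccross a b = vector [a$2 * b$3 - a$3 * b$2, a$3 * b$1 - a$1 * b$3, a$1 * b$2 - a$2 * b$1]"

definition tangential :: "real^3 \<Rightarrow> complex^3 \<Rightarrow> complex^3" where
  "tangential n v = ccross (ccross (cvec n) v) (cvec n)"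

definition pderivative :: "'n \<Rightarrow> (real^'n \<Rightarrow> complex) \<Rightarrow> real^'n \<Rightarrow> complex" where
  "pderivative i f x = frechet_derivative f (at x) (axis i 1)"

definition curl :: "(real^3 \<Rightarrow> complex^3) \<Rightarrow> real^3 \<Rightarrow> complex^3" where
  "curl v x = vector
     [pderivative 2 (\<lambda>y. v y $ 3) x - pderivative 3 (\<lambda>y. v y $ 2) x,
      pderivative 3 (\<lambda>y. v y $ 1) x - pderivative 1 (\<lambda>y. v y $ 3) x,
      pderivative 1 (\<lambda>y. v y $ 2) x - pderivative 2 (\<lambda>y. v y $ 1) x]"

definition divg :: "(real^'n \<Rightarrow> complex^'n) \<Rightarrow> real^'n \<Rightarrow> complex" where
  "divg v x = (\<Sum>i\<in>UNIV. pderivative i (\<lambda>y. v y $ i) x)"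

fun exponents :: "cell_kind \<Rightarrow> nat \<Rightarrow> ('n::finite \<Rightarrow> nat) set" where
  "exponents Simplicial p = {\<alpha>. (\<Sum>i\<in>UNIV. \<alpha> i) \<le> p}"
| "exponents Cubic p = {\<alpha>. \<forall>i. \<alpha> i \<le> p}"

text \<open>
  A polynomial on an element (a nonempty open set) is identified with its unique
  polynomial extension to the whole space, so the element spaces do not mention the element.
\<close>

definition poly_space :: "cell_kind \<Rightarrow> nat \<Rightarrow> (real^'n \<Rightarrow> complex) set" where
  "poly_space c p =
     {f. \<exists>a. f = (\<lambda>x. \<Sum>\<alpha>\<in>exponents c p. a \<alpha> * (\<Prod>i\<in>UNIV. of_real (x $ i) ^ \<alpha> i))}"

definition vpoly_space :: "cell_kind \<Rightarrow> nat \<Rightarrow> (real^'n \<Rightarrow> complex^'n) set" where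
  "vpoly_space c p = {v. \<forall>i. (\<lambda>x. v x $ i) \<in> poly_space c p}"

text \<open>
  A polynomial on a face is the restriction of a polynomial on the space. As such
  an extension is not unique, only the values on \<open>F\<close> matter for members of the face spaces.
  A function on the skeleton is a family indexed by the faces, which is an \<open>L\<^sup>2\<close>
  function because distinct faces overlap in sets of surface measure zero.
\<close>

definition face_poly :: "cell_kind \<Rightarrow> nat \<Rightarrow> (real^'n) set \<Rightarrow> (real^'n \<Rightarrow> complex) set" where
  "face_poly c p F = {\<eta>. \<exists>q\<in>poly_space c p. \<forall>x\<in>F. \<eta> x = q x}"

definition face_tpoly :: "cell_kind \<Rightarrow> nat \<Rightarrow> (real^3) set \<Rightarrow> (real^3 \<Rightarrow> complex^3) set" where
  "face_tpoly c p F =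
     {\<eta>. (\<exists>q\<in>vpoly_space c p. \<forall>x\<in>F. \<eta> x = q x) \<and>
         (\<forall>n. unit_normal F n \<longrightarrow> (\<forall>x\<in>F. hdot (\<eta> x) (cvec n) = 0))}"

definition M_h :: "cell_kind \<Rightarrow> nat \<Rightarrow> (real^2) set \<Rightarrow> (real^2) set set
    \<Rightarrow> ((real^2) set \<Rightarrow> real^2 \<Rightarrow> complex) set" where
  "M_h c p \<Omega> \<T> =
     {\<eta>. \<forall>F\<in>mesh_faces \<T>. \<eta> F \<in> face_poly c p F \<and>
            (F \<subseteq> frontier \<Omega> \<longrightarrow> (\<forall>x\<in>F. \<eta> F x = 0))}"

definition N_h :: "cell_kind \<Rightarrow> nat \<Rightarrow> (real^3) set \<Rightarrow> (real^3) set set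
    \<Rightarrow> ((real^3) set \<Rightarrow> real^3 \<Rightarrow> complex^3) set" where
  "N_h c p \<Omega> \<T> =
     {\<eta>. \<forall>F\<in>mesh_faces \<T>. \<eta> F \<in> face_tpoly c p F \<and>
            (F \<subseteq> frontier \<Omega> \<longrightarrow> (\<forall>x\<in>F. \<eta> F x = 0))}"

definition square_integrable :: "(real^'n) set \<Rightarrow> (real^'n \<Rightarrow> 'b::real_normed_vector) \<Rightarrow> bool" where
  "square_integrable K f \<longleftrightarrow>
     set_borel_measurable lebesgue K f \<and> set_integrable lebesgue K (\<lambda>x. (norm (f x))\<^sup>2)"

definition ip :: "(real^'n) set \<Rightarrow> (real^'n \<Rightarrow> complex) \<Rightarrow> (real^'n \<Rightarrow> complex) \<Rightarrow> complex" where
  "ip K f g = (LINT x:K|lebesgue. f x * cnj (g x))"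

definition vip :: "(real^'n) set \<Rightarrow> (real^'n \<Rightarrow> complex^'n) \<Rightarrow> (real^'n \<Rightarrow> complex^'n) \<Rightarrow> complex" where
  "vip K u v = (LINT x:K|lebesgue. hdot (u x) (v x))"

definition bip :: "(real^'n) set \<Rightarrow> ((real^'n) set \<Rightarrow> real^'n \<Rightarrow> complex)
    \<Rightarrow> ((real^'n) set \<Rightarrow> real^'n \<Rightarrow> complex) \<Rightarrow> complex" where
  "bip K f g = (\<Sum>F\<in>faces K. LINT x:F|face_measure F. f F x * cnj (g F x))"

definition vbip :: "(real^'n) set \<Rightarrow> ((real^'n) set \<Rightarrow> real^'n \<Rightarrow> complex^'n)
    \<Rightarrow> ((real^'n) set \<Rightarrow> real^'n \<Rightarrow> complex^'n) \<Rightarrow> complex" where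
  "vbip K u v = (\<Sum>F\<in>faces K. LINT x:F|face_measure F. hdot (u F x) (v F x))"

definition maxwell_solutions :: "complex \<Rightarrow> nat \<Rightarrow> cell_kind \<Rightarrow> complex \<Rightarrow> (real^3) set
    \<Rightarrow> ((real^3) set \<Rightarrow> real^3 \<Rightarrow> complex^3) \<Rightarrow> (real^3 \<Rightarrow> complex^3)
    \<Rightarrow> ((real^3 \<Rightarrow> complex^3) \<times> (real^3 \<Rightarrow> complex^3)) set" where
  "maxwell_solutions k p c \<tau> K Eh J =
     {(E, H). E \<in> vpoly_space c p \<and> H \<in> vpoly_space c p \<and>
        (let n = (\<lambda>F. cvec (outward_normal K F)) in
         (\<forall>v\<in>vpoly_space c p.
            \<i> * k * vip K E v - vip K (curl H) v
              + vbip K (\<lambda>F x. \<tau> *s ccross (E x) (n F)) (\<lambda>F x. ccross (v x) (n F))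
            = vbip K (\<lambda>F x. \<tau> *s ccross (Eh F x) (n F)) (\<lambda>F x. ccross (v x) (n F))
              - vip K J v) \<and>
         (\<forall>w\<in>vpoly_space c p.
            - vip K E (curl w) - \<i> * k * vip K H w
            = - vbip K Eh (\<lambda>F x. ccross (n F) (w x))))}"

text \<open>
  The description operator denotes the element solution where the local problem is
  unisolvent, and is arbitrary otherwise; likewise for the Helmholtz problem below.
\<close>

definition maxwell_sol :: "complex \<Rightarrow> nat \<Rightarrow> cell_kind \<Rightarrow> complex \<Rightarrow> (real^3) set
    \<Rightarrow> ((real^3) set \<Rightarrow> real^3 \<Rightarrow> complex^3)
    \<Rightarrow> (real^3 \<Rightarrow> complex^3) \<times> (real^3 \<Rightarrow> complex^3)" where
  "maxwell_sol k p c \<tau> K \<Lambda> = (THE X. X \<in> maxwell_solutions k p c \<tau> K \<Lambda> (\<lambda>x. 0))"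

definition maxwell_flux :: "complex \<Rightarrow> nat \<Rightarrow> cell_kind \<Rightarrow> complex \<Rightarrow> (real^3) set
    \<Rightarrow> ((real^3) set \<Rightarrow> real^3 \<Rightarrow> complex^3) \<Rightarrow> (real^3) set \<Rightarrow> real^3 \<Rightarrow> complex^3" where
  "maxwell_flux k p c \<tau> K \<Lambda> F x =
     (let n = outward_normal K F; (E, H) = maxwell_sol k p c \<tau> K \<Lambda>
      in ccross (H x) (cvec n) + \<tau> *s tangential n (E x - \<Lambda> F x))"

definition maxwell_form :: "complex \<Rightarrow> nat \<Rightarrow> cell_kind \<Rightarrow> (real^3) set set \<Rightarrow> ((real^3) set \<Rightarrow> complex)
    \<Rightarrow> ((real^3) set \<Rightarrow> real^3 \<Rightarrow> complex^3) \<Rightarrow> ((real^3) set \<Rightarrow> real^3 \<Rightarrow> complex^3) \<Rightarrow> complex" where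
  "maxwell_form k p c \<T> \<tau> \<Lambda> \<eta> = (\<Sum>K\<in>\<T>. vbip K (maxwell_flux k p c (\<tau> K) K \<Lambda>) \<eta>)"

definition helmholtz_solutions :: "complex \<Rightarrow> nat \<Rightarrow> cell_kind \<Rightarrow> complex \<Rightarrow> (real^2) set
    \<Rightarrow> ((real^2) set \<Rightarrow> real^2 \<Rightarrow> complex) \<Rightarrow> (real^2 \<Rightarrow> complex)
    \<Rightarrow> ((real^2 \<Rightarrow> complex^2) \<times> (real^2 \<Rightarrow> complex)) set" where
  "helmholtz_solutions k p c \<tau> K \<phi>h f =
     {(u, \<phi>). u \<in> vpoly_space c p \<and> \<phi> \<in> poly_space c p \<and>
        (let n = (\<lambda>F. cvec (outward_normal K F)) in
         (\<forall>v\<in>vpoly_space c p.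
            \<i> * k * vip K u v - ip K \<phi> (divg v) = - bip K \<phi>h (\<lambda>F x. hdot (v x) (n F))) \<and>
         (\<forall>\<psi>\<in>poly_space c p.
            - ip K (divg u) \<psi> - bip K (\<lambda>F x. \<tau> * \<phi> x) (\<lambda>F. \<psi>) - \<i> * k * ip K \<phi> \<psi>
            = - bip K (\<lambda>F x. \<tau> * \<phi>h F x) (\<lambda>F. \<psi>) - ip K f \<psi>))}"

definition helmholtz_sol :: "complex \<Rightarrow> nat \<Rightarrow> cell_kind \<Rightarrow> complex \<Rightarrow> (real^2) set
    \<Rightarrow> ((real^2) set \<Rightarrow> real^2 \<Rightarrow> complex) \<Rightarrow> (real^2 \<Rightarrow> complex^2) \<times> (real^2 \<Rightarrow> complex)" where
  "helmholtz_sol k p c \<tau> K \<Lambda> = (THE X. X \<in> helmholtz_solutions k p c \<tau> K \<Lambda> (\<lambda>x. 0))"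

definition helmholtz_flux :: "complex \<Rightarrow> nat \<Rightarrow> cell_kind \<Rightarrow> complex \<Rightarrow> (real^2) set
    \<Rightarrow> ((real^2) set \<Rightarrow> real^2 \<Rightarrow> complex) \<Rightarrow> (real^2) set \<Rightarrow> real^2 \<Rightarrow> complex" where
  "helmholtz_flux k p c \<tau> K \<Lambda> F x =
     (let n = outward_normal K F; (u, \<phi>) = helmholtz_sol k p c \<tau> K \<Lambda>
      in hdot (u x) (cvec n) + \<tau> * (\<phi> x - \<Lambda> F x))"

definition helmholtz_form :: "complex \<Rightarrow> nat \<Rightarrow> cell_kind \<Rightarrow> (real^2) set set \<Rightarrow> ((real^2) set \<Rightarrow> complex)
    \<Rightarrow> ((real^2) set \<Rightarrow> real^2 \<Rightarrow> complex) \<Rightarrow> ((real^2) set \<Rightarrow> real^2 \<Rightarrow> complex) \<Rightarrow> complex" where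
  "helmholtz_form k p c \<T> \<tau> \<Lambda> \<eta> = (\<Sum>K\<in>\<T>. bip K (helmholtz_flux k p c (\<tau> K) K \<Lambda>) \<eta>)"

definition stab_condition :: "complex \<Rightarrow> complex \<Rightarrow> bool" where
  "stab_condition k t \<longleftrightarrow>
     (Im k = 0 \<longrightarrow> Re t \<noteq> 0) \<and> (Im k \<noteq> 0 \<longrightarrow> Im k * Re t \<le> 0)"

end

theory Submission
  imports Defs "HOL-Computational_Algebra.Polynomial"
begin

text \<open>
  Testing an element problem with its own solution gives the energy identity
  \<open>\<i> k \<alpha> - \<i> k\<^sup>* \<beta> + \<tau> \<gamma> + \<langle>flux, \<Lambda>\<rangle> = 0\<close>, where \<open>k\<^sup>*\<close> is the conjugate of \<open>k\<close>, \<open>\<alpha>\<close> and \<open>\<beta>\<close> are the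
  squared norms of the two unknowns on the cell and \<open>\<gamma>\<close> is that of the mismatch between the
  trace and the datum \<open>\<Lambda>\<close>. For \<open>\<Lambda> = 0\<close> the real part makes the unknowns vanish if \<open>Im k \<noteq> 0\<close>, and
  the mismatch if \<open>Im k = 0\<close>. In the latter case integration by parts turns the weak equations into
  \<open>curl H = \<i> k E\<close>, \<open>curl E = - \<i> k H\<close> (for Helmholtz: \<open>grad \<phi> = - \<i> k u\<close>, \<open>div u = - \<i> k \<phi>\<close>), and as
  differentiation lowers the total degree, no nonzero polynomials satisfy this. The element
  problem is a square linear system, so uniqueness gives existence.

  In the condensed problem, neighbouring cells have \<open>Re \<tau>\<close> of the same sign if \<open>Im k = 0\<close>, and testing with
  the restriction of \<open>\<Lambda>\<close> to the cells of one sign makes every mismatch vanish. If \<open>Im k \<noteq> 0\<close>, testing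
  with \<open>\<Lambda>\<close> makes all element solutions vanish. In the Maxwell case the flux is then \<open>- \<tau> \<Lambda>\<close>, and testing on
  the single face between \<open>K\<close> and \<open>L\<close> leaves \<open>(\<tau> K + \<tau> L) |\<Lambda>|\<^sup>2 = 0\<close>. In the Helmholtz case \<open>\<Lambda>\<close> is orthogonal to the
  normal traces of all polynomial fields on each cell. Hence if \<open>\<Lambda>\<close> is nonzero on one side of a
  cell, it is so on the other sides facing the same coordinate direction, which are therefore not on the boundary and
  lead to further such cells. By the divergence theorem a patch of cells that is closed under this
  passage has volume zero.

  The divergence theorem on a polytope \<open>K\<close> comes from comparing \<open>K\<close> with its translate \<open>K + t e\<close>: up to a null
  set, the difference of their indicator functions is a signed sum of indicators of the prisms
  \<open>F + [0, t] e\<close> over the faces \<open>F\<close>.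
\<close>

section \<open>Polytopal cells\<close>

text \<open>One of the two equations enters the energy identity conjugated, so both norms carry the
  real part \<open>- Im k\<close> and cannot cancel each other;
  \<open>Im k * Re \<tau> \<le> 0\<close> keeps the mismatch from cancelling them. But for
  \<open>Im k \<noteq> 0\<close> the number \<open>Re \<tau>\<close> may be 0, so the energy says
  nothing about the mismatch, and \<Lambda> has to be recovered from the flux or from an element
  equation once the interior unknowns are known to vanish. For \<open>Im k = 0\<close> it is the
  reverse: only the mismatch is controlled, and energies of cells with different signs of
  \<open>Re \<tau>\<close> could cancel in the sum over the mesh.

  The divergence theorem is aimed at \<open>face_measure\<close> itself: if \<open>e\<close> is not
  parallel to a face, the slab that defines the measure and the prism over the face are affine
  images of each other, with determinant \<open>t * (n \<bullet> e)\<close>, so no face has to be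
  parametrized. Once a cell is known to be a \<open>polycell\<close>, its shape matters again only
  for \<open>tangent_to_other_faces\<close>.\<close>

definition polycell :: "(real^'n) set \<Rightarrow> bool" where
  "polycell K \<longleftrightarrow> open K \<and> convex K \<and> K \<noteq> {} \<and> polytope (closure K)"

text \<open>Every point of \<open>F\<close> gives the same value, since the inner product with the
  normal is constant on \<open>F\<close>; it is the level of the hyperplane that carries
  \<open>F\<close>.\<close>

definition face_offset :: "(real^'n) set \<Rightarrow> (real^'n) set \<Rightarrow> real" where
  "face_offset K F = outward_normal K F \<bullet> (SOME x. x \<in> F)"

text \<open>A simplex of full dimension has its relative interior as interior, which is therefore
  nonempty and dense in it, so that closing the open cell gives the simplex back.\<close>

lemma is_cell_imp_polycell:
  assumes "is_cell c (K :: (real^'n) set)"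
  shows "polycell K"
proof (cases c)
  case Simplicial
  then obtain S where S: "int CARD('n) simplex S" and K: "K = interior S"
    using assms by auto
  have conv: "convex S" and poly: "polytope S"
    using S simplex_imp_polytope polytope_imp_convex by blast+
  have "aff_dim S = int CARD('n)"
    using S aff_dim_simplex by blast
  then have "affine hull S = UNIV"
    by (metis DIM_real DIM_cart aff_dim_eq_full mult.right_neutral)
  then have "interior S = rel_interior S"
    by (simp add: rel_interior_interior)
  moreover have "S \<noteq> {}"
    using \<open>affine hull S = UNIV\<close> by auto
  ultimately have ne: "interior S \<noteq> {}"
    using conv rel_interior_eq_empty by metis
  then have "closure K = S"
    using K conv poly convex_closure_interior polytope_imp_closed closure_closed by metis
  then show ?thesis
    using K conv poly ne by (simp add: polycell_def convex_interior)
next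
  case Cubic
  then obtain a h where h: "0 < h" and K: "K = box a (\<chi> i. a $ i + h)"
    using assms by auto
  have "K \<noteq> {}"
    unfolding K using h by (simp add: interval_ne_empty_cart)
  moreover from this have "closure K = cbox a (\<chi> i. a $ i + h)"
    unfolding K by (rule closure_box)
  ultimately show ?thesis
    unfolding polycell_def using K by (simp add: open_box convex_box polytope_interval)
qed

lemma polycell_bounded: "polycell K \<Longrightarrow> bounded K"
  unfolding polycell_def using polytope_imp_bounded bounded_subset closure_subset by metis

lemma polycell_aff_dim_closure: "polycell (K::(real^'n) set) \<Longrightarrow> aff_dim (closure K) = int CARD('n)"
  unfolding polycell_def by (simp add: aff_dim_open closure_subset)

lemma finite_faces: "polycell K \<Longrightarrow> finite (faces K)"
  unfolding polycell_def faces_def using finite_polytope_facets by auto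

text \<open>A supporting half-space of the facet, scaled to a unit normal. The facet spans the
  bounding hyperplane because both have codimension one.\<close>

lemma facet_halfspace:
  assumes K: "polycell (K::(real^'n) set)" and F: "F \<in> faces K"
  obtains n b where "norm n = 1" "closure K \<subseteq> {x. n \<bullet> x \<le> b}" "F = closure K \<inter> {x. n \<bullet> x = b}"
    "affine hull F = {x. n \<bullet> x = b}"
proof -
  have poly: "polyhedron (closure K)" and ne: "closure K \<noteq> {}"
    using K polytope_imp_polyhedron unfolding polycell_def by auto
  obtain a b where a: "a \<noteq> 0" and sub: "closure K \<subseteq> {x. a \<bullet> x \<le> b}"
    and Feq: "F = closure K \<inter> {x. a \<bullet> x = b}"
    using F facet_of_polyhedron[OF poly] unfolding faces_def by blast
  define n where "n = a /\<^sub>R norm a"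
  define d where "d = b / norm a"
  have n1: "norm n = 1" using a by (simp add: n_def)
  have le: "n \<bullet> x \<le> d \<longleftrightarrow> a \<bullet> x \<le> b" and eq: "n \<bullet> x = d \<longleftrightarrow> a \<bullet> x = b" for x
    using a by (auto simp: n_def d_def divide_simps)
  have Feq': "F = closure K \<inter> {x. n \<bullet> x = d}"
    using Feq eq by simp
  have "aff_dim F = int CARD('n) - 1"
    using F polycell_aff_dim_closure[OF K] by (simp add: faces_def facet_of_def)
  moreover have "aff_dim {x. n \<bullet> x = d} = int CARD('n) - 1"
    using n1 by (subst aff_dim_hyperplane) auto
  moreover have "affine hull F \<subseteq> {x. n \<bullet> x = d}"
    by (rule hull_minimal) (use Feq' affine_hyperplane in auto)
  moreover have "F \<noteq> {}"
    using F by (auto simp: faces_def facet_of_def)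
  ultimately have "affine hull F = {x. n \<bullet> x = d}"
    using affine_hyperplane by (intro affine_dim_equal) auto
  then show ?thesis
    using that[of n d] n1 Feq' sub le by auto
qed

lemma unit_normal_unique:
  assumes aff: "affine hull F = {x. n \<bullet> x = b}" and n: "norm n = 1" and m: "unit_normal F m"
  shows "m = n \<or> m = - n"
proof -
  have "F \<noteq> {}"
  proof
    assume "F = {}"
    then have "{x. n \<bullet> x = b} = {}" using aff by auto
    moreover have "n \<bullet> (b *\<^sub>R n) = b" using n by (simp add: dot_square_norm)
    ultimately show False by blast
  qed
  then obtain x where x: "x \<in> F" by auto
  have "affine hull F \<subseteq> {y. m \<bullet> y = m \<bullet> x}"
  proof (rule hull_minimal)
    show "F \<subseteq> {y. m \<bullet> y = m \<bullet> x}"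
    proof
      fix y assume "y \<in> F"
      then have "m \<bullet> (y - x) = 0" using m x unfolding unit_normal_def by blast
      then show "y \<in> {y. m \<bullet> y = m \<bullet> x}" by (simp add: inner_diff_right)
    qed
  qed (rule affine_hyperplane)
  then have sub: "n \<bullet> y = b \<Longrightarrow> m \<bullet> y = m \<bullet> x" for y using aff by auto
  have nx: "n \<bullet> x = b" using aff x hull_inc by fastforce
  \<comment> \<open>The part of \<open>m\<close> orthogonal to \<open>n\<close>. Adding it to
    \<open>x\<close> stays in the hyperplane, on which \<open>m\<close> is constant, so
    \<open>z\<close> is orthogonal to \<open>m\<close> as well and hence to itself.\<close>
  define z where "z = m - (n \<bullet> m) *\<^sub>R n"
  have nz: "n \<bullet> z = 0"
    using n by (simp add: z_def inner_diff_right dot_square_norm)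
  then have "m \<bullet> z = 0"
    using sub[of "x + z"] nx by (simp add: inner_add_right)
  then have "z \<bullet> z = 0"
    using nz by (simp add: z_def inner_diff_left)
  then have eq: "m = (n \<bullet> m) *\<^sub>R n" by (simp add: z_def)
  then have "\<bar>n \<bullet> m\<bar> = 1"
    using m n by (metis unit_normal_def norm_scaleR mult.right_neutral)
  then have "n \<bullet> m = 1 \<or> n \<bullet> m = -1" by linarith
  then show ?thesis using eq by (metis scaleR_one scaleR_minus1_left)
qed

text \<open>Of the two unit normals the inward one is ruled out: it would put the open set
  \<open>K\<close> into the hyperplane.\<close>

lemma outward_normal_eq:
  assumes K: "polycell K" and n: "norm n = 1" and sub: "closure K \<subseteq> {x. n \<bullet> x \<le> b}"
    and F: "F = closure K \<inter> {x. n \<bullet> x = b}" and aff: "affine hull F = {x. n \<bullet> x = b}"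
  shows "outward_normal K F = n"
  unfolding outward_normal_def
proof (rule the_equality)
  have "unit_normal F n"
    using n F by (simp add: unit_normal_def inner_diff_right)
  moreover have "n \<bullet> y \<le> n \<bullet> x" if "x \<in> F" "y \<in> K" for x y
    using that F sub closure_subset[of K] by auto
  ultimately show "unit_normal F n \<and> (\<forall>x\<in>F. \<forall>y\<in>K. n \<bullet> y \<le> n \<bullet> x)"
    by blast
next
  fix m assume m: "unit_normal F m \<and> (\<forall>x\<in>F. \<forall>y\<in>K. m \<bullet> y \<le> m \<bullet> x)"
  have "F \<noteq> {}"
  proof
    assume "F = {}"
    then have "{x. n \<bullet> x = b} = {}" using aff by auto
    moreover have "n \<bullet> (b *\<^sub>R n) = b" using n by (simp add: dot_square_norm)
    ultimately show False by blast
  qed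
  then obtain x where x: "x \<in> F" by auto
  obtain y where y: "y \<in> K" using K by (auto simp: polycell_def)
  show "m = n"
  proof (rule ccontr)
    assume "m \<noteq> n"
    then have "m = - n" using unit_normal_unique[OF aff n] m by auto
    then have ge: "z \<in> K \<Longrightarrow> n \<bullet> x \<le> n \<bullet> z" for z using m x by auto
    have "n \<bullet> z = b" if z: "z \<in> K" for z
    proof -
      have "n \<bullet> x = b" using F x by blast
      moreover have "n \<bullet> z \<le> b" using sub z closure_subset by blast
      ultimately show ?thesis using ge[OF z] by simp
    qed
    then have "K \<subseteq> {z. n \<bullet> z = b}" by auto
    moreover have "interior {z. n \<bullet> z = b} = {}"
      using n by (intro interior_hyperplane) auto
    ultimately show False
      using K y by (metis polycell_def interior_maximal empty_iff subset_iff)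
  qed
qed

lemma face_props:
  assumes K: "polycell (K::(real^'n) set)" and F: "F \<in> faces K"
  shows norm_outward_normal: "norm (outward_normal K F) = 1"
    and closure_below_face: "\<And>x. x \<in> closure K \<Longrightarrow> outward_normal K F \<bullet> x \<le> face_offset K F"
    and face_eq: "F = closure K \<inter> {x. outward_normal K F \<bullet> x = face_offset K F}"
    and affine_hull_face: "affine hull F = {x. outward_normal K F \<bullet> x = face_offset K F}"
    and face_nonempty: "F \<noteq> {}"
proof -
  obtain n b where n: "norm n = 1" and sub: "closure K \<subseteq> {x. n \<bullet> x \<le> b}"
    and Feq: "F = closure K \<inter> {x. n \<bullet> x = b}" and aff: "affine hull F = {x. n \<bullet> x = b}"
    using facet_halfspace[OF K F] .
  have on: "outward_normal K F = n" by (rule outward_normal_eq[OF K n sub Feq aff])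
  show ne: "F \<noteq> {}" using F by (auto simp: faces_def facet_of_def)
  then have "(SOME x. x \<in> F) \<in> F" by (simp add: some_in_eq)
  then have "face_offset K F = b" using Feq on by (auto simp: face_offset_def)
  then show "norm (outward_normal K F) = 1"
    "\<And>x. x \<in> closure K \<Longrightarrow> outward_normal K F \<bullet> x \<le> face_offset K F"
    "F = closure K \<inter> {x. outward_normal K F \<bullet> x = face_offset K F}"
    "affine hull F = {x. outward_normal K F \<bullet> x = face_offset K F}"
    using n sub Feq aff on by auto
qed

lemma outward_normal_nonzero: "polycell K \<Longrightarrow> F \<in> faces K \<Longrightarrow> outward_normal K F \<noteq> 0"
  using norm_outward_normal by fastforce

lemma cell_below_face:
  assumes K: "polycell (K::(real^'n) set)" and F: "F \<in> faces K" and x: "x \<in> K"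
  shows "outward_normal K F \<bullet> x < face_offset K F"
proof (rule ccontr)
  let ?n = "outward_normal K F"
  assume "\<not> ?thesis"
  then have eq: "?n \<bullet> x = face_offset K F"
    using closure_below_face[OF K F] x closure_subset by fastforce
  obtain e where e: "e > 0" "ball x e \<subseteq> K"
    using K x by (auto simp: polycell_def open_contains_ball)
  then have "x + (e/2) *\<^sub>R ?n \<in> K"
    using norm_outward_normal[OF K F] by (intro subsetD[OF e(2)]) (simp add: dist_norm)
  then have "?n \<bullet> (x + (e/2) *\<^sub>R ?n) \<le> face_offset K F"
    using closure_below_face[OF K F] closure_subset by blast
  then show False
    using eq e norm_outward_normal[OF K F] by (simp add: inner_add_right dot_square_norm)
qed

text \<open>For the converse, the segment from a point of \<open>K\<close> to a point
  \<open>x\<close> outside meets the frontier in some face, although both its ends lie strictly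
  below that face.\<close>

lemma mem_polycell_iff:
  assumes K: "polycell (K::(real^'n) set)"
  shows "x \<in> K \<longleftrightarrow> (\<forall>F\<in>faces K. outward_normal K F \<bullet> x < face_offset K F)"
proof
  assume "x \<in> K" then show "\<forall>F\<in>faces K. outward_normal K F \<bullet> x < face_offset K F"
    using cell_below_face[OF K] by blast
next
  assume lt: "\<forall>F\<in>faces K. outward_normal K F \<bullet> x < face_offset K F"
  show "x \<in> K"
  proof (rule ccontr)
    assume x: "x \<notin> K"
    obtain c where c: "c \<in> K" using K by (auto simp: polycell_def)
    have conn: "connected (closed_segment c x)" by (rule connected_segment)
    have "closed_segment c x \<inter> frontier K \<noteq> {}"
      by (rule connected_Int_frontier[OF conn]) (use c x in auto)
    then obtain z where z: "z \<in> closed_segment c x" "z \<in> frontier K" by auto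
    have ri: "rel_interior (closure K) = K"
    proof -
      have "rel_interior (closure K) = interior (closure K)"
        using K by (metis polycell_def interior_eq interior_mono closure_subset rel_interior_nonempty_interior subset_empty)
      also have "\<dots> = K" using K by (metis polycell_def convex_interior_closure interior_eq)
      finally show ?thesis .
    qed
    have "z \<in> closure K - rel_interior (closure K)"
      using z(2) K ri by (auto simp: frontier_def polycell_def interior_open)
    also have "\<dots> = \<Union>{F. F facet_of closure K}"
      using K polytope_imp_polyhedron by (intro rel_boundary_of_polyhedron) (auto simp: polycell_def)
    finally obtain F where F: "F \<in> faces K" "z \<in> F" by (auto simp: faces_def)
    let ?n = "outward_normal K F"
    have "z \<in> {y. ?n \<bullet> y < face_offset K F}"
    proof -
      have "closed_segment c x \<subseteq> {y. ?n \<bullet> y < face_offset K F}"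
        by (rule closed_segment_subset) (use c lt F cell_below_face[OF K] in \<open>auto simp: convex_halfspace_lt\<close>)
      then show ?thesis using z by auto
    qed
    moreover have "?n \<bullet> z = face_offset K F"
      using face_eq[OF K F(1)] F(2) by blast
    ultimately show False by auto
  qed
qed

lemma mem_closure_polycell_iff:
  assumes K: "polycell (K::(real^'n) set)"
  shows "x \<in> closure K \<longleftrightarrow> (\<forall>F\<in>faces K. outward_normal K F \<bullet> x \<le> face_offset K F)"
proof
  assume "x \<in> closure K" then show "\<forall>F\<in>faces K. outward_normal K F \<bullet> x \<le> face_offset K F"
    using closure_below_face[OF K] by blast
next
  assume le: "\<forall>F\<in>faces K. outward_normal K F \<bullet> x \<le> face_offset K F"
  obtain c where c: "c \<in> K" using K by (auto simp: polycell_def)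
  \<comment> \<open>Points on the segment from \<open>x\<close> to the inner point \<open>c\<close>
    that converge to \<open>x\<close>; the share of \<open>c\<close> makes every inequality
    strict.\<close>
  define z where "z m = x + inverse (real (Suc m)) *\<^sub>R (c - x)" for m
  have "z m \<in> K" for m
  proof -
    define e where "e = inverse (real (Suc m))"
    have e: "0 < e" "e \<le> 1" by (auto simp: e_def divide_simps)
    have "outward_normal K F \<bullet> z m < face_offset K F" if F: "F \<in> faces K" for F
    proof -
      have "outward_normal K F \<bullet> z m = (1 - e) * (outward_normal K F \<bullet> x) + e * (outward_normal K F \<bullet> c)"
        by (simp add: z_def e_def inner_add_right inner_diff_right algebra_simps)
      also have "\<dots> < (1 - e) * face_offset K F + e * face_offset K F"
        using e le F cell_below_face[OF K F c] by (intro add_le_less_mono mult_left_mono mult_strict_left_mono) auto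
      finally show ?thesis by (simp add: algebra_simps)
    qed
    then show ?thesis using mem_polycell_iff[OF K] by blast
  qed
  moreover have "z \<longlonglongrightarrow> x + 0 *\<^sub>R (c - x)"
    unfolding z_def by (intro tendsto_intros LIMSEQ_inverse_real_of_nat)
  ultimately show "x \<in> closure K"
    by (auto simp: closure_sequential)
qed

text \<open>A face is the set where the functional given by its normal attains its maximum over the
  closed cell, so the normal determines the offset.\<close>

lemma face_inj_normal:
  assumes K: "polycell (K::(real^'n) set)" and "F \<in> faces K" "G \<in> faces K"
    and eq: "outward_normal K F = outward_normal K G"
  shows "F = G"
proof -
  have le: "face_offset K F \<le> face_offset K G"
    if FG: "F \<in> faces K" "G \<in> faces K" "outward_normal K F = outward_normal K G" for F G
  proof -
    obtain x where "x \<in> F" using face_nonempty[OF K FG(1)] by blast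
    then have "x \<in> closure K" "outward_normal K F \<bullet> x = face_offset K F"
      using face_eq[OF K FG(1)] by blast+
    then show ?thesis using closure_below_face[OF K FG(2)] FG(3) by metis
  qed
  have "face_offset K F = face_offset K G"
    using le[of F G] le[of G F] assms by simp
  then show ?thesis using face_eq[OF K assms(2)] face_eq[OF K assms(3)] eq by simp
qed

lemma compact_face: "polycell K \<Longrightarrow> F \<in> faces K \<Longrightarrow> compact F"
  by (metis polycell_def faces_def mem_Collect_eq face_of_imp_compact facet_of_imp_face_of
      polytope_imp_compact polytope_imp_convex)

lemma convex_face: "F \<in> faces K \<Longrightarrow> convex F"
  unfolding faces_def using face_of_imp_convex facet_of_imp_face_of by auto

lemma facet_subset_eq:
  assumes "F facet_of S" "G facet_of S" "F \<subseteq> G" "convex S"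
  shows "F = G"
proof (rule ccontr)
  assume "F \<noteq> G"
  have "F face_of G"
    using assms by (meson face_of_subset facet_of_imp_face_of facet_of_imp_subset)
  then have "aff_dim F < aff_dim G"
    using \<open>F \<noteq> G\<close> assms face_of_aff_dim_lt face_of_imp_convex facet_of_imp_face_of by metis
  then show False using assms by (simp add: facet_of_def)
qed

text \<open>A face that meets the relative interior of \<open>F\<close> contains \<open>F\<close>,
  and no facet contains another one.\<close>

lemma rel_interior_face_below:
  assumes K: "polycell (K::(real^'n) set)" and F: "F \<in> faces K" and G: "G \<in> faces K" "G \<noteq> F"
    and x: "x \<in> rel_interior F"
  shows "outward_normal K G \<bullet> x < face_offset K G"
proof (rule ccontr)
  assume "\<not> ?thesis"
  moreover have xF: "x \<in> F" using x rel_interior_subset by blast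
  moreover from this have xK: "x \<in> closure K" using face_eq[OF K F] by blast
  ultimately have "x \<in> G"
    using closure_below_face[OF K G(1)] face_eq[OF K G(1)] by fastforce
  then have "F \<subseteq> G"
    using G F x by (intro subset_of_face_of[of G "closure K"]) (auto simp: faces_def facet_of_imp_face_of facet_of_imp_subset)
  then show False
    using facet_subset_eq[of F "closure K" G] G F K polytope_imp_convex by (auto simp: faces_def polycell_def)
qed

lemma inside_rel_interior_face:
  assumes K: "polycell (K::(real^'n) set)" and F: "F \<in> faces K" and x: "x \<in> rel_interior F"
  obtains d where "d > 0" "\<And>s. 0 < s \<Longrightarrow> s < d \<Longrightarrow> x - s *\<^sub>R outward_normal K F \<in> K"
proof -
  let ?n = "outward_normal K F"
  have "\<exists>d>0. \<forall>s. 0 < s \<and> s < d \<longrightarrow> outward_normal K G \<bullet> (x - s *\<^sub>R ?n) < face_offset K G"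
    if G: "G \<in> faces K" for G
  proof (cases "G = F")
    case True
    have "x \<in> F" using x rel_interior_subset by blast
    then have "?n \<bullet> x = face_offset K F" using face_eq[OF K F] by blast
    then show ?thesis
      using True norm_outward_normal[OF K F]
      by (intro exI[of _ 1]) (auto simp: inner_diff_right dot_square_norm)
  next
    case False
    have lt: "outward_normal K G \<bullet> x < face_offset K G"
      by (rule rel_interior_face_below[OF K F G False x])
    \<comment> \<open>The normals are unit vectors, so a step of length \<open>s\<close> changes the
      functional of \<open>G\<close> by at most \<open>s\<close>, and its slack at \<open>x\<close>
      bounds the admissible steps.\<close>
    let ?d = "face_offset K G - outward_normal K G \<bullet> x"
    have "outward_normal K G \<bullet> (x - s *\<^sub>R ?n) < face_offset K G" if "0 < s" "s < ?d" for s
    proof -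
      have "\<bar>outward_normal K G \<bullet> ?n\<bar> \<le> 1"
        using Cauchy_Schwarz_ineq2[of "outward_normal K G" ?n] norm_outward_normal[OF K] F G by simp
      then have "s * - (outward_normal K G \<bullet> ?n) \<le> s * 1"
        using that by (intro mult_left_mono) auto
      then show ?thesis using that by (simp add: inner_diff_right)
    qed
    then show ?thesis using lt by (intro exI[of _ ?d]) auto
  qed
  then obtain d where d: "\<And>G. G \<in> faces K \<Longrightarrow> d G > 0"
    "\<And>G s. G \<in> faces K \<Longrightarrow> 0 < s \<Longrightarrow> s < d G \<Longrightarrow> outward_normal K G \<bullet> (x - s *\<^sub>R ?n) < face_offset K G"
    by metis
  have "Min (d ` faces K) > 0"
    using d F finite_faces[OF K] by (subst Min_gr_iff) auto
  moreover have "x - s *\<^sub>R ?n \<in> K" if s: "0 < s" "s < Min (d ` faces K)" for s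
  proof -
    have "s < d G" if "G \<in> faces K" for G
      using s that finite_faces[OF K] by (meson Min_le finite_imageI image_eqI less_le_trans)
    then show ?thesis using d s mem_polycell_iff[OF K] by blast
  qed
  ultimately show ?thesis using that by blast
qed

lemma unit_normal_outward_normal:
  assumes K: "polycell (K::(real^'n) set)" and F: "F \<in> faces K"
  shows "unit_normal F (outward_normal K F)"
proof -
  have "outward_normal K F \<bullet> (x - y) = 0" if "x \<in> F" "y \<in> F" for x y
    using that face_eq[OF K F] unfolding inner_diff_right by (metis (mono_tags, lifting) IntE diff_self mem_Collect_eq)
  then show ?thesis
    unfolding unit_normal_def using norm_outward_normal[OF K F] by blast
qed

text \<open>If the normals agreed, points just below the relative interior of the common face would
  belong to both cells.\<close>

lemma opposite_outward_normal:
  assumes K: "polycell (K::(real^'n) set)" and L: "polycell L" and "K \<inter> L = {}"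
    and F: "F \<in> faces K" "F \<in> faces L"
  shows "outward_normal L F = - outward_normal K F"
proof (rule ccontr)
  assume "\<not> ?thesis"
  then have eq: "outward_normal L F = outward_normal K F"
    using unit_normal_unique[OF affine_hull_face[OF K F(1)] norm_outward_normal[OF K F(1)]
        unit_normal_outward_normal[OF L F(2)]] by auto
  obtain x where x: "x \<in> rel_interior F"
    using face_nonempty[OF K F(1)] convex_face[OF F(1)] rel_interior_eq_empty by blast
  obtain d where d: "d > 0" "\<And>s. 0 < s \<Longrightarrow> s < d \<Longrightarrow> x - s *\<^sub>R outward_normal K F \<in> K"
    using inside_rel_interior_face[OF K F(1) x] by blast
  obtain e where e: "e > 0" "\<And>s. 0 < s \<Longrightarrow> s < e \<Longrightarrow> x - s *\<^sub>R outward_normal L F \<in> L"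
    using inside_rel_interior_face[OF L F(2) x] by blast
  let ?s = "min d e / 2"
  have s: "0 < ?s" "?s < d" "?s < e" using d(1) e(1) by linarith+
  have "x - ?s *\<^sub>R outward_normal K F \<in> K" by (rule d(2)[OF s(1,2)])
  moreover have "x - ?s *\<^sub>R outward_normal K F \<in> L" using e(2)[OF s(1,3)] eq by simp
  ultimately show False using \<open>K \<inter> L = {}\<close> by blast
qed

section \<open>Adjacency in a mesh\<close>

lemma meshD:
  assumes "is_mesh c \<Omega> \<T>"
  shows "open \<Omega>" "finite \<T>" "\<And>K. K \<in> \<T> \<Longrightarrow> is_cell c K" "closure \<Omega> = (\<Union>K\<in>\<T>. closure K)"
    "\<And>K L. K \<in> \<T> \<Longrightarrow> L \<in> \<T> \<Longrightarrow> K \<noteq> L \<Longrightarrow> K \<inter> L = {}"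
    "\<And>K L. K \<in> \<T> \<Longrightarrow> L \<in> \<T> \<Longrightarrow> closure K \<inter> closure L face_of closure K"
  using assms unfolding is_mesh_def by simp_all

lemma mesh_polycell: "is_mesh c \<Omega> \<T> \<Longrightarrow> K \<in> \<T> \<Longrightarrow> polycell K"
  by (rule is_cell_imp_polycell[OF meshD(3)])

lemma mesh_opposite_normal:
  assumes "is_mesh c \<Omega> \<T>" "K \<in> \<T>" "L \<in> \<T>" "K \<noteq> L" "F \<in> faces K" "F \<in> faces L"
  shows "outward_normal L F = - outward_normal K F"
proof (rule opposite_outward_normal)
  show "polycell K" by (rule mesh_polycell[OF assms(1,2)])
  show "polycell L" by (rule mesh_polycell[OF assms(1,3)])
  show "K \<inter> L = {}" by (rule meshD(5)[OF assms(1-4)])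
qed (use assms in auto)

text \<open>Three cells at one face would need three pairwise opposite normals.\<close>

lemma mesh_face_two_cells:
  assumes mesh: "is_mesh c \<Omega> \<T>" and K: "K \<in> \<T>" "L \<in> \<T>" "M \<in> \<T>" "K \<noteq> L" "K \<noteq> M"
    and F: "F \<in> faces K" "F \<in> faces L" "F \<in> faces M"
  shows "L = M"
proof (rule ccontr)
  assume "L \<noteq> M"
  have "outward_normal M F = - outward_normal L F"
    by (rule mesh_opposite_normal[OF mesh K(2,3) \<open>L \<noteq> M\<close> F(2,3)])
  moreover have "outward_normal L F = - outward_normal K F"
    by (rule mesh_opposite_normal[OF mesh K(1,2,4) F(1,2)])
  moreover have "outward_normal M F = - outward_normal K F"
    by (rule mesh_opposite_normal[OF mesh K(1,3,5) F(1,3)])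
  ultimately have "outward_normal K F = - outward_normal K F" by simp
  then have "outward_normal K F = 0" by (simp add: vec_eq_iff)
  then show False using outward_normal_nonzero[OF mesh_polycell[OF mesh K(1)] F(1)] by simp
qed

text \<open>Beyond a point of \<open>F\<close> inside \<Omega> there is more of \<Omega>, hence
  another cell whose closure touches \<open>F\<close> there; conformity turns this contact into a
  common face.\<close>

lemma mesh_neighbour:
  assumes mesh: "is_mesh c \<Omega> \<T>" and K: "K \<in> \<T>" and F: "F \<in> faces K" and nf: "\<not> F \<subseteq> frontier \<Omega>"
  obtains L where "L \<in> \<T>" "L \<noteq> K" "F \<in> faces L"
proof -
  have pc: "polycell K" by (rule mesh_polycell[OF mesh K])
  note op = meshD(1)[OF mesh] and fin = meshD(2)[OF mesh] and clos = meshD(4)[OF mesh]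
  let ?n = "outward_normal K F"
  have FK: "F \<subseteq> closure K" using face_eq[OF pc F] by blast
  have "F \<subseteq> closure \<Omega>" using FK clos K by blast
  then obtain y where y: "y \<in> F" "y \<in> \<Omega>"
    using nf op by (auto simp: frontier_def interior_open)
  have "y \<in> closure (rel_interior F)"
    using y convex_face[OF F] convex_closure_rel_interior closure_subset by blast
  then obtain x where x: "x \<in> rel_interior F" "x \<in> \<Omega>"
    using y op closure_iff_nhds_not_empty by (metis Int_iff disjoint_iff subset_refl)
  have xF: "x \<in> F" using x rel_interior_subset by blast
  \<comment> \<open>Otherwise a ball about \<open>x\<close> would meet no closed cell but that of
    \<open>K\<close>, and its points on the outer side of \<open>F\<close> would be beyond the face
    and yet in \<open>closure K\<close>.\<close>
  have "\<exists>L\<in>\<T>. L \<noteq> K \<and> x \<in> closure L"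
  proof (rule ccontr)
    assume no: "\<not> ?thesis"
    define C where "C = (\<Union>L\<in>\<T> - {K}. closure L)"
    have "closed C" unfolding C_def using fin by (intro closed_UN) auto
    then have opn: "open (\<Omega> - C)" using op by (rule open_Diff[rotated])
    have "x \<in> \<Omega> - C" using x(2) no unfolding C_def by auto
    then have "\<exists>e>0. ball x e \<subseteq> \<Omega> - C" using opn unfolding open_contains_ball by (rule bspec[rotated])
    then obtain e where e: "e > 0" "ball x e \<subseteq> \<Omega> - C" by (elim exE conjE)
    let ?z = "x + (e/2) *\<^sub>R ?n"
    have "dist x ?z < e"
      using e(1) norm_outward_normal[OF pc F] by (simp add: dist_norm)
    then have z: "?z \<in> \<Omega> - C"
      using e(2) by (simp add: subset_iff)
    then have "?z \<in> (\<Union>K\<in>\<T>. closure K)" using closure_subset[of \<Omega>] unfolding clos by (simp add: subset_iff)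
    then have "?z \<in> closure K" using z unfolding C_def by auto
    then have "?n \<bullet> ?z \<le> face_offset K F" by (rule closure_below_face[OF pc F])
    moreover have "?n \<bullet> x = face_offset K F" using xF face_eq[OF pc F] by blast
    ultimately show False
      using e norm_outward_normal[OF pc F] by (simp add: inner_add_right dot_square_norm)
  qed
  then obtain L where L: "L \<in> \<T>" "L \<noteq> K" "x \<in> closure L" by blast
  have pl: "polycell L" by (rule mesh_polycell[OF mesh L(1)])
  \<comment> \<open>By conformity \<open>?G\<close> is a face of both closed cells. It contains
    \<open>F\<close> and is not all of \<open>closure K\<close>, so it has the dimension of
    \<open>F\<close> and equals \<open>F\<close>.\<close>
  let ?G = "closure K \<inter> closure L"
  have GK: "?G face_of closure K" and GL: "?G face_of closure L"
    using meshD(6)[OF mesh K L(1)] meshD(6)[OF mesh L(1) K] by (simp_all add: Int_commute)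
  have disj: "K \<inter> L = {}" using meshD(5)[OF mesh K L(1)] L(2) by simp
  have "F \<subseteq> ?G"
    using GK FK x L xF by (intro subset_of_face_of[OF GK FK]) auto
  have "?G \<noteq> closure K"
  proof
    assume "?G = closure K"
    then have "K \<subseteq> closure L" using closure_subset by blast
    moreover have "K \<inter> closure L = {}"
      using disj pc open_Int_closure_eq_empty by (metis polycell_def)
    ultimately show False using pc by (auto simp: polycell_def)
  qed
  then have "aff_dim ?G < aff_dim (closure K)"
    using face_of_aff_dim_lt[OF _ GK] pc by (auto simp: polycell_def polytope_imp_convex)
  moreover have "aff_dim F = aff_dim (closure K) - 1"
    using F by (simp add: faces_def facet_of_def)
  ultimately have "aff_dim F = aff_dim ?G"
    using aff_dim_subset[OF \<open>F \<subseteq> ?G\<close>] by linarith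
  have ch: "F face_of ?G"
    using F GK face_of_subset \<open>F \<subseteq> ?G\<close> by (metis (no_types, lifting) faces_def facet_of_imp_face_of inf_le1 mem_Collect_eq)
  have "F = ?G"
  proof (rule ccontr)
    assume "F \<noteq> ?G"
    then have "aff_dim F < aff_dim ?G"
      using face_of_aff_dim_lt[OF _ ch] GK face_of_imp_convex by blast
    then show False using \<open>aff_dim F = aff_dim ?G\<close> by simp
  qed
  then have "F face_of closure L" using GL by simp
  moreover have "aff_dim F = aff_dim (closure L) - 1"
    using F polycell_aff_dim_closure[OF pl] polycell_aff_dim_closure[OF pc] by (simp add: faces_def facet_of_def)
  ultimately have "F \<in> faces L"
    using face_nonempty[OF pc F] by (simp add: faces_def facet_of_def)
  then show ?thesis using that L by blast
qed

section \<open>Integration over faces and cells\<close>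

text \<open>For a unit vector \<open>n\<close> this is the orthogonal projection to the hyperplane
  at level \<open>b\<close>, the explicit form of the \<open>closest_point\<close> in
  \<open>face_measure\<close>.\<close>

definition hproj :: "real^'n \<Rightarrow> real \<Rightarrow> real^'n \<Rightarrow> real^'n" where
  "hproj n b y = y - (n \<bullet> y - b) *\<^sub>R n"

text \<open>The region of thickness 1 over which \<open>face_measure\<close> integrates, with
  projection and distance given by formulas.\<close>

definition slab :: "real^'n \<Rightarrow> real \<Rightarrow> (real^'n) set \<Rightarrow> (real^'n) set" where
  "slab n b F = {y. hproj n b y \<in> F \<and> \<bar>n \<bullet> y - b\<bar> \<le> 1 / 2}"

abbreviation fproj :: "(real^'n) set \<Rightarrow> (real^'n) set \<Rightarrow> real^'n \<Rightarrow> real^'n" where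
  "fproj K F \<equiv> hproj (outward_normal K F) (face_offset K F)"

abbreviation fslab :: "(real^'n) set \<Rightarrow> (real^'n) set \<Rightarrow> (real^'n) set" where
  "fslab K F \<equiv> slab (outward_normal K F) (face_offset K F) F"

lemma continuous_hproj: "continuous_on S (hproj n b)"
  unfolding hproj_def by (intro continuous_intros)

lemma inner_hproj: "norm n = 1 \<Longrightarrow> n \<bullet> hproj n b y = b"
  by (simp add: hproj_def inner_diff_right dot_square_norm)

lemma dist_hproj: "norm n = 1 \<Longrightarrow> dist y (hproj n b y) = \<bar>n \<bullet> y - b\<bar>"
  by (simp add: hproj_def dist_norm)

lemma hproj_nearest:
  assumes n: "norm n = 1" and z: "n \<bullet> z = b"
  shows "dist y (hproj n b y) \<le> dist y z"
proof -
  have "n \<bullet> y - b = n \<bullet> (y - z)" using z by (simp add: inner_diff_right)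
  then have "\<bar>n \<bullet> y - b\<bar> \<le> norm (y - z)"
    using Cauchy_Schwarz_ineq2[of n "y - z"] n by simp
  then show ?thesis using dist_hproj[OF n] by (simp add: dist_norm)
qed

lemma closest_point_hyperplane:
  assumes n: "norm n = 1"
  shows "closest_point {x. n \<bullet> x = b} = hproj n b"
proof
  fix y
  show "closest_point {x. n \<bullet> x = b} y = hproj n b y"
    by (rule closest_point_unique[symmetric])
      (use n in \<open>auto simp: convex_hyperplane closed_hyperplane inner_hproj intro: hproj_nearest\<close>)
qed

lemma infdist_hyperplane:
  assumes n: "norm (n :: real^'n) = 1"
  shows "infdist y {x. n \<bullet> x = b} = \<bar>n \<bullet> y - b\<bar>"
proof -
  have "hproj n b y \<in> {x. n \<bullet> x = b}" using inner_hproj[OF n] by simp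
  then have "{x. n \<bullet> x = b} \<noteq> {}" by blast
  then show ?thesis
    using setdist_closest_point[OF closed_hyperplane[of n b], of y] dist_hproj[OF n]
    by (simp add: infdist_eq_setdist closest_point_hyperplane[OF n])
qed

text \<open>Pythagoras, for the projection to a hyperplane through \<open>x\<close>.\<close>

lemma dist_hproj_le:
  assumes n: "norm n = 1" and x: "n \<bullet> x = b"
  shows "dist (hproj n b y) x \<le> dist y x"
proof -
  let ?v = "y - x"
  have eq: "hproj n b y - x = ?v - (n \<bullet> ?v) *\<^sub>R n"
    using x by (simp add: hproj_def inner_diff_right)
  have "(norm (hproj n b y - x))\<^sup>2 = (norm ?v)\<^sup>2 - (n \<bullet> ?v)\<^sup>2"
  proof -
    have "n \<bullet> n = 1" using n by (simp add: dot_square_norm)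
    then have "(v - (n \<bullet> v) *\<^sub>R n) \<bullet> (v - (n \<bullet> v) *\<^sub>R n) = v \<bullet> v - (n \<bullet> v)\<^sup>2" for v
      by (simp add: inner_diff_left inner_diff_right inner_commute[of v n] power2_eq_square)
    then show ?thesis unfolding eq power2_norm_eq_inner by blast
  qed
  then have "(norm (hproj n b y - x))\<^sup>2 \<le> (norm ?v)\<^sup>2" by simp
  then show ?thesis by (simp add: dist_norm)
qed

lemma compact_slab:
  assumes n: "norm n = 1" and F: "compact F"
  shows "compact (slab n b F)"
proof -
  have "slab n b F = (hproj n b -` F) \<inter> {y. \<bar>n \<bullet> y - b\<bar> \<le> 1 / 2}"
    by (auto simp: slab_def)
  moreover have "closed (hproj n b -` F)"
    using compact_imp_closed[OF F] continuous_hproj[of UNIV n b] by (simp add: continuous_on_closed_vimage)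
  moreover have "closed {y. \<bar>n \<bullet> y - b\<bar> \<le> 1 / 2}"
    by (intro closed_Collect_le continuous_intros)
  ultimately have "closed (slab n b F)" using closed_Int by metis
  moreover obtain B where B: "\<And>x. x \<in> F \<Longrightarrow> norm x \<le> B"
    using compact_imp_bounded[OF F] by (auto simp: bounded_iff)
  have "norm y \<le> B + 1 / 2" if "y \<in> slab n b F" for y
  proof -
    have "dist y (hproj n b y) \<le> 1 / 2"
      unfolding dist_hproj[OF n] using that by (simp add: slab_def)
    moreover have "norm (hproj n b y) \<le> B" using that B by (simp add: slab_def)
    moreover have "norm y \<le> norm (hproj n b y) + dist y (hproj n b y)"
      by (metis dist_norm norm_triangle_sub)
    ultimately show ?thesis by linarith
  qed
  then have "bounded (slab n b F)" by (auto simp: bounded_iff)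
  ultimately show ?thesis by (simp add: compact_eq_bounded_closed)
qed

context
  fixes K F :: "(real^'n) set"
  assumes K: "polycell K" and F: "F \<in> faces K"
begin

lemma compact_fslab: "compact (fslab K F)"
  by (rule compact_slab[OF norm_outward_normal[OF K F] compact_face[OF K F]])

lemma fslab_borel: "fslab K F \<in> sets borel"
  using compact_fslab compact_imp_closed borel_closed by blast

lemma face_borel: "F \<in> sets borel"
  using compact_face[OF K F] compact_imp_closed borel_closed by blast

lemma face_measure_eq:
  "face_measure F = distr (restrict_space lborel (fslab K F)) borel (fproj K F)"
  unfolding face_measure_def affine_hull_face[OF K F]
    closest_point_hyperplane[OF norm_outward_normal[OF K F]]
    infdist_hyperplane[OF norm_outward_normal[OF K F]] slab_def ..

lemma fproj_measurable: "fproj K F \<in> measurable (restrict_space lborel (fslab K F)) borel"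
proof -
  have "fproj K F \<in> borel_measurable borel"
    by (rule borel_measurable_continuous_onI[OF continuous_hproj])
  then show ?thesis by (intro measurable_restrict_space1) simp
qed

text \<open>The total mass is the volume of a bounded slab.\<close>

lemma finite_face_measure: "finite_measure (face_measure F)"
proof
  have sp: "fproj K F -` UNIV \<inter> space (restrict_space lborel (fslab K F)) = fslab K F"
    by (simp add: space_restrict_space)
  have "emeasure (face_measure F) (space (face_measure F))
      = emeasure (restrict_space lborel (fslab K F)) (fslab K F)"
    unfolding face_measure_eq using fproj_measurable sp by (simp add: emeasure_distr)
  also have "\<dots> = emeasure lborel (fslab K F)"
    using fslab_borel by (intro emeasure_restrict_space) auto
  also have "\<dots> < \<infinity>"
    using emeasure_bounded_finite[OF compact_imp_bounded[OF compact_fslab]] by simp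
  finally show "emeasure (face_measure F) (space (face_measure F)) \<noteq> \<infinity>" by simp
qed

lemma face_integrable:
  fixes g :: "real^'n \<Rightarrow> 'b::{banach, second_countable_topology}"
  assumes g: "continuous_on F g"
  shows "set_integrable (face_measure F) F g"
proof -
  have "compact (g ` F)" by (rule compact_continuous_image[OF g compact_face[OF K F]])
  then have "bounded (g ` F)" by (rule compact_imp_bounded)
  then obtain B where "\<forall>y\<in>g ` F. norm y \<le> B" unfolding bounded_iff by (elim exE)
  then have B: "\<And>x. x \<in> F \<Longrightarrow> norm (g x) \<le> B" by simp
  have "(\<lambda>x. indicator F x *\<^sub>R g x) \<in> borel_measurable (face_measure F)"
    using borel_measurable_continuous_on_indicator[OF face_borel g] by (simp add: face_measure_def)
  moreover have "norm (indicator F x *\<^sub>R g x) \<le> max B 0" for x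
    using B[of x] by (auto simp: indicator_def)
  ultimately show ?thesis
    unfolding set_integrable_def using finite_face_measure
    by (intro finite_measure.integrable_const_bound[of _ _ "max B 0"]) auto
qed

text \<open>The form in which surface integrals meet Lebesgue integrals: prism integrals tend to it
  in the divergence theorem, and positivity is tested on it.\<close>

lemma face_integral_slab:
  fixes g :: "real^'n \<Rightarrow> 'b::{banach, second_countable_topology}"
  assumes g: "continuous_on F g"
  shows "(LINT x:F|face_measure F. g x) = (LINT y|lborel. indicator (fslab K F) y *\<^sub>R g (fproj K F y))"
proof -
  have meas: "(\<lambda>x. indicator F x *\<^sub>R g x) \<in> borel_measurable borel"
    by (rule borel_measurable_continuous_on_indicator[OF face_borel g])
  have "(LINT x:F|face_measure F. g x)
      = integral\<^sup>L (restrict_space lborel (fslab K F)) (\<lambda>y. indicator F (fproj K F y) *\<^sub>R g (fproj K F y))"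
    unfolding set_lebesgue_integral_def face_measure_eq
    by (rule integral_distr[OF fproj_measurable meas])
  also have "\<dots> = (LINT y|lborel. indicator (fslab K F) y *\<^sub>R (indicator F (fproj K F y) *\<^sub>R g (fproj K F y)))"
    using fslab_borel by (intro integral_restrict_space) auto
  also have "\<dots> = (LINT y|lborel. indicator (fslab K F) y *\<^sub>R g (fproj K F y))"
    by (intro Bochner_Integration.integral_cong) (auto simp: indicator_def slab_def)
  finally show ?thesis .
qed

end

section \<open>Nonnegative continuous integrands with zero integral\<close>

lemma pos_on_open_integral:
  fixes f :: "real^'n \<Rightarrow> real"
  assumes int: "integrable lborel f" and nn: "\<And>x. f x \<ge> 0" and "open U" "U \<noteq> {}"
    and pos: "\<And>x. x \<in> U \<Longrightarrow> f x > 0"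
  shows "(LINT x|lborel. f x) \<noteq> 0"
proof
  assume "(LINT x|lborel. f x) = 0"
  then have "AE x in lborel. f x = 0"
    using integral_nonneg_eq_0_iff_AE[OF int] nn by simp
  then have "AE x in lborel. x \<notin> U"
    by (rule AE_mp) (use pos in force)
  then have "U \<in> null_sets lborel"
    using AE_iff_null_sets[of U lborel] borel_open[OF \<open>open U\<close>] by simp
  then have "negligible U"
    by (simp add: negligible_iff_null_sets null_sets_completionI)
  then show False using open_not_negligible assms by blast
qed

text \<open>The face itself has volume zero, so positivity of \<open>g\<close> is carried over to a
  ball inside the slab.\<close>

lemma face_integral_zero:
  fixes g :: "real^'n \<Rightarrow> real"
  assumes K: "polycell K" and F: "F \<in> faces K" and g: "continuous_on F g" and nn: "\<And>x. x \<in> F \<Longrightarrow> g x \<ge> 0"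
    and zero: "(LINT x:F|face_measure F. g x) = 0" and x: "x \<in> F"
  shows "g x = 0"
proof (rule ccontr)
  assume "g x \<noteq> 0"
  then have gx: "g x > 0" using nn[OF x] by simp
  let ?n = "outward_normal K F"
  note n1 = norm_outward_normal[OF K F]
  obtain d where d: "d > 0" "\<And>y. y \<in> F \<Longrightarrow> dist y x < d \<Longrightarrow> dist (g y) (g x) < g x"
    using g x gx unfolding continuous_on_iff by blast
  have "x \<in> closure (rel_interior F)"
    using x convex_face[OF F] convex_closure_rel_interior closure_subset by blast
  then obtain z where z: "z \<in> rel_interior F" "dist z x < d"
    using d(1) unfolding closure_approachable by blast
  obtain e where e: "e > 0" "ball z e \<inter> affine hull F \<subseteq> F"
    using z(1) unfolding mem_rel_interior_ball by blast
  \<comment> \<open>The three bounds keep the projection of the ball in \<open>F\<close>, keep it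
    where \<open>g\<close> is still positive, and keep the ball itself within the slab of half-width
    1/2.\<close>
  define r where "r = min e (min (d - dist z x) (1/2))"
  have r: "r > 0" "r \<le> e" "r \<le> d - dist z x" "r \<le> 1/2"
    using e(1) z(2) by (auto simp: r_def min_def)
  have zF: "z \<in> F" using z(1) rel_interior_subset by blast
  then have nz: "?n \<bullet> z = face_offset K F" using face_eq[OF K F] by blast
  have in_slab: "y \<in> fslab K F \<and> g (fproj K F y) > 0" if y: "y \<in> ball z r" for y
  proof -
    have yz: "dist y z < r" using y by (simp add: dist_commute)
    have pz: "dist (fproj K F y) z < r"
      using dist_hproj_le[OF n1 nz] yz by (rule le_less_trans)
    have "fproj K F y \<in> affine hull F"
      using affine_hull_face[OF K F] inner_hproj[OF n1] by simp
    moreover have "fproj K F y \<in> ball z e" using pz r by (simp add: dist_commute)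
    ultimately have pF: "fproj K F y \<in> F" using e(2) by blast
    have "dist (fproj K F y) x < d"
      using dist_triangle[of "fproj K F y" x z] pz r by linarith
    then have "dist (g (fproj K F y)) (g x) < g x" using d(2) pF by blast
    then have gp: "g (fproj K F y) > 0" by (simp add: dist_real_def)
    have "\<bar>?n \<bullet> y - face_offset K F\<bar> = dist y (fproj K F y)"
      by (simp add: dist_hproj[OF n1])
    also have "\<dots> \<le> dist y z" by (rule hproj_nearest[OF n1 nz])
    finally show ?thesis using pF gp yz r by (simp add: slab_def)
  qed
  define h where "h y = indicator (fslab K F) y *\<^sub>R g (fproj K F y)" for y
  have "continuous_on (fslab K F) (\<lambda>y. g (fproj K F y))"
    by (rule continuous_on_compose2[OF g continuous_hproj]) (auto simp: slab_def)
  then have "integrable lborel h"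
    unfolding h_def by (rule borel_integrable_compact[OF compact_fslab[OF K F]])
  moreover have "h y \<ge> 0" for y using nn by (auto simp: h_def indicator_def slab_def)
  moreover have "h y > 0" if "y \<in> ball z r" for y using in_slab[OF that] by (simp add: h_def)
  ultimately have "(LINT y|lborel. h y) \<noteq> 0"
    using r(1) by (intro pos_on_open_integral[of h "ball z r"]) auto
  then show False using zero face_integral_slab[OF K F g] by (simp add: h_def)
qed

lemma cell_integrable:
  fixes f :: "real^'n \<Rightarrow> 'b::{banach, second_countable_topology}"
  assumes K: "polycell K" and f: "continuous_on UNIV f"
  shows "integrable lborel (\<lambda>x. indicator K x *\<^sub>R f x)" "set_integrable lebesgue K f"
proof -
  have comp: "compact (closure K)" using K polytope_imp_compact unfolding polycell_def by metis
  have "set_integrable lborel (closure K) f"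
    unfolding set_integrable_def
    by (rule borel_integrable_compact[OF comp continuous_on_subset[OF f]]) simp
  then have int: "set_integrable lborel K f"
    by (rule set_integrable_subset) (use K in \<open>auto simp: polycell_def closure_subset\<close>)
  then show "integrable lborel (\<lambda>x. indicator K x *\<^sub>R f x)" by (simp add: set_integrable_def)
  then show "set_integrable lebesgue K f"
    unfolding set_integrable_def by (subst integrable_completion) (auto dest: borel_measurable_integrable)
qed

lemma cell_integral_lborel:
  fixes f :: "real^'n \<Rightarrow> 'b::{banach, second_countable_topology}"
  assumes K: "polycell K" and f: "continuous_on UNIV f"
  shows "(LINT x:K|lebesgue. f x) = (LINT x|lborel. indicator K x *\<^sub>R f x)"
  unfolding set_lebesgue_integral_def
  by (rule integral_completion) (use cell_integrable(1)[OF assms] in \<open>auto dest: borel_measurable_integrable\<close>)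

lemma cell_integral_zero:
  fixes g :: "real^'n \<Rightarrow> real"
  assumes K: "polycell K" and g: "continuous_on UNIV g" and nn: "\<And>x. g x \<ge> 0"
    and zero: "(LINT x:K|lebesgue. g x) = 0" and x: "x \<in> K"
  shows "g x = 0"
proof (rule ccontr)
  assume "g x \<noteq> 0"
  then have gx: "g x > 0" using nn[of x] by simp
  let ?U = "K \<inter> {y. g y > 0}"
  have "open ?U"
    using K by (intro open_Int open_Collect_less continuous_intros g) (auto simp: polycell_def)
  moreover have "?U \<noteq> {}" using x gx by blast
  ultimately have "(LINT y|lborel. indicator K y *\<^sub>R g y) \<noteq> 0"
    using cell_integrable(1)[OF K g] nn by (intro pos_on_open_integral[of _ ?U]) (auto simp: indicator_def)
  then show False using zero cell_integral_lborel[OF K g] by simp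
qed

section \<open>The divergence theorem on polytopal cells\<close>

text \<open>The matrix determinant lemma. The map \<open>p\<close>, which replaces the coordinate
  \<open>k\<close> by \<open>v \<bullet> x\<close>, is invertible as
  \<open>v $ k \<noteq> 0\<close>, and conjugates the map to one whose matrix differs from the
  identity only in the column \<open>k\<close>; Cramer's rule reads off its determinant.\<close>

lemma det_rank_one_update:
  fixes u v :: "real^'n"
  shows "det (matrix (\<lambda>x. x + (v \<bullet> x) *\<^sub>R u)) = 1 + v \<bullet> u"
proof (cases "v = 0")
  case True
  then show ?thesis by (simp add: matrix_id_mat_1[unfolded id_def])
next
  case False
  then obtain k where k: "v $ k \<noteq> 0" by (metis vec_eq_iff zero_index)
  let ?L = "\<lambda>x. x + (v \<bullet> x) *\<^sub>R u"
  define p :: "real^'n \<Rightarrow> real^'n" where "p x = (\<chi> i. if i = k then v \<bullet> x else x $ i)" for x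
  let ?M = "\<lambda>y. y + (y $ k) *\<^sub>R p u"
  have linL: "linear ?L" by (intro linearI) (auto simp: inner_add_right algebra_simps)
  have linp: "linear p" by (intro linearI) (auto simp: p_def vec_eq_iff inner_add_right)
  have linM: "linear ?M" by (intro linearI) (auto simp: algebra_simps)
  have "p \<circ> ?L = ?M \<circ> p"
    by (auto simp: p_def vec_eq_iff fun_eq_iff inner_add_right)
  then have "matrix p ** matrix ?L = matrix ?M ** matrix p"
    using matrix_compose[OF linL linp] matrix_compose[OF linp linM] by simp
  then have "det (matrix p ** matrix ?L) = det (matrix ?M ** matrix p)" by (rule arg_cong)
  then have eq: "det (matrix p) * det (matrix ?L) = det (matrix ?M) * det (matrix p)"
    by (simp only: det_mul)
  have "x = 0" if "p x = 0" for x
  proof -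
    have 0: "x $ i = 0" if "i \<noteq> k" for i
      using \<open>p x = 0\<close> that by (auto simp: p_def vec_eq_iff split: if_splits)
    have "(p x) $ k = 0" using \<open>p x = 0\<close> by simp
    then have "0 = v \<bullet> x" by (simp add: p_def)
    also have "\<dots> = (\<Sum>i\<in>UNIV. if i = k then v $ k * x $ k else 0)"
      unfolding inner_vec_def by (rule sum.cong) (use 0 in auto)
    also have "\<dots> = v $ k * x $ k" by simp
    finally have "x $ k = 0" using k by simp
    then show "x = 0" using 0 by (metis vec_eq_iff zero_index)
  qed
  then have "inj p" using linear_injective_0[OF linp] by blast
  then have p0: "det (matrix p) \<noteq> 0" using det_nz_iff_inj[OF linp] by blast
  have "matrix ?M = (\<chi> i j. if j = k then (axis k 1 + p u) $ i else (mat 1 :: real^'n^'n) $ i $ j)"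
    by (auto simp: matrix_def vec_eq_iff axis_def mat_def)
  then have "det (matrix ?M) = 1 + p u $ k"
    using cramer_lemma[of k "mat 1" "axis k 1 + p u"] unfolding matrix_vector_mul_lid by (simp add: axis_def)
  then have "det (matrix ?M) = 1 + v \<bullet> u" by (simp add: p_def)
  then show ?thesis using eq p0 by simp
qed

text \<open>It suffices to compare boxes, and a box is the linear image of its preimage, so that the
  determinant scales the volume. The sort \<open>wellorder\<close> comes with
  \<open>measure_linear_image\<close> and is inherited by all that rests on the divergence
  theorem.\<close>

lemma lborel_linear_distr:
  fixes L :: "real^'n::{finite,wellorder} \<Rightarrow> real^'n::_"
  assumes lin: "linear L" and d: "det (matrix L) \<noteq> 0"
  shows "lborel = density (distr lborel borel L) (\<lambda>_. ennreal \<bar>det (matrix L)\<bar>)"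
proof (rule lborel_eqI)
  fix l u :: "real^'n::{finite,wellorder}" assume le: "\<And>b. b \<in> Basis \<Longrightarrow> l \<bullet> b \<le> u \<bullet> b"
  have inj: "inj L" using det_nz_iff_inj[OF lin] d by blast
  then have surj: "surj L" using lin linear_injective_imp_surjective by blast
  then obtain G where G: "linear G" "\<And>x. G (L x) = x"
    using linear_injective_left_inverse[OF lin inj] by (auto simp: fun_eq_iff)
  have LG: "L (G y) = y" for y using surj G(2) by (metis surjD)
  have vim: "L -` box l u = G ` box l u"
    using G(2) LG by (auto simp: image_iff) metis
  have mL: "L \<in> borel_measurable borel"
    by (rule borel_measurable_continuous_onI[OF linear_continuous_on[OF linear_conv_bounded_linear[THEN iffD1, OF lin]]])
  have lm: "L -` box l u \<in> lmeasurable"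
    unfolding vim by (rule measurable_linear_image[OF G(1)]) simp
  have bor: "L -` box l u \<in> sets borel"
    using measurable_sets[OF mL, of "box l u"] by simp
  have em: "emeasure lborel (L -` box l u) = ennreal (measure lebesgue (L -` box l u))"
    using emeasure_eq_measure2[OF lm] bor by (simp add: emeasure_completion)
  have "emeasure (density (distr lborel borel L) (\<lambda>_. ennreal \<bar>det (matrix L)\<bar>)) (box l u)
      = ennreal \<bar>det (matrix L)\<bar> * emeasure (distr lborel borel L) (box l u)"
    by (rule emeasure_density_const) simp
  also have "\<dots> = ennreal \<bar>det (matrix L)\<bar> * emeasure lborel (L -` box l u)"
    using mL by (simp add: emeasure_distr)
  also have "\<dots> = ennreal (\<bar>det (matrix L)\<bar> * measure lebesgue (L -` box l u))"
    by (simp add: em ennreal_mult)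
  also have "\<bar>det (matrix L)\<bar> * measure lebesgue (L -` box l u) = measure lebesgue (L ` (L -` box l u))"
    by (rule measure_linear_image[OF lin lm, symmetric])
  also have "L ` (L -` box l u) = box l u" using surj by (simp add: surj_image_vimage_eq)
  also have "measure lebesgue (box l u) = (\<Prod>b\<in>Basis. (u - l) \<bullet> b)"
    using le by (simp add: measure_completion measure_def emeasure_lborel_box prod_nonneg inner_diff_left)
  finally show "emeasure (density (distr lborel borel L) (\<lambda>_. ennreal \<bar>det (matrix L)\<bar>)) (box l u)
      = ennreal (\<Prod>b\<in>Basis. (u - l) \<bullet> b)" .
qed simp

lemma lborel_integral_translate:
  fixes f :: "'a::euclidean_space \<Rightarrow> 'b::{banach, second_countable_topology}"
  assumes "f \<in> borel_measurable borel"
  shows "(LINT x|lborel. f (c + x)) = (LINT x|lborel. f x)"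
proof -
  have "(LINT x|lborel. f x) = (LINT x|distr lborel borel ((+) c). f x)" by (simp add: lborel_distr_plus)
  also have "\<dots> = (LINT x|lborel. f (c + x))" using assms by (intro integral_distr) auto
  finally show ?thesis ..
qed

lemma lborel_integral_affine:
  fixes f :: "real^'n::{finite,wellorder} \<Rightarrow> 'b::{banach, second_countable_topology}"
  assumes f: "f \<in> borel_measurable borel" and d: "1 + v \<bullet> u \<noteq> 0"
  shows "(LINT x|lborel. f x) = \<bar>1 + v \<bullet> u\<bar> *\<^sub>R (LINT x|lborel. f (c + (x + (v \<bullet> x) *\<^sub>R u)))"
proof -
  let ?L = "\<lambda>x. x + (v \<bullet> x) *\<^sub>R u"
  have lin: "linear ?L" by (intro linearI) (auto simp: inner_add_right algebra_simps)
  have mL: "?L \<in> borel_measurable borel"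
    by (intro borel_measurable_continuous_onI continuous_intros)
  have fc: "(\<lambda>x. f (c + x)) \<in> borel_measurable borel"
    using f by (intro measurable_compose[OF _ f]) simp
  have "(LINT x|lborel. f x) = (LINT x|lborel. f (c + x))"
    by (rule lborel_integral_translate[OF f, symmetric])
  also have "\<dots> = (LINT x|density (distr lborel borel ?L) (\<lambda>_. ennreal \<bar>1 + v \<bullet> u\<bar>). f (c + x))"
    using lborel_linear_distr[OF lin] d by (simp add: det_rank_one_update)
  also have "\<dots> = (LINT x|distr lborel borel ?L. \<bar>1 + v \<bullet> u\<bar> *\<^sub>R f (c + x))"
    using fc by (intro integral_density) auto
  also have "\<dots> = (LINT x|lborel. \<bar>1 + v \<bullet> u\<bar> *\<^sub>R f (c + ?L x))"
    using fc mL by (intro integral_distr) auto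
  finally show ?thesis by simp
qed

text \<open>
  For \<open>a = n \<bullet> e \<noteq> 0\<close>, the point \<open>x + \<sigma> e\<close> with \<open>\<sigma> = (b - n \<bullet> x) / a\<close> is where the line through \<open>x\<close>
  in direction \<open>e\<close> crosses the hyperplane, so \<open>prism n b F e t\<close> is \<open>F + [0, t] e\<close>.
\<close>

definition crossing :: "real^'n \<Rightarrow> real \<Rightarrow> real^'n \<Rightarrow> real^'n \<Rightarrow> real" where
  "crossing n b e x = (b - n \<bullet> x) / (n \<bullet> e)"

definition prism :: "real^'n \<Rightarrow> real \<Rightarrow> (real^'n) set \<Rightarrow> real^'n \<Rightarrow> real \<Rightarrow> (real^'n) set" where
  "prism n b F e t = {x. x + crossing n b e x *\<^sub>R e \<in> F \<and> - t \<le> crossing n b e x \<and> crossing n b e x \<le> 0}"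

lemma prism_borel:
  assumes "closed F" "n \<bullet> e \<noteq> 0"
  shows "prism n b F e t \<in> sets borel"
proof -
  have c: "continuous_on UNIV (crossing n b e)"
    using assms(2) unfolding crossing_def by (intro continuous_intros) auto
  have "prism n b F e t = ((\<lambda>x. x + crossing n b e x *\<^sub>R e) -` F) \<inter> {x. - t \<le> crossing n b e x} \<inter> {x. crossing n b e x \<le> 0}"
    by (auto simp: prism_def)
  moreover have "closed ((\<lambda>x. x + crossing n b e x *\<^sub>R e) -` F)"
    using assms(1) by (intro continuous_closed_vimage) (use c in \<open>auto simp: continuous_on_eq_continuous_at intro!: continuous_intros\<close>)
  moreover have "closed {x. - t \<le> crossing n b e x}" "closed {x. crossing n b e x \<le> 0}"
    by (intro closed_Collect_le continuous_intros c)+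
  ultimately have "closed (prism n b F e t)" by (simp only: closed_Int)
  then show ?thesis by (rule borel_closed)
qed

text \<open>The map \<open>?T\<close> projects to the hyperplane and turns the normal coordinate
  into a shift by at most \<open>t\<close> along \<open>e\<close>. It is a translate of a rank-one
  update of the identity with determinant \<open>t * (n \<bullet> e)\<close>.\<close>

lemma prism_integral:
  fixes f :: "real^'n::{finite,wellorder} \<Rightarrow> 'b::{banach, second_countable_topology}"
  assumes n: "norm n = 1" and F: "closed F" and a: "n \<bullet> e \<noteq> 0" and t: "t > 0"
    and f: "f \<in> borel_measurable borel"
  shows "(LINT x|lborel. indicator (prism n b F e t) x *\<^sub>R f x)
    = (t * \<bar>n \<bullet> e\<bar>) *\<^sub>R (LINT y|lborel. indicator (slab n b F) y *\<^sub>R f (hproj n b y + ((n \<bullet> y - b + 1/2) * t) *\<^sub>R e))"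
proof -
  let ?T = "\<lambda>y. hproj n b y + ((n \<bullet> y - b + 1/2) * t) *\<^sub>R e"
  \<comment> \<open>The constant part of \<open>?T\<close>. The number 1/2 moves the normal
    coordinate, which in the slab runs from -1/2 to 1/2, to the range from 0 to 1.\<close>
  define c where "c = b *\<^sub>R n + ((1/2 - b) * t) *\<^sub>R e"
  have T: "?T y = c + (y + (n \<bullet> y) *\<^sub>R (t *\<^sub>R e - n))" for y
    by (simp add: hproj_def c_def algebra_simps)
  have nn: "n \<bullet> n = 1" using n by (simp add: dot_square_norm)
  have d: "1 + n \<bullet> (t *\<^sub>R e - n) = t * (n \<bullet> e)"
    by (simp add: inner_diff_right nn)
  have cross: "crossing n b e (?T y) = - ((n \<bullet> y - b + 1/2) * t)" for y
    using a by (simp add: crossing_def inner_add_right inner_hproj[OF n])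
  have mem: "?T y \<in> prism n b F e t \<longleftrightarrow> y \<in> slab n b F" for y
  proof -
    have "- t \<le> - ((n \<bullet> y - b + 1/2) * t) \<longleftrightarrow> n \<bullet> y - b \<le> 1/2"
      using t mult_le_cancel_right[of "n \<bullet> y - b + 1/2" t 1] by auto
    moreover have "- ((n \<bullet> y - b + 1/2) * t) \<le> 0 \<longleftrightarrow> n \<bullet> y - b \<ge> - 1/2"
      using t zero_le_mult_iff[of "n \<bullet> y - b + 1/2" t] by auto
    moreover have "\<bar>n \<bullet> y - b\<bar> \<le> 1/2 \<longleftrightarrow> n \<bullet> y - b \<le> 1/2 \<and> n \<bullet> y - b \<ge> - 1/2" by linarith
    moreover have "?T y + (- ((n \<bullet> y - b + 1/2) * t)) *\<^sub>R e = hproj n b y" by simp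
    ultimately show ?thesis unfolding prism_def slab_def mem_Collect_eq cross by metis
  qed
  have "(\<lambda>x. indicator (prism n b F e t) x *\<^sub>R f x) \<in> borel_measurable borel"
    using prism_borel[OF F a] f by (intro borel_measurable_scaleR borel_measurable_indicator) auto
  then have "(LINT x|lborel. indicator (prism n b F e t) x *\<^sub>R f x)
    = \<bar>t * (n \<bullet> e)\<bar> *\<^sub>R (LINT y|lborel. indicator (prism n b F e t) (?T y) *\<^sub>R f (?T y))"
    unfolding T by (subst lborel_integral_affine[of _ n "t *\<^sub>R e - n" c]) (use a t d in auto)
  moreover have "indicator (prism n b F e t) (?T y) = (indicator (slab n b F) y :: real)" for y
    using mem[of y] by (simp add: indicator_def)
  ultimately show ?thesis using t by (simp add: abs_mult)
qed

text \<open>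
  The values \<open>s i\<close> are the parameters at which a line enters (\<open>N\<close>) and leaves (\<open>P\<close>) the half-spaces
  bounding a cell: the line meets the cell in the interval between the largest of the former
  and the smallest of the latter.
\<close>

lemma interval_shift_identity:
  fixes s :: "'i \<Rightarrow> real"
  assumes fin: "finite P" "finite N" and ne: "P \<noteq> {}" "N \<noteq> {}" and disj: "P \<inter> N = {}" and inj: "inj_on s (P \<union> N)"
    and avoid: "\<And>i. i \<in> P \<union> N \<Longrightarrow> s i \<noteq> 0 \<and> s i \<noteq> - t" and t: "t > 0"
  defines "Q \<equiv> \<lambda>r. (\<forall>i\<in>P. r < s i) \<and> (\<forall>i\<in>N. s i < r)"
    and "C \<equiv> \<lambda>i. (\<forall>j\<in>P. s i \<le> s j) \<and> (\<forall>j\<in>N. s j \<le> s i) \<and> - t \<le> s i \<and> s i \<le> 0"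
  shows "of_bool (Q (- t)) - of_bool (Q 0) = (\<Sum>i\<in>P. of_bool (C i)) - (\<Sum>i\<in>N. of_bool (C i) :: real)"
proof -
  have "Min (s ` P) \<in> s ` P" "Max (s ` N) \<in> s ` N" using fin ne by simp_all
  then obtain p q where pq: "p \<in> P" "Min (s ` P) = s p" "q \<in> N" "Max (s ` N) = s q"
    by (elim imageE)
  have p: "p \<in> P" "\<And>j. j \<in> P \<Longrightarrow> s p \<le> s j"
    using pq(1) fin(1) unfolding pq(2)[symmetric] by simp_all
  have q: "q \<in> N" "\<And>j. j \<in> N \<Longrightarrow> s j \<le> s q"
    using pq(3) fin(2) unfolding pq(4)[symmetric] by simp_all
  have Q: "Q r \<longleftrightarrow> s q < r \<and> r < s p" for r
    unfolding Q_def using p q by (auto intro: le_less_trans less_le_trans)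
  have CP: "C i \<longleftrightarrow> i = p \<and> s q \<le> s p \<and> - t \<le> s p \<and> s p \<le> 0" if "i \<in> P" for i
  proof -
    have "i = p" if "\<forall>j\<in>P. s i \<le> s j"
      using that p \<open>i \<in> P\<close> inj by (metis UnI1 antisym inj_onD)
    then show ?thesis unfolding C_def using p q by (metis order_trans)
  qed
  have CN: "C i \<longleftrightarrow> i = q \<and> s q \<le> s p \<and> - t \<le> s q \<and> s q \<le> 0" if "i \<in> N" for i
  proof -
    have "i = q" if "\<forall>j\<in>N. s j \<le> s i"
      using that q \<open>i \<in> N\<close> inj by (metis UnI2 antisym inj_onD)
    then show ?thesis unfolding C_def using p q by (metis order_trans)
  qed
  have "(\<Sum>i\<in>P. of_bool (C i)) = (\<Sum>i\<in>P. if i = p then of_bool (s q \<le> s p \<and> - t \<le> s p \<and> s p \<le> 0) else (0::real))"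
    by (rule sum.cong) (use CP in auto)
  then have SP: "(\<Sum>i\<in>P. of_bool (C i)) = (of_bool (s q \<le> s p \<and> - t \<le> s p \<and> s p \<le> 0) :: real)"
    using fin(1) p(1) by simp
  have "(\<Sum>i\<in>N. of_bool (C i)) = (\<Sum>i\<in>N. if i = q then of_bool (s q \<le> s p \<and> - t \<le> s q \<and> s q \<le> 0) else (0::real))"
    by (rule sum.cong) (use CN in auto)
  then have SN: "(\<Sum>i\<in>N. of_bool (C i)) = (of_bool (s q \<le> s p \<and> - t \<le> s q \<and> s q \<le> 0) :: real)"
    using fin(2) q(1) by simp
  have "p \<noteq> q" using p(1) q(1) disj by blast
  then have "s p \<noteq> s q" using inj p(1) q(1) by (metis UnI1 UnI2 inj_onD)
  \<comment> \<open>The interval runs from \<open>s q\<close> to \<open>s p\<close>. If it contains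
    \<open>- t\<close> but not 0, it ends between these two numbers; if it contains 0 but not
    \<open>- t\<close>, it begins between them; if it lies between them, its two ends cancel on the
    right; if it is empty, everything vanishes.\<close>
  then show ?thesis
    unfolding SP SN Q using avoid[of p] avoid[of q] p(1) q(1) t by (auto simp: of_bool_def)
qed

section \<open>Comparison of a cell with its translate\<close>

lemma AE_not_hyperplane:
  assumes "a \<noteq> 0 \<or> b \<noteq> 0"
  shows "AE x in lborel. (a :: 'a::euclidean_space) \<bullet> x \<noteq> b"
proof -
  have "{x. a \<bullet> x = b} \<in> sets lborel"
    using borel_closed[OF closed_hyperplane[of a b]] by simp
  moreover have "{x. a \<bullet> x = b} \<in> null_sets lebesgue"
    using negligible_hyperplane[OF assms] by (simp add: negligible_iff_null_sets)
  ultimately have "{x. a \<bullet> x = b} \<in> null_sets lborel"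
    by (simp add: null_sets_completion_iff)
  then show ?thesis using AE_not_in by fastforce
qed

text \<open>Otherwise a ray from \<open>c\<close> in direction \<open>e\<close> would never leave
  the cell, which is bounded.\<close>

lemma polycell_exit_face:
  assumes K: "polycell (K :: (real^'n) set)" and e: "e \<noteq> 0"
  shows "\<exists>F\<in>faces K. outward_normal K F \<bullet> e > 0"
proof (rule ccontr)
  assume no: "\<not> ?thesis"
  obtain c where c: "c \<in> K" using K by (auto simp: polycell_def)
  obtain B where B: "\<And>x. x \<in> K \<Longrightarrow> norm x \<le> B"
    using polycell_bounded[OF K] unfolding bounded_iff by blast
  \<comment> \<open>Makes the step along \<open>e\<close> have length \<open>B + norm c + 1\<close>,
    more than two points of norm at most \<open>B\<close> and \<open>norm c\<close> can be
    apart.\<close>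
  define s where "s = (B + norm c + 1) / norm e"
  have B0: "B \<ge> 0" using B[OF c] norm_ge_zero[of c] by linarith
  have s: "s \<ge> 0" using B0 by (simp add: s_def)
  have "c + s *\<^sub>R e \<in> K"
    unfolding mem_polycell_iff[OF K]
  proof
    fix F assume F: "F \<in> faces K"
    have "s * (outward_normal K F \<bullet> e) \<le> 0" using no F s by (auto intro: mult_nonneg_nonpos simp: not_less)
    then show "outward_normal K F \<bullet> (c + s *\<^sub>R e) < face_offset K F"
      using cell_below_face[OF K F c] by (simp add: inner_add_right)
  qed
  then have "norm (c + s *\<^sub>R e) \<le> B" by (rule B)
  moreover have "norm (s *\<^sub>R e) = B + norm c + 1" using e s B0 by (simp add: s_def)
  moreover have "norm (s *\<^sub>R e) \<le> norm (c + s *\<^sub>R e) + norm c"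
    using norm_triangle_ineq4[of "c + s *\<^sub>R e" c] by simp
  ultimately show False by linarith
qed

text \<open>The crossings agree where \<open>?w \<bullet> x = ?d\<close>, a null set unless
  \<open>?w\<close> and \<open>?d\<close> both vanish. In that case the unit normals are parallel:
  opposite ones are excluded by a point of \<open>K\<close>, which lies strictly below both faces,
  and equal ones by \<open>face_inj_normal\<close>.\<close>

lemma AE_crossings_distinct:
  assumes K: "polycell (K :: (real^'n) set)" and F: "F \<in> faces K" and G: "G \<in> faces K" and "F \<noteq> G"
    and a: "outward_normal K F \<bullet> e \<noteq> 0" "outward_normal K G \<bullet> e \<noteq> 0"
  shows "AE x in lborel. crossing (outward_normal K F) (face_offset K F) e x
      \<noteq> crossing (outward_normal K G) (face_offset K G) e x"
proof -
  let ?m = "outward_normal K F" and ?n = "outward_normal K G"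
  let ?b = "face_offset K F" and ?c = "face_offset K G"
  let ?w = "(?m \<bullet> e) *\<^sub>R ?n - (?n \<bullet> e) *\<^sub>R ?m" and ?d = "(?m \<bullet> e) * ?c - (?n \<bullet> e) * ?b"
  have "?w \<noteq> 0 \<or> ?d \<noteq> 0"
  proof (rule ccontr)
    assume "\<not> ?thesis"
    then have w: "(?m \<bullet> e) *\<^sub>R ?n = (?n \<bullet> e) *\<^sub>R ?m" and d: "(?m \<bullet> e) * ?c = (?n \<bullet> e) * ?b" by auto
    have "norm ((?m \<bullet> e) *\<^sub>R ?n) = norm ((?n \<bullet> e) *\<^sub>R ?m)" using w by (rule arg_cong)
    then have abs: "\<bar>?m \<bullet> e\<bar> = \<bar>?n \<bullet> e\<bar>"
      using norm_outward_normal[OF K F] norm_outward_normal[OF K G] by simp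
    obtain z where z: "z \<in> K" using K by (auto simp: polycell_def)
    have pos: "?b - ?m \<bullet> z > 0" "?c - ?n \<bullet> z > 0"
      using cell_below_face[OF K F z] cell_below_face[OF K G z] by simp_all
    have "(?m \<bullet> e) * (?n \<bullet> z) = (?n \<bullet> e) * (?m \<bullet> z)"
      using arg_cong[OF w, of "\<lambda>v. v \<bullet> z"] by simp
    then have eq: "(?m \<bullet> e) * (?c - ?n \<bullet> z) = (?n \<bullet> e) * (?b - ?m \<bullet> z)"
      using d by (simp add: algebra_simps)
    have "?m \<bullet> e = ?n \<bullet> e"
    proof (rule ccontr)
      assume "?m \<bullet> e \<noteq> ?n \<bullet> e"
      then have "?m \<bullet> e = - (?n \<bullet> e)" using abs by linarith
      then have "(?n \<bullet> e) * ((?c - ?n \<bullet> z) + (?b - ?m \<bullet> z)) = 0"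
        using eq by (simp add: algebra_simps)
      then show False using a(2) pos by simp
    qed
    then have "(?n \<bullet> e) *\<^sub>R ?n = (?n \<bullet> e) *\<^sub>R ?m" using w by (simp only:)
    then have "?n = ?m" using a(2) by (simp only: scaleR_cancel_left) blast
    then show False using face_inj_normal[OF K F G] \<open>F \<noteq> G\<close> by simp
  qed
  then have "AE x in lborel. ?w \<bullet> x \<noteq> ?d" by (rule AE_not_hyperplane)
  then show ?thesis
  proof eventually_elim
    case (elim x)
    show ?case
    proof
      assume "crossing ?m ?b e x = crossing ?n ?c e x"
      then have "(?b - ?m \<bullet> x) * (?n \<bullet> e) = (?c - ?n \<bullet> x) * (?m \<bullet> e)"
        using a by (simp add: crossing_def frac_eq_eq)
      then have "?w \<bullet> x = ?d" by (simp add: inner_diff_left algebra_simps)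
      then show False using elim by simp
    qed
  qed
qed

text \<open>Each line in direction \<open>e\<close> meets the cell in an interval, so
  \<open>interval_shift_identity\<close> applies to the parameters at which it crosses the face
  hyperplanes. Faces parallel to \<open>e\<close> admit or reject the line as a whole, by
  \<open>z\<close>, and have sign 0 in the sum.\<close>

lemma shifted_cell_indicator:
  assumes K: "polycell (K :: (real^'n) set)" and e: "e \<noteq> 0" and t: "t > 0"
  shows "AE x in lborel. indicator K (x - t *\<^sub>R e) - indicator K x
    = (\<Sum>F\<in>faces K. sgn (outward_normal K F \<bullet> e)
        * indicator (prism (outward_normal K F) (face_offset K F) F e t) x :: real)"
proof -
  let ?n = "outward_normal K" and ?b = "face_offset K"
  let ?s = "\<lambda>F. crossing (?n F) (?b F) e"
  define P where "P = {F \<in> faces K. ?n F \<bullet> e > 0}"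
  define N where "N = {F \<in> faces K. ?n F \<bullet> e < 0}"
  define Z where "Z = {F \<in> faces K. ?n F \<bullet> e = 0}"
  have fin: "finite P" "finite N" "finite Z"
    using finite_faces[OF K] by (simp_all add: P_def N_def Z_def)
  have un: "faces K = P \<union> N \<union> Z" by (auto simp: P_def N_def Z_def)
  have "P \<noteq> {}" using polycell_exit_face[OF K e] by (auto simp: P_def)
  have "N \<noteq> {}" using polycell_exit_face[OF K, of "- e"] e by (auto simp: N_def)
  have ae1: "AE x in lborel. \<forall>F\<in>P \<union> N. \<forall>G\<in>P \<union> N. F \<noteq> G \<longrightarrow> ?s F x \<noteq> ?s G x"
  proof (intro AE_finite_allI)
    fix F G assume "F \<in> P \<union> N" "G \<in> P \<union> N"
    then show "AE x in lborel. F \<noteq> G \<longrightarrow> ?s F x \<noteq> ?s G x"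
      using AE_crossings_distinct[OF K, of F G e] by (cases "F = G") (auto simp: P_def N_def)
  qed (use fin in auto)
  \<comment> \<open>Excludes the face hyperplanes of \<open>K\<close> and of its translate: no
    crossing then has parameter 0 or \<open>- t\<close>, and strict and weak inequalities agree for
    the faces parallel to \<open>e\<close>.\<close>
  have ae2: "AE x in lborel. \<forall>F\<in>faces K. ?n F \<bullet> x \<noteq> ?b F \<and> ?n F \<bullet> x \<noteq> ?b F + t * (?n F \<bullet> e)"
  proof (intro AE_finite_allI AE_conjI)
    fix F assume F: "F \<in> faces K"
    show "AE x in lborel. ?n F \<bullet> x \<noteq> ?b F" "AE x in lborel. ?n F \<bullet> x \<noteq> ?b F + t * (?n F \<bullet> e)"
      using outward_normal_nonzero[OF K F] by (intro AE_not_hyperplane; simp)+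
  qed (rule finite_faces[OF K])
  from ae1 ae2 show ?thesis
  proof eventually_elim
    case (elim x)
    have sP: "?n F \<bullet> (x + r *\<^sub>R e) < ?b F \<longleftrightarrow> r < ?s F x" "?n F \<bullet> (x + r *\<^sub>R e) \<le> ?b F \<longleftrightarrow> r \<le> ?s F x"
      if "F \<in> P" for F r
      using that by (auto simp: P_def crossing_def inner_add_right field_simps)
    have sN: "?n F \<bullet> (x + r *\<^sub>R e) < ?b F \<longleftrightarrow> ?s F x < r" "?n F \<bullet> (x + r *\<^sub>R e) \<le> ?b F \<longleftrightarrow> ?s F x \<le> r"
      if "F \<in> N" for F r
      using that by (auto simp: N_def crossing_def inner_add_right field_simps)
    have sZ: "?n F \<bullet> (x + r *\<^sub>R e) = ?n F \<bullet> x" if "F \<in> Z" for F r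
      using that by (simp add: Z_def inner_add_right)
    define z where "z \<longleftrightarrow> (\<forall>F\<in>Z. ?n F \<bullet> x < ?b F)"
    have zle: "(\<forall>F\<in>Z. ?n F \<bullet> x \<le> ?b F) \<longleftrightarrow> z"
      unfolding z_def using elim(2) un by (metis UnI2 order_le_less)
    have inK: "x + r *\<^sub>R e \<in> K \<longleftrightarrow> z \<and> (\<forall>F\<in>P. r < ?s F x) \<and> (\<forall>F\<in>N. ?s F x < r)" for r
      unfolding mem_polycell_iff[OF K] un z_def ball_Un using sP sN sZ by auto
    have inC: "x + r *\<^sub>R e \<in> closure K \<longleftrightarrow> z \<and> (\<forall>F\<in>P. r \<le> ?s F x) \<and> (\<forall>F\<in>N. ?s F x \<le> r)" for r
      unfolding mem_closure_polycell_iff[OF K] un zle[symmetric] ball_Un using sP sN sZ by auto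
    let ?C = "\<lambda>F. (\<forall>G\<in>P. ?s F x \<le> ?s G x) \<and> (\<forall>G\<in>N. ?s G x \<le> ?s F x) \<and> - t \<le> ?s F x \<and> ?s F x \<le> 0"
    have inF: "x \<in> prism (?n F) (?b F) F e t \<longleftrightarrow> z \<and> ?C F" if F: "F \<in> P \<union> N" for F
    proof -
      have FK: "F \<in> faces K" and a: "?n F \<bullet> e \<noteq> 0" using F by (auto simp: P_def N_def)
      have "?n F \<bullet> (x + ?s F x *\<^sub>R e) = ?b F" using a by (simp add: crossing_def inner_add_right)
      then have "x + ?s F x *\<^sub>R e \<in> F \<longleftrightarrow> x + ?s F x *\<^sub>R e \<in> closure K"
        using face_eq[OF K FK] by blast
      then show ?thesis unfolding prism_def using inC by auto
    qed
    have id: "of_bool ((\<forall>i\<in>P. - t < ?s i x) \<and> (\<forall>i\<in>N. ?s i x < - t))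
        - of_bool ((\<forall>i\<in>P. 0 < ?s i x) \<and> (\<forall>i\<in>N. ?s i x < 0))
      = (\<Sum>F\<in>P. of_bool (?C F)) - (\<Sum>F\<in>N. of_bool (?C F) :: real)"
    proof (rule interval_shift_identity)
      show "inj_on (\<lambda>i. ?s i x) (P \<union> N)" using elim(1) by (auto simp: inj_on_def)
      show "?s i x \<noteq> 0 \<and> ?s i x \<noteq> - t" if i: "i \<in> P \<union> N" for i
      proof -
        have "?n i \<bullet> e \<noteq> 0" "i \<in> faces K" using i by (auto simp: P_def N_def)
        then show ?thesis using elim(2) by (auto simp: crossing_def field_simps)
      qed
    qed (use fin \<open>P \<noteq> {}\<close> \<open>N \<noteq> {}\<close> t in \<open>auto simp: P_def N_def\<close>)
    have sumP: "(\<Sum>F\<in>P. sgn (?n F \<bullet> e) * indicator (prism (?n F) (?b F) F e t) x) = (\<Sum>F\<in>P. of_bool (z \<and> ?C F) :: real)"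
      by (rule sum.cong) (use inF in \<open>auto simp: P_def indicator_def\<close>)
    have sumN: "(\<Sum>F\<in>N. sgn (?n F \<bullet> e) * indicator (prism (?n F) (?b F) F e t) x) = - (\<Sum>F\<in>N. of_bool (z \<and> ?C F) :: real)"
      unfolding sum_negf[symmetric] by (rule sum.cong) (use inF in \<open>auto simp: N_def indicator_def\<close>)
    have sumZ: "(\<Sum>F\<in>Z. sgn (?n F \<bullet> e) * indicator (prism (?n F) (?b F) F e t) x) = (0 :: real)"
      by (rule sum.neutral) (auto simp: Z_def)
    have "(\<Sum>F\<in>faces K. sgn (?n F \<bullet> e) * indicator (prism (?n F) (?b F) F e t) x)
        = (\<Sum>F\<in>P. of_bool (z \<and> ?C F)) - (\<Sum>F\<in>N. of_bool (z \<and> ?C F) :: real)"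
    proof -
      have "(\<Sum>F\<in>P \<union> N \<union> Z. g F) = (\<Sum>F\<in>P. g F) + (\<Sum>F\<in>N. g F) + (\<Sum>F\<in>Z. g F)" for g :: "_ \<Rightarrow> real"
      proof -
        have "(P \<union> N) \<inter> Z = {}" "P \<inter> N = {}" by (auto simp: P_def N_def Z_def)
        then show ?thesis using fin by (simp add: sum.union_disjoint)
      qed
      then show ?thesis unfolding un using sumP sumN sumZ by simp
    qed
    also have "\<dots> = indicator K (x - t *\<^sub>R e) - indicator K x"
    proof (cases z)
      case True
      then show ?thesis using id inK[of "- t"] inK[of 0] by (simp add: indicator_def)
    next
      case False
      then show ?thesis using inK[of "- t"] inK[of 0] by (simp add: indicator_def)
    qed
    finally show ?case by simp
  qed
qed

lemma slab_integrable:
  fixes h :: "real^'n \<Rightarrow> 'b::{banach, second_countable_topology}"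
  assumes K: "polycell K" and F: "F \<in> faces K" and h: "continuous_on UNIV h"
  shows "integrable lborel (\<lambda>y. indicator (fslab K F) y *\<^sub>R h y)"
  by (rule borel_integrable_compact[OF compact_fslab[OF K F] continuous_on_subset[OF h]]) simp

text \<open>Translation invariance moves the shift from \<open>f\<close> to the indicator of the
  cell, and the difference of indicators is resolved into prisms. The factor \<open>sgn\<close> and
  the absolute value from \<open>prism_integral\<close> combine to the signed
  \<open>outward_normal K F \<bullet> e\<close>.\<close>

lemma cell_difference_integral:
  fixes f :: "real^'n::{finite,wellorder} \<Rightarrow> complex"
  assumes K: "polycell K" and e: "e \<noteq> 0" and t: "t > 0" and f: "continuous_on UNIV f"
  shows "(LINT x|lborel. indicator K x *\<^sub>R (f (x + t *\<^sub>R e) - f x))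
    = (\<Sum>F\<in>faces K. (t * (outward_normal K F \<bullet> e)) *\<^sub>R (LINT y|lborel. indicator (fslab K F) y *\<^sub>R
        f (fproj K F y + ((outward_normal K F \<bullet> y - face_offset K F + 1/2) * t) *\<^sub>R e)))"
proof -
  let ?n = "outward_normal K" and ?b = "face_offset K"
  let ?p = "\<lambda>F. prism (?n F) (?b F) F e t"
  have fb: "f \<in> borel_measurable borel" using f by (rule borel_measurable_continuous_onI)
  have Kb: "K \<in> sets borel" using K by (simp add: polycell_def)
  have f2: "continuous_on UNIV (\<lambda>x. f (x + t *\<^sub>R e))"
    by (rule continuous_on_compose2[OF f]) (auto intro!: continuous_intros)
  note i1 = cell_integrable(1)[OF K f2] and i2 = cell_integrable(1)[OF K f]
  have meas: "(\<lambda>x. indicator K (x - t *\<^sub>R e) *\<^sub>R f x) \<in> borel_measurable borel"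
  proof -
    have "(\<lambda>x. indicator K (x - t *\<^sub>R e) :: real) \<in> borel_measurable borel"
      by (rule measurable_compose[where N = borel]) (use Kb in auto)
    then show ?thesis using fb by (rule borel_measurable_scaleR)
  qed
  have shift: "(\<lambda>x. indicator K (x - t *\<^sub>R e) *\<^sub>R f x) = (\<lambda>x. (\<lambda>y. indicator K y *\<^sub>R f (y + t *\<^sub>R e)) (- (t *\<^sub>R e) + x))"
    by (auto simp: fun_eq_iff)
  have i3: "integrable lborel (\<lambda>x. indicator K (x - t *\<^sub>R e) *\<^sub>R f x)"
  proof -
    have "integrable (distr lborel borel ((+) (- (t *\<^sub>R e)))) (\<lambda>y. indicator K y *\<^sub>R f (y + t *\<^sub>R e))"
      using i1 unfolding lborel_distr_plus .
    then show ?thesis unfolding shift by (rule integrable_distr[rotated]) auto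
  qed
  have "(LINT x|lborel. indicator K x *\<^sub>R (f (x + t *\<^sub>R e) - f x))
      = (LINT x|lborel. indicator K x *\<^sub>R f (x + t *\<^sub>R e)) - (LINT x|lborel. indicator K x *\<^sub>R f x)"
    using i1 i2 by (simp add: scaleR_diff_right)
  also have "(LINT x|lborel. indicator K x *\<^sub>R f (x + t *\<^sub>R e)) = (LINT x|lborel. indicator K (x - t *\<^sub>R e) *\<^sub>R f x)"
    unfolding shift by (rule lborel_integral_translate[symmetric]) (use i1 in \<open>auto dest: borel_measurable_integrable\<close>)
  also have "\<dots> - (LINT x|lborel. indicator K x *\<^sub>R f x)
      = (LINT x|lborel. (indicator K (x - t *\<^sub>R e) - indicator K x) *\<^sub>R f x)"
    using i2 i3 by (simp add: scaleR_diff_left)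
  also have "\<dots> = (LINT x|lborel. (\<Sum>F\<in>faces K. sgn (?n F \<bullet> e) *\<^sub>R (indicator (?p F) x *\<^sub>R f x)))"
  proof (rule integral_cong_AE)
    show "AE x in lborel. (indicator K (x - t *\<^sub>R e) - indicator K x) *\<^sub>R f x
        = (\<Sum>F\<in>faces K. sgn (?n F \<bullet> e) *\<^sub>R (indicator (?p F) x *\<^sub>R f x))"
      using shifted_cell_indicator[OF K e t] by eventually_elim (simp add: scaleR_sum_left)
    show "(\<lambda>x. (indicator K (x - t *\<^sub>R e) - indicator K x) *\<^sub>R f x) \<in> borel_measurable lborel"
      using i2 i3 by (auto simp: scaleR_diff_left dest: borel_measurable_integrable)
    show "(\<lambda>x. \<Sum>F\<in>faces K. sgn (?n F \<bullet> e) *\<^sub>R (indicator (?p F) x *\<^sub>R f x)) \<in> borel_measurable lborel"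
    proof (rule borel_measurable_sum)
      fix F assume F: "F \<in> faces K"
      show "(\<lambda>x. sgn (?n F \<bullet> e) *\<^sub>R (indicator (?p F) x *\<^sub>R f x)) \<in> borel_measurable lborel"
      proof (cases "?n F \<bullet> e = 0")
        case False
        have "?p F \<in> sets borel"
          by (rule prism_borel[OF compact_imp_closed[OF compact_face[OF K F]] False])
        then have "(indicator (?p F) :: _ \<Rightarrow> real) \<in> borel_measurable borel" by (rule borel_measurable_indicator)
        then show ?thesis using fb by (intro borel_measurable_scaleR borel_measurable_const) simp_all
      qed simp
    qed
  qed
  also have "\<dots> = (\<Sum>F\<in>faces K. sgn (?n F \<bullet> e) *\<^sub>R (LINT x|lborel. indicator (?p F) x *\<^sub>R f x))"
  proof -
    have int: "integrable lborel (\<lambda>x. sgn (?n F \<bullet> e) *\<^sub>R (indicator (?p F) x *\<^sub>R f x))" if F: "F \<in> faces K" for F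
    proof (cases "?n F \<bullet> e = 0")
      case False
      note Fc = compact_face[OF K F]
      have pb: "?p F \<in> sets borel" by (rule prism_borel[OF compact_imp_closed[OF Fc] False])
      have "bounded (?p F)"
      proof -
        obtain B where B: "\<And>x. x \<in> F \<Longrightarrow> norm x \<le> B"
          using compact_imp_bounded[OF Fc] unfolding bounded_iff by blast
        have "norm x \<le> B + t * norm e" if "x \<in> ?p F" for x
        proof -
          let ?r = "crossing (?n F) (?b F) e x"
          have "norm (x + ?r *\<^sub>R e) \<le> B" "\<bar>?r\<bar> \<le> t" using that B by (auto simp: prism_def)
          moreover have "norm x \<le> norm (x + ?r *\<^sub>R e) + norm (?r *\<^sub>R e)"
            using norm_triangle_ineq4[of "x + ?r *\<^sub>R e" "?r *\<^sub>R e"] by simp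
          moreover have "norm (?r *\<^sub>R e) \<le> t * norm e"
            using \<open>\<bar>?r\<bar> \<le> t\<close> by (simp add: mult_right_mono)
          ultimately show ?thesis by linarith
        qed
        then show ?thesis unfolding bounded_iff by blast
      qed
      then have "compact (closure (?p F))" by simp
      then have "set_integrable lborel (closure (?p F)) f"
        unfolding set_integrable_def by (rule borel_integrable_compact[OF _ continuous_on_subset[OF f]]) simp
      then have "set_integrable lborel (?p F) f"
        by (rule set_integrable_subset) (use pb closure_subset in auto)
      then have "integrable lborel (\<lambda>x. indicator (?p F) x *\<^sub>R f x)" by (simp only: set_integrable_def)
      then show ?thesis by (rule integrable_scaleR_right)
    qed simp
    have "(LINT x|lborel. (\<Sum>F\<in>faces K. sgn (?n F \<bullet> e) *\<^sub>R (indicator (?p F) x *\<^sub>R f x)))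
        = (\<Sum>F\<in>faces K. LINT x|lborel. sgn (?n F \<bullet> e) *\<^sub>R (indicator (?p F) x *\<^sub>R f x))"
      by (rule Bochner_Integration.integral_sum) (rule int)
    then show ?thesis by (simp only: integral_scaleR_right)
  qed
  also have "\<dots> = (\<Sum>F\<in>faces K. (t * (?n F \<bullet> e)) *\<^sub>R (LINT y|lborel. indicator (fslab K F) y *\<^sub>R
        f (fproj K F y + ((?n F \<bullet> y - ?b F + 1/2) * t) *\<^sub>R e)))"
  proof (rule sum.cong[OF refl])
    fix F assume F: "F \<in> faces K"
    show "sgn (?n F \<bullet> e) *\<^sub>R (LINT x|lborel. indicator (?p F) x *\<^sub>R f x) = (t * (?n F \<bullet> e)) *\<^sub>R (LINT y|lborel. indicator (fslab K F) y *\<^sub>R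
        f (fproj K F y + ((?n F \<bullet> y - ?b F + 1/2) * t) *\<^sub>R e))"
    proof (cases "?n F \<bullet> e = 0")
      case False
      show ?thesis
        unfolding prism_integral[OF norm_outward_normal[OF K F] compact_imp_closed[OF compact_face[OF K F]] False t fb]
        by (simp add: mult.left_commute sgn_mult_abs)
    qed simp
  qed
  finally show ?thesis .
qed

section \<open>Difference quotients and their limit\<close>

lemma bounded_norm_on_cball:
  fixes g :: "'a::euclidean_space \<Rightarrow> 'b::real_normed_vector"
  assumes "continuous_on UNIV g"
  obtains B where "B \<ge> 0" "\<And>x. norm x \<le> R \<Longrightarrow> norm (g x) \<le> B"
proof -
  have "bounded (g ` cball 0 R)"
    by (rule compact_imp_bounded[OF compact_continuous_image[OF continuous_on_subset[OF assms]]]) auto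
  then obtain B where "\<forall>y\<in>g ` cball 0 R. norm y \<le> B" unfolding bounded_iff by (elim exE)
  then have "norm (g x) \<le> max B 0" if "norm x \<le> R" for x
  proof -
    have "g x \<in> g ` cball 0 R" using that by simp
    then have "norm (g x) \<le> B" using \<open>\<forall>y\<in>g ` cball 0 R. norm y \<le> B\<close> by (rule bspec[rotated])
    then show ?thesis by simp
  qed
  then show ?thesis using that[of "max B 0"] by simp
qed

lemma difference_quotient_limit:
  fixes f :: "'a::real_normed_vector \<Rightarrow> 'b::real_normed_vector"
  assumes f: "(f has_derivative f') (at x)" and e: "e \<noteq> 0"
    and t: "t \<longlonglongrightarrow> 0" "\<And>m. (t m :: real) > 0"
  shows "(\<lambda>m. (f (x + t m *\<^sub>R e) - f x) /\<^sub>R t m) \<longlonglongrightarrow> f' e"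
proof -
  have lim: "((\<lambda>h. norm (f (x + h) - f x - f' h) / norm h) \<longlongrightarrow> 0) (at 0)" and lin: "bounded_linear f'"
    using f unfolding has_derivative_at by blast+
  have "filterlim (\<lambda>m. t m *\<^sub>R e) (at 0) sequentially"
  proof (rule filterlim_atI)
    show "(\<lambda>m. t m *\<^sub>R e) \<longlonglongrightarrow> 0" using tendsto_scaleR[OF t(1) tendsto_const[of e]] by simp
    have "t m *\<^sub>R e \<noteq> 0" for m using t(2)[of m] e by simp
    then show "\<forall>\<^sub>F m in sequentially. t m *\<^sub>R e \<noteq> 0" by simp
  qed
  then have "(\<lambda>m. norm (f (x + t m *\<^sub>R e) - f x - f' (t m *\<^sub>R e)) / norm (t m *\<^sub>R e)) \<longlonglongrightarrow> 0"
    by (rule filterlim_compose[OF lim])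
  then have "(\<lambda>m. norm (f (x + t m *\<^sub>R e) - f x - f' (t m *\<^sub>R e)) / norm (t m *\<^sub>R e) * norm e) \<longlonglongrightarrow> 0"
    by (rule tendsto_mult_left_zero)
  moreover have "norm (f (x + t m *\<^sub>R e) - f x - f' (t m *\<^sub>R e)) / norm (t m *\<^sub>R e) * norm e
      = norm ((f (x + t m *\<^sub>R e) - f x) /\<^sub>R t m - f' e)" for m
  proof -
    have eq: "(f (x + t m *\<^sub>R e) - f x) /\<^sub>R t m - f' e = (f (x + t m *\<^sub>R e) - f x - f' (t m *\<^sub>R e)) /\<^sub>R t m"
      using t(2)[of m] linear_scale[OF bounded_linear.linear[OF lin]] by (simp add: scaleR_diff_right)
    show ?thesis unfolding eq using t(2)[of m] e by (simp add: divide_simps)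
  qed
  ultimately have "(\<lambda>m. norm ((f (x + t m *\<^sub>R e) - f x) /\<^sub>R t m - f' e)) \<longlonglongrightarrow> 0" by (simp only:)
  then show ?thesis by (rule LIM_zero_cancel[OF tendsto_norm_zero_cancel])
qed

text \<open>The mean value inequality on a segment; it provides the dominating constant for the
  difference quotients.\<close>

lemma difference_quotient_bound:
  fixes f :: "'a::real_normed_vector \<Rightarrow> 'b::real_normed_vector"
  assumes f: "\<And>x. (f has_derivative f' x) (at x)" and t: "0 < t" "t \<le> 1"
    and B: "\<And>s. 0 \<le> s \<Longrightarrow> s \<le> 1 \<Longrightarrow> norm (f' (x + s *\<^sub>R e) e) \<le> B"
  shows "norm ((f (x + t *\<^sub>R e) - f x) /\<^sub>R t) \<le> B"
proof -
  let ?g = "\<lambda>s. f (x + s *\<^sub>R e)"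
  have "norm (?g t - ?g 0) \<le> B * norm (t - 0)"
  proof (rule differentiable_bound)
    show "convex {0..t}" by simp
    fix s assume s: "s \<in> {0..t}"
    have "((\<lambda>s. x + s *\<^sub>R e) has_derivative (\<lambda>h. h *\<^sub>R e)) (at s)"
      by (auto intro!: derivative_eq_intros)
    then have "(?g has_derivative (\<lambda>h. f' (x + s *\<^sub>R e) (h *\<^sub>R e))) (at s)"
      by (rule has_derivative_compose[OF _ f])
    then show "(?g has_derivative (\<lambda>h. f' (x + s *\<^sub>R e) (h *\<^sub>R e))) (at s within {0..t})"
      by (rule has_derivative_at_withinI)
    have lin: "linear (f' (x + s *\<^sub>R e))"
      using f has_derivative_bounded_linear bounded_linear.linear by blast
    show "onorm (\<lambda>h. f' (x + s *\<^sub>R e) (h *\<^sub>R e)) \<le> B"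
    proof (rule onorm_le)
      fix h :: real
      have "\<bar>h\<bar> * norm (f' (x + s *\<^sub>R e) e) \<le> \<bar>h\<bar> * B"
        using B[of s] s t by (intro mult_left_mono) auto
      then show "norm (f' (x + s *\<^sub>R e) (h *\<^sub>R e)) \<le> B * norm h"
        by (simp add: linear_scale[OF lin] mult.commute)
    qed
  qed (use t in auto)
  then show ?thesis using t by (simp add: divide_simps mult.commute)
qed

text \<open>This is \<open>cell_difference_integral\<close> divided by \<open>t m\<close>, in the
  limit; dominated convergence applies on the cell and on each slab.\<close>

theorem polycell_divergence:
  fixes f :: "real^'n::{finite,wellorder} \<Rightarrow> complex"
  assumes K: "polycell K" and f: "\<And>x. (f has_derivative f' x) (at x)" and c: "continuous_on UNIV (\<lambda>x. f' x e)"
  shows "(LINT x:K|lebesgue. f' x e) = (\<Sum>F\<in>faces K. (outward_normal K F \<bullet> e) *\<^sub>R (LINT x:F|face_measure F. f x))"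
proof (cases "e = 0")
  case True
  have "f' x 0 = 0" for x
    using linear_0[OF bounded_linear.linear[OF has_derivative_bounded_linear[OF f]]] .
  then show ?thesis using True by (simp add: set_lebesgue_integral_def)
next
  case False
  let ?n = "outward_normal K" and ?b = "face_offset K"
  have fc: "continuous_on UNIV f"
    using f has_derivative_continuous continuous_at_imp_continuous_on by blast
  define t where "t m = inverse (real (Suc m))" for m
  have t: "t \<longlonglongrightarrow> 0" "\<And>m. t m > 0" "\<And>m. t m \<le> 1"
    unfolding t_def by (rule LIMSEQ_inverse_real_of_nat) (auto simp: divide_simps)
  obtain B where B: "\<And>x. x \<in> K \<Longrightarrow> norm x \<le> B"
    using polycell_bounded[OF K] unfolding bounded_iff by blast
  \<comment> \<open>As \<open>t m \<le> 1\<close>, the segments that start in \<open>K\<close> and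
    run along \<open>e\<close> stay in the ball of radius \<open>B + norm e\<close>.\<close>
  obtain M where M: "M \<ge> 0" "\<And>x. norm x \<le> B + norm e \<Longrightarrow> norm (f' x e) \<le> M"
    using bounded_norm_on_cball[OF c] by blast
  let ?q = "\<lambda>m x. (f (x + t m *\<^sub>R e) - f x) /\<^sub>R t m"
  have qc: "continuous_on UNIV (?q m)" for m
    by (intro continuous_intros fc continuous_on_compose2[OF fc, of UNIV "\<lambda>x. x + t m *\<^sub>R e"]) simp
  have norm_shift: "norm (x + s *\<^sub>R e) \<le> norm x + norm e" if "0 \<le> s" "s \<le> 1" for x s
  proof -
    have "norm (x + s *\<^sub>R e) \<le> norm x + s * norm e"
      using norm_triangle_ineq[of x "s *\<^sub>R e"] that by simp
    also have "\<dots> \<le> norm x + norm e" using that by (simp add: mult_left_le_one_le)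
    finally show ?thesis .
  qed
  have A: "(\<lambda>m. LINT x|lborel. indicator K x *\<^sub>R ?q m x) \<longlonglongrightarrow> (LINT x|lborel. indicator K x *\<^sub>R f' x e)"
  proof (rule integral_dominated_convergence[where w = "\<lambda>x. indicator K x *\<^sub>R M"])
    show "integrable lborel (\<lambda>x. indicator K x *\<^sub>R M)"
      by (rule cell_integrable(1)[OF K]) simp
    show "(\<lambda>x. indicator K x *\<^sub>R f' x e) \<in> borel_measurable lborel"
      using cell_integrable(1)[OF K c] by (rule borel_measurable_integrable)
    show "(\<lambda>x. indicator K x *\<^sub>R ?q m x) \<in> borel_measurable lborel" for m
      using cell_integrable(1)[OF K qc] by (rule borel_measurable_integrable)
    show "AE x in lborel. (\<lambda>m. indicator K x *\<^sub>R ?q m x) \<longlonglongrightarrow> indicator K x *\<^sub>R f' x e"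
      by (intro AE_I2 tendsto_scaleR tendsto_const difference_quotient_limit[OF f False t(1,2)])
    show "AE x in lborel. norm (indicator K x *\<^sub>R ?q m x) \<le> indicator K x *\<^sub>R M" for m
    proof (rule AE_I2)
      fix x
      have "norm (?q m x) \<le> M" if x: "x \<in> K"
      proof (rule difference_quotient_bound[OF f t(2,3)])
        fix s :: real assume "0 \<le> s" "s \<le> 1"
        then show "norm (f' (x + s *\<^sub>R e) e) \<le> M"
          using norm_shift[of s x] B[OF x] by (intro M(2)) simp
      qed
      then show "norm (indicator K x *\<^sub>R ?q m x) \<le> indicator K x *\<^sub>R M"
        by (cases "x \<in> K") auto
    qed
  qed
  \<comment> \<open>On the slab the coefficient of \<open>e\<close> lies between 0 and
    \<open>t m\<close>, so in the limit only the value of \<open>f\<close> at the projection is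
    left.\<close>
  let ?h = "\<lambda>F m y. f (fproj K F y + ((?n F \<bullet> y - ?b F + 1/2) * t m) *\<^sub>R e)"
  have S: "(\<lambda>m. LINT y|lborel. indicator (fslab K F) y *\<^sub>R ?h F m y)
      \<longlonglongrightarrow> (LINT y|lborel. indicator (fslab K F) y *\<^sub>R f (fproj K F y))" if F: "F \<in> faces K" for F
  proof -
    obtain C where C: "\<And>x. x \<in> F \<Longrightarrow> norm x \<le> C"
      using compact_imp_bounded[OF compact_face[OF K F]] unfolding bounded_iff by blast
    obtain N where N: "N \<ge> 0" "\<And>x. norm x \<le> C + norm e \<Longrightarrow> norm (f x) \<le> N"
      using bounded_norm_on_cball[OF fc] by blast
    have hc: "continuous_on UNIV (?h F m)" for m
      by (rule continuous_on_compose2[OF fc]) (auto intro!: continuous_intros continuous_hproj)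
    have pc: "continuous_on UNIV (\<lambda>y. f (fproj K F y))"
      by (rule continuous_on_compose2[OF fc]) (auto intro!: continuous_hproj)
    show ?thesis
    proof (rule integral_dominated_convergence[where w = "\<lambda>y. indicator (fslab K F) y *\<^sub>R N"])
      show "integrable lborel (\<lambda>y. indicator (fslab K F) y *\<^sub>R N)"
        by (rule slab_integrable[OF K F]) simp
      show "(\<lambda>y. indicator (fslab K F) y *\<^sub>R f (fproj K F y)) \<in> borel_measurable lborel"
        using slab_integrable[OF K F pc] by (rule borel_measurable_integrable)
      show "(\<lambda>y. indicator (fslab K F) y *\<^sub>R ?h F m y) \<in> borel_measurable lborel" for m
        using slab_integrable[OF K F hc] by (rule borel_measurable_integrable)
      show "AE y in lborel. (\<lambda>m. indicator (fslab K F) y *\<^sub>R ?h F m y) \<longlonglongrightarrow> indicator (fslab K F) y *\<^sub>R f (fproj K F y)"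
      proof (intro AE_I2 tendsto_scaleR tendsto_const)
        fix y
        let ?c = "?n F \<bullet> y - ?b F + 1/2"
        have "(\<lambda>m. fproj K F y + (?c * t m) *\<^sub>R e) \<longlonglongrightarrow> fproj K F y + (?c * 0) *\<^sub>R e"
          by (intro tendsto_intros t(1))
        then have "(\<lambda>m. fproj K F y + (?c * t m) *\<^sub>R e) \<longlonglongrightarrow> fproj K F y" by simp
        then show "(\<lambda>m. ?h F m y) \<longlonglongrightarrow> f (fproj K F y)"
          by (rule continuous_on_tendsto_compose[OF fc]) auto
      qed
      show "AE y in lborel. norm (indicator (fslab K F) y *\<^sub>R ?h F m y) \<le> indicator (fslab K F) y *\<^sub>R N" for m
      proof (rule AE_I2)
        fix y
        have "norm (?h F m y) \<le> N" if y: "y \<in> fslab K F"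
        proof -
          let ?r = "(?n F \<bullet> y - ?b F + 1/2) * t m"
          have pF: "fproj K F y \<in> F" and "\<bar>?n F \<bullet> y - ?b F\<bar> \<le> 1/2"
            using y unfolding slab_def mem_Collect_eq by (rule conjunct1, rule conjunct2)
          then have c01: "0 \<le> ?n F \<bullet> y - ?b F + 1/2" "?n F \<bullet> y - ?b F + 1/2 \<le> 1" by linarith+
          have "0 \<le> ?r" using c01 t(2)[of m] by simp
          moreover have "?r \<le> 1" using mult_mono[OF c01(2) t(3)[of m]] t(2)[of m] by simp
          ultimately have "norm (fproj K F y + ?r *\<^sub>R e) \<le> C + norm e"
            using norm_shift[of ?r "fproj K F y"] C[OF pF] by linarith
          then show ?thesis by (rule N(2))
        qed
        then show "norm (indicator (fslab K F) y *\<^sub>R ?h F m y) \<le> indicator (fslab K F) y *\<^sub>R N"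
          by (cases "y \<in> fslab K F") auto
      qed
    qed
  qed
  have eq: "(LINT x|lborel. indicator K x *\<^sub>R ?q m x)
      = (\<Sum>F\<in>faces K. (?n F \<bullet> e) *\<^sub>R (LINT y|lborel. indicator (fslab K F) y *\<^sub>R ?h F m y))" for m
  proof -
    have "(LINT x|lborel. indicator K x *\<^sub>R ?q m x)
        = inverse (t m) *\<^sub>R (LINT x|lborel. indicator K x *\<^sub>R (f (x + t m *\<^sub>R e) - f x))"
      unfolding integral_scaleR_right[symmetric]
      by (rule Bochner_Integration.integral_cong) (simp_all only: scaleR_left_commute)
    also have "\<dots> = (\<Sum>F\<in>faces K. (?n F \<bullet> e) *\<^sub>R (LINT y|lborel. indicator (fslab K F) y *\<^sub>R ?h F m y))"
      unfolding cell_difference_integral[OF K False t(2) fc] scaleR_sum_right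
      by (rule sum.cong) (use t(2)[of m] in simp_all)
    finally show ?thesis .
  qed
  have "(\<lambda>m. LINT x|lborel. indicator K x *\<^sub>R ?q m x)
      \<longlonglongrightarrow> (\<Sum>F\<in>faces K. (?n F \<bullet> e) *\<^sub>R (LINT y|lborel. indicator (fslab K F) y *\<^sub>R f (fproj K F y)))"
    unfolding eq by (intro tendsto_sum tendsto_scaleR tendsto_const S)
  then have "(LINT x|lborel. indicator K x *\<^sub>R f' x e)
      = (\<Sum>F\<in>faces K. (?n F \<bullet> e) *\<^sub>R (LINT y|lborel. indicator (fslab K F) y *\<^sub>R f (fproj K F y)))"
    by (rule LIMSEQ_unique[OF A])
  also have "\<dots> = (\<Sum>F\<in>faces K. (?n F \<bullet> e) *\<^sub>R (LINT x:F|face_measure F. f x))"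
    by (rule sum.cong[OF refl]) (simp add: face_integral_slab[OF K _ continuous_on_subset[OF fc]])
  finally show ?thesis by (simp add: cell_integral_lborel[OF K c])
qed

section \<open>Polynomial spaces\<close>

definition monomial :: "('n::finite \<Rightarrow> nat) \<Rightarrow> real^'n \<Rightarrow> complex" where
  "monomial \<alpha> x = (\<Prod>i\<in>UNIV. of_real (x $ i) ^ \<alpha> i)"

lemma poly_space_iff: "f \<in> poly_space c p \<longleftrightarrow> (\<exists>a. f = (\<lambda>x. \<Sum>\<alpha>\<in>exponents c p. a \<alpha> * monomial \<alpha> x))"
  by (simp add: poly_space_def monomial_def)

lemma finite_exponents: "finite (exponents c p :: ('n::finite \<Rightarrow> nat) set)"
proof -
  have fin: "finite {\<alpha> :: 'n \<Rightarrow> nat. \<forall>i. \<alpha> i \<le> p}"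
  proof -
    have "{\<alpha> :: 'n \<Rightarrow> nat. \<forall>i. \<alpha> i \<le> p} = PiE UNIV (\<lambda>_. {..p})" by auto
    then show ?thesis by (simp add: finite_PiE)
  qed
  show ?thesis
  proof (cases c)
    case Simplicial
    have "\<alpha> i \<le> p" if "sum \<alpha> UNIV \<le> p" for \<alpha> :: "'n \<Rightarrow> nat" and i
      using that member_le_sum[of i UNIV \<alpha>] by simp
    then show ?thesis using Simplicial by (auto intro: finite_subset[OF _ fin])
  qed (use fin in simp)
qed

text \<open>Truncated subtraction covers \<open>\<alpha> i = 0\<close>, where the derivative of the
  monomial carries the factor 0.\<close>

lemma exponents_decrease:
  assumes "\<alpha> \<in> exponents c p"
  shows "\<alpha>(i := \<alpha> i - 1) \<in> exponents c p"
proof (cases c)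
  case Simplicial
  have "sum (\<alpha>(i := \<alpha> i - 1)) UNIV \<le> sum \<alpha> UNIV" by (rule sum_mono) simp
  then show ?thesis using Simplicial assms by simp
next
  case Cubic
  then show ?thesis using assms by (auto intro: order_trans[OF diff_le_self])
qed

lemma exponents_Simplicial_decrease:
  assumes "\<alpha> \<in> exponents Simplicial (Suc d)" "\<alpha> i \<noteq> 0"
  shows "\<alpha>(i := \<alpha> i - 1) \<in> exponents Simplicial d"
proof -
  have "sum \<alpha> UNIV = \<alpha> i + sum \<alpha> (UNIV - {i})" by (simp add: sum.remove[of UNIV i])
  moreover have "sum (\<alpha>(i := \<alpha> i - 1)) UNIV = \<alpha> i - 1 + sum \<alpha> (UNIV - {i})"
    by (simp add: sum.remove[of UNIV i])
  ultimately show ?thesis using assms by simp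
qed

lemma poly_space_0: "(\<lambda>x. 0) \<in> poly_space c p"
  unfolding poly_space_iff by (rule exI[of _ "\<lambda>_. 0"]) simp

lemma poly_space_add:
  assumes "f \<in> poly_space c p" "g \<in> poly_space c p"
  shows "(\<lambda>x. f x + g x) \<in> poly_space c p"
proof -
  obtain a b where "f = (\<lambda>x. \<Sum>\<alpha>\<in>exponents c p. a \<alpha> * monomial \<alpha> x)" "g = (\<lambda>x. \<Sum>\<alpha>\<in>exponents c p. b \<alpha> * monomial \<alpha> x)"
    using assms unfolding poly_space_iff by (elim exE)
  then show ?thesis
    unfolding poly_space_iff by (intro exI[of _ "\<lambda>\<alpha>. a \<alpha> + b \<alpha>"]) (simp add: sum.distrib distrib_right)
qed

lemma poly_space_scale:
  assumes "f \<in> poly_space c p"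
  shows "(\<lambda>x. z * f x) \<in> poly_space c p"
proof -
  obtain a where "f = (\<lambda>x. \<Sum>\<alpha>\<in>exponents c p. a \<alpha> * monomial \<alpha> x)"
    using assms unfolding poly_space_iff by (elim exE)
  then show ?thesis
    unfolding poly_space_iff by (intro exI[of _ "\<lambda>\<alpha>. z * a \<alpha>"]) (simp add: sum_distrib_left mult.assoc)
qed

lemma poly_space_minus: "f \<in> poly_space c p \<Longrightarrow> (\<lambda>x. - f x) \<in> poly_space c p"
  using poly_space_scale[of f c p "-1"] by simp

lemma poly_space_diff: "f \<in> poly_space c p \<Longrightarrow> g \<in> poly_space c p \<Longrightarrow> (\<lambda>x. f x - g x) \<in> poly_space c p"
  using poly_space_add[OF _ poly_space_minus] by fastforce

lemma poly_space_sum: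
  assumes "\<And>i. i \<in> I \<Longrightarrow> f i \<in> poly_space c p"
  shows "(\<lambda>x. \<Sum>i\<in>I. f i x) \<in> poly_space c p"
proof (cases "finite I")
  case True
  then show ?thesis using assms by (induction I) (auto intro: poly_space_0 poly_space_add)
qed (simp add: poly_space_0)

lemma monomial_in_poly_space:
  assumes "\<alpha> \<in> exponents c p"
  shows "monomial \<alpha> \<in> poly_space c p"
proof -
  have "monomial \<alpha> x = (\<Sum>\<beta>\<in>exponents c p. (if \<beta> = \<alpha> then 1 else 0) * monomial \<beta> x)" for x
  proof -
    have "(\<Sum>\<beta>\<in>exponents c p. (if \<beta> = \<alpha> then 1 else 0) * monomial \<beta> x) = (\<Sum>\<beta>\<in>exponents c p. if \<beta> = \<alpha> then monomial \<beta> x else 0)"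
      by (rule sum.cong) auto
    then show ?thesis using assms by (simp add: finite_exponents)
  qed
  then show ?thesis unfolding poly_space_iff by (intro exI[of _ "\<lambda>\<beta>. if \<beta> = \<alpha> then 1 else 0"]) (rule ext)
qed

lemma poly_space_mono:
  assumes "exponents c p \<subseteq> (exponents d q :: ('n::finite \<Rightarrow> nat) set)" and f: "f \<in> poly_space c p"
  shows "(f :: real^'n \<Rightarrow> complex) \<in> poly_space d q"
proof -
  obtain a where a: "f = (\<lambda>x. \<Sum>\<alpha>\<in>exponents c p. a \<alpha> * monomial \<alpha> x)"
    using f unfolding poly_space_iff by (elim exE)
  show ?thesis unfolding a using assms(1) by (intro poly_space_sum poly_space_scale monomial_in_poly_space) auto
qed

text \<open>A partial derivative of a polynomial in \<open>poly_space Cubic p\<close> may still have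
  degree \<open>p\<close> in another variable. The descent that forces solutions to vanish therefore
  runs on the total degree, which is at most \<open>CARD('n) * p\<close>.\<close>

lemma poly_space_subset_Simplicial:
  assumes "(f :: real^'n \<Rightarrow> complex) \<in> poly_space c p"
  shows "f \<in> poly_space Simplicial (CARD('n) * p)"
proof (rule poly_space_mono[OF _ assms], cases c)
  case Simplicial
  have "1 * p \<le> CARD('n) * p" by (rule mult_right_mono) (simp_all add: Suc_leI)
  then show "exponents c p \<subseteq> (exponents Simplicial (CARD('n) * p) :: ('n \<Rightarrow> nat) set)"
    using Simplicial by (auto intro: order_trans)
next
  case Cubic
  have "sum \<alpha> UNIV \<le> CARD('n) * p" if "\<forall>i. \<alpha> i \<le> p" for \<alpha> :: "'n \<Rightarrow> nat"
    using sum_bounded_above[of UNIV \<alpha> p] that by simp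
  then show "exponents c p \<subseteq> (exponents Simplicial (CARD('n) * p) :: ('n \<Rightarrow> nat) set)"
    using Cubic by auto
qed

section \<open>Derivatives of polynomials\<close>

lemma monomial_has_derivative:
  "(monomial \<alpha> has_derivative (\<lambda>h. \<Sum>j\<in>UNIV. of_nat (\<alpha> j) * of_real (h $ j) * monomial (\<alpha>(j := \<alpha> j - 1)) x)) (at x)"
proof -
  have d: "((\<lambda>x. of_real (x $ j) ^ \<alpha> j :: complex) has_derivative
      (\<lambda>h. of_nat (\<alpha> j) * of_real (h $ j) * of_real (x $ j) ^ (\<alpha> j - 1))) (at x)" for j
  proof -
    have "((\<lambda>x::real^'a. of_real (x $ j) :: complex) has_derivative (\<lambda>h. of_real (h $ j))) (at x)"
      by (intro bounded_linear_imp_has_derivative bounded_linear_compose[OF bounded_linear_of_real] bounded_linear_vec_nth)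
    from has_derivative_power[OF this, of "\<alpha> j"] show ?thesis
      by (simp add: mult.commute mult.left_commute)
  qed
  have "((\<lambda>x. \<Prod>j\<in>UNIV. of_real (x $ j) ^ \<alpha> j :: complex) has_derivative
      (\<lambda>h. \<Sum>j\<in>UNIV. of_nat (\<alpha> j) * of_real (h $ j) * of_real (x $ j) ^ (\<alpha> j - 1) * (\<Prod>i\<in>UNIV - {j}. of_real (x $ i) ^ \<alpha> i))) (at x)"
    by (rule has_derivative_prod) (rule d)
  moreover have "of_real (x $ j) ^ (\<alpha> j - 1) * (\<Prod>i\<in>UNIV - {j}. of_real (x $ i) ^ \<alpha> i) = monomial (\<alpha>(j := \<alpha> j - 1)) x" for j
  proof -
    have "monomial (\<alpha>(j := \<alpha> j - 1)) x = of_real (x $ j) ^ (\<alpha> j - 1) * (\<Prod>i\<in>UNIV - {j}. of_real (x $ i) ^ (\<alpha>(j := \<alpha> j - 1)) i)"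
      unfolding monomial_def by (subst prod.remove[of UNIV j]) auto
    also have "(\<Prod>i\<in>UNIV - {j}. of_real (x $ i) ^ (\<alpha>(j := \<alpha> j - 1)) i :: complex) = (\<Prod>i\<in>UNIV - {j}. of_real (x $ i) ^ \<alpha> i)"
      by (rule prod.cong) auto
    finally show ?thesis ..
  qed
  ultimately show ?thesis unfolding monomial_def[abs_def, symmetric] by (simp add: mult.assoc monomial_def[abs_def])
qed

lemma monomial_sum_has_derivative:
  "((\<lambda>x. \<Sum>\<alpha>\<in>S. a \<alpha> * monomial \<alpha> x) has_derivative
    (\<lambda>h. \<Sum>\<alpha>\<in>S. a \<alpha> * (\<Sum>j\<in>UNIV. of_nat (\<alpha> j) * of_real (h $ j) * monomial (\<alpha>(j := \<alpha> j - 1)) x))) (at x)"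
  by (intro has_derivative_sum has_derivative_mult_right monomial_has_derivative)

lemma pderivative_monomial_sum:
  "pderivative i (\<lambda>x. \<Sum>\<alpha>\<in>S. a \<alpha> * monomial \<alpha> x)
    = (\<lambda>x. \<Sum>\<alpha>\<in>S. a \<alpha> * (of_nat (\<alpha> i) * monomial (\<alpha>(i := \<alpha> i - 1)) x))"
proof
  fix x
  have "pderivative i (\<lambda>x. \<Sum>\<alpha>\<in>S. a \<alpha> * monomial \<alpha> x) x
      = (\<Sum>\<alpha>\<in>S. a \<alpha> * (\<Sum>j\<in>UNIV. of_nat (\<alpha> j) * of_real (axis i 1 $ j) * monomial (\<alpha>(j := \<alpha> j - 1)) x))"
    unfolding pderivative_def frechet_derivative_at[OF monomial_sum_has_derivative, symmetric] ..
  also have "\<dots> = (\<Sum>\<alpha>\<in>S. a \<alpha> * (of_nat (\<alpha> i) * monomial (\<alpha>(i := \<alpha> i - 1)) x))"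
  proof (rule sum.cong[OF refl])
    fix \<alpha>
    have "(\<Sum>j\<in>UNIV. of_nat (\<alpha> j) * of_real (axis i 1 $ j) * monomial (\<alpha>(j := \<alpha> j - 1)) x)
        = (\<Sum>j\<in>UNIV. if j = i then of_nat (\<alpha> i) * monomial (\<alpha>(i := \<alpha> i - 1)) x else 0)"
      by (rule sum.cong) (auto simp: axis_def)
    then show "a \<alpha> * (\<Sum>j\<in>UNIV. of_nat (\<alpha> j) * of_real (axis i 1 $ j) * monomial (\<alpha>(j := \<alpha> j - 1)) x)
        = a \<alpha> * (of_nat (\<alpha> i) * monomial (\<alpha>(i := \<alpha> i - 1)) x)" by simp
  qed
  finally show "pderivative i (\<lambda>x. \<Sum>\<alpha>\<in>S. a \<alpha> * monomial \<alpha> x) x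
    = (\<Sum>\<alpha>\<in>S. a \<alpha> * (of_nat (\<alpha> i) * monomial (\<alpha>(i := \<alpha> i - 1)) x))" .
qed

lemma poly_has_derivative:
  assumes "f \<in> poly_space c p"
  shows "(f has_derivative frechet_derivative f (at x)) (at x)"
proof -
  obtain a where a: "f = (\<lambda>x. \<Sum>\<alpha>\<in>exponents c p. a \<alpha> * monomial \<alpha> x)"
    using assms unfolding poly_space_iff by (elim exE)
  have "f differentiable (at x)" unfolding a by (rule differentiableI[OF monomial_sum_has_derivative])
  then show ?thesis by (simp add: frechet_derivative_works)
qed

lemma continuous_poly: "f \<in> poly_space c p \<Longrightarrow> continuous_on S f"
  by (rule continuous_at_imp_continuous_on) (intro ballI has_derivative_continuous[OF poly_has_derivative])

lemma pderivative_poly: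
  assumes "f \<in> poly_space c p"
  shows "pderivative i f \<in> poly_space c p"
proof -
  obtain a where f: "f = (\<lambda>x. \<Sum>\<alpha>\<in>exponents c p. a \<alpha> * monomial \<alpha> x)"
    using assms unfolding poly_space_iff by (elim exE)
  note a = pderivative_monomial_sum[where i = i and S = "exponents c p" and a = a, folded f]
  show ?thesis unfolding a
    by (intro poly_space_sum poly_space_scale monomial_in_poly_space exponents_decrease)
qed

lemma pderivative_Simplicial_Suc:
  assumes "f \<in> poly_space Simplicial (Suc d)"
  shows "pderivative i f \<in> poly_space Simplicial d"
proof -
  obtain a where f: "f = (\<lambda>x. \<Sum>\<alpha>\<in>exponents Simplicial (Suc d). a \<alpha> * monomial \<alpha> x)"
    using assms unfolding poly_space_iff by (elim exE)
  note a = pderivative_monomial_sum[where i = i and S = "exponents Simplicial (Suc d)" and a = a, folded f]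
  have *: "(\<lambda>x. of_nat (\<alpha> i) * monomial (\<alpha>(i := \<alpha> i - 1)) x) \<in> poly_space Simplicial d"
    if "\<alpha> \<in> exponents Simplicial (Suc d)" for \<alpha>
  proof (cases "\<alpha> i = 0")
    case False
    show ?thesis
      by (intro poly_space_scale monomial_in_poly_space exponents_Simplicial_decrease[OF that False])
  qed (simp add: poly_space_0)
  show ?thesis unfolding a by (rule poly_space_sum) (rule poly_space_scale[OF *])
qed

lemma pderivative_Simplicial_0:
  assumes "f \<in> poly_space Simplicial 0"
  shows "pderivative i f = (\<lambda>x. 0)"
proof -
  obtain a where f: "f = (\<lambda>x. \<Sum>\<alpha>\<in>exponents Simplicial 0. a \<alpha> * monomial \<alpha> x)"
    using assms unfolding poly_space_iff by (elim exE)
  note a = pderivative_monomial_sum[where i = i and S = "exponents Simplicial 0" and a = a, folded f]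
  have "\<alpha> i = 0" if "\<alpha> \<in> exponents Simplicial 0" for \<alpha> :: "'a \<Rightarrow> nat" using that by simp
  then show ?thesis unfolding a by (intro ext sum.neutral ballI) simp
qed

section \<open>Zeros of polynomials, and integration by parts\<close>

lemma poly_on_line:
  assumes "f \<in> poly_space c p"
  obtains q :: "complex poly" where "\<And>s. f (x + s *\<^sub>R d) = poly q (of_real s)"
proof -
  obtain a where a: "f = (\<lambda>x. \<Sum>\<alpha>\<in>exponents c p. a \<alpha> * monomial \<alpha> x)"
    using assms unfolding poly_space_iff by (elim exE)
  define q where "q = (\<Sum>\<alpha>\<in>exponents c p. smult (a \<alpha>) (\<Prod>i\<in>UNIV. [:of_real (x $ i), of_real (d $ i):] ^ \<alpha> i))"
  have "f (x + s *\<^sub>R d) = poly q (of_real s)" for s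
    by (simp add: a q_def poly_sum poly_prod monomial_def)
  then show ?thesis by (rule that)
qed

text \<open>Restricted to the line through a point of \<open>U\<close> and an arbitrary
  \<open>y\<close>, it is a polynomial in one variable with infinitely many zeros.\<close>

lemma poly_eq_0_on_open:
  assumes f: "f \<in> poly_space c p" and U: "open U" "U \<noteq> {}" and z: "\<And>x. x \<in> U \<Longrightarrow> f x = 0"
  shows "f = (\<lambda>x. 0)"
proof
  fix y
  obtain x where x: "x \<in> U" using U by blast
  then obtain e where e: "e > 0" "ball x e \<subseteq> U" using U(1) open_contains_ball by blast
  obtain q where q: "\<And>s. f (x + s *\<^sub>R (y - x)) = poly q (of_real s)" using poly_on_line[OF f] by blast
  \<comment> \<open>For \<open>s\<close> below \<open>r\<close> the point stays in the ball; the
    summand 1 avoids a division by 0 when \<open>y = x\<close>.\<close>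
  define r where "r = e / (norm (y - x) + 1)"
  have r: "r > 0" using e(1) by (simp add: r_def add_nonneg_pos)
  have zero: "poly q (of_real s) = 0" if s: "s \<in> {0<..<r}" for s
  proof -
    have "norm (s *\<^sub>R (y - x)) \<le> s * (norm (y - x) + 1)" using s by simp
    also have "\<dots> < r * (norm (y - x) + 1)"
      using s by (intro mult_strict_right_mono) (auto simp: add_nonneg_pos)
    also have "\<dots> = e" using norm_ge_zero[of "y - x"] by (simp add: r_def add_nonneg_eq_0_iff)
    finally have "x + s *\<^sub>R (y - x) \<in> ball x e" by (simp add: dist_norm)
    then have "f (x + s *\<^sub>R (y - x)) = 0" using e(2) z by blast
    then show ?thesis using q by simp
  qed
  have "q = 0"
  proof (rule ccontr)
    assume "q \<noteq> 0"
    then have fin: "finite {w. poly q w = 0}" by (rule poly_roots_finite)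
    have "infinite ((of_real :: real \<Rightarrow> complex) ` {0<..<r})"
      using r infinite_Ioo[of 0 r] finite_imageD[of "of_real :: real \<Rightarrow> complex" "{0<..<r}"] inj_of_real inj_on_subset by blast
    moreover have "(of_real :: real \<Rightarrow> complex) ` {0<..<r} \<subseteq> {w. poly q w = 0}" using zero by blast
    ultimately show False using fin finite_subset by blast
  qed
  then show "f y = 0" using q[of 1] by simp
qed

text \<open>The divergence theorem for the product \<open>f x * cnj (g x)\<close> in the direction
  \<open>axis i 1\<close>.\<close>

lemma product_integral_by_parts:
  fixes f g :: "real^'n::{finite,wellorder} \<Rightarrow> complex"
  assumes K: "polycell K" and f: "f \<in> poly_space c p" and g: "g \<in> poly_space c p"
  shows "ip K (pderivative i f) g + ip K f (pderivative i g)
    = (\<Sum>F\<in>faces K. of_real (outward_normal K F $ i) * (LINT x:F|face_measure F. f x * cnj (g x)))"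
proof -
  let ?D = "\<lambda>f x. frechet_derivative f (at x)"
  have d: "((\<lambda>x. f x * cnj (g x)) has_derivative (\<lambda>h. f x * cnj (?D g x h) + ?D f x h * cnj (g x))) (at x)" for x
    by (intro has_derivative_mult has_derivative_cnj poly_has_derivative[OF f] poly_has_derivative[OF g])
  have eq: "f x * cnj (?D g x (axis i 1)) + ?D f x (axis i 1) * cnj (g x)
      = pderivative i f x * cnj (g x) + f x * cnj (pderivative i g x)" for x
    by (simp add: pderivative_def)
  note fc = continuous_poly[OF f] and gc = continuous_poly[OF g]
  note dfc = continuous_poly[OF pderivative_poly[OF f]] and dgc = continuous_poly[OF pderivative_poly[OF g]]
  have c1: "continuous_on UNIV (\<lambda>x. pderivative i f x * cnj (g x))"
    and c2: "continuous_on UNIV (\<lambda>x. f x * cnj (pderivative i g x))"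
    by (intro continuous_intros fc gc dfc dgc)+
  have "ip K (pderivative i f) g + ip K f (pderivative i g)
      = (LINT x:K|lebesgue. pderivative i f x * cnj (g x) + f x * cnj (pderivative i g x))"
    unfolding ip_def by (rule set_integral_add(2)[OF cell_integrable(2)[OF K c1] cell_integrable(2)[OF K c2], symmetric])
  also have "\<dots> = (\<Sum>F\<in>faces K. (outward_normal K F \<bullet> axis i 1) *\<^sub>R (LINT x:F|face_measure F. f x * cnj (g x)))"
    unfolding eq[symmetric] by (rule polycell_divergence[OF K d]) (unfold eq, intro continuous_intros c1 c2)
  finally show ?thesis by (simp add: inner_axis scaleR_conv_of_real)
qed

section \<open>Square linear systems\<close>

text \<open>Gaussian elimination, by induction on the equations.\<close>

lemma homogeneous_system_solution:
  fixes A :: "'i \<Rightarrow> 'j \<Rightarrow> complex"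
  assumes "finite J" "finite I" "card J < card I"
  shows "\<exists>c. (\<exists>i\<in>I. c i \<noteq> 0) \<and> (\<forall>j\<in>J. (\<Sum>i\<in>I. c i * A i j) = 0)"
  using assms
proof (induction J arbitrary: I A rule: finite_induct)
  case empty
  then have "I \<noteq> {}" by auto
  then show ?case by (intro exI[of _ "\<lambda>_. 1"]) auto
next
  case (insert j J)
  show ?case
  proof (cases "\<forall>i\<in>I. A i j = 0")
    case True
    have "card J < card I" using insert.prems insert.hyps by simp
    then obtain c where c: "\<exists>i\<in>I. c i \<noteq> 0" "\<forall>j\<in>J. (\<Sum>i\<in>I. c i * A i j) = 0"
      using insert.IH[OF insert.prems(1)] by blast
    have "(\<Sum>i\<in>I. c i * A i j) = 0" using True by simp
    then show ?thesis using c by blast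
  next
    case False
    then obtain k where k: "k \<in> I" "A k j \<noteq> 0" by blast
    let ?I = "I - {k}"
    \<comment> \<open>The coefficients after the equation \<open>j\<close> has been solved for the
      unknown \<open>k\<close>, whose value is recovered below as \<open>- s\<close>.\<close>
    let ?B = "\<lambda>i m. A i m - A i j / A k j * A k m"
    have "card J < card ?I" using insert.prems insert.hyps k by simp
    then obtain c where c: "\<exists>i\<in>?I. c i \<noteq> 0" "\<forall>m\<in>J. (\<Sum>i\<in>?I. c i * ?B i m) = 0"
      using insert.IH[of ?I ?B] insert.prems by blast
    define s where "s = (\<Sum>i\<in>?I. c i * (A i j / A k j))"
    define d where "d = c(k := - s)"
    have sum: "(\<Sum>i\<in>I. d i * A i m) = (\<Sum>i\<in>?I. c i * A i m) - s * A k m" for m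
    proof -
      have "(\<Sum>i\<in>I. d i * A i m) = d k * A k m + (\<Sum>i\<in>?I. d i * A i m)"
        by (rule sum.remove[OF insert.prems(1) k(1)])
      also have "(\<Sum>i\<in>?I. d i * A i m) = (\<Sum>i\<in>?I. c i * A i m)"
        by (rule sum.cong) (auto simp: d_def)
      finally show ?thesis by (simp add: d_def)
    qed
    have "(\<Sum>i\<in>I. d i * A i m) = (\<Sum>i\<in>?I. c i * ?B i m)" for m
      unfolding sum s_def by (simp add: algebra_simps sum_subtractf sum_distrib_left)
    then have "\<forall>m\<in>J. (\<Sum>i\<in>I. d i * A i m) = 0" using c(2) by simp
    moreover have "(\<Sum>i\<in>I. d i * A i j) = 0"
      unfolding sum s_def using k(2) by (simp add: sum_distrib_right)
    moreover have "\<exists>i\<in>I. d i \<noteq> 0" using c(1) by (auto simp: d_def)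
    ultimately show ?thesis by blast
  qed
qed

text \<open>The right-hand side becomes a further unknown, indexed by \<open>None\<close>. With more
  unknowns than equations there is a nontrivial solution; injectivity keeps its entry at
  \<open>None\<close> from vanishing, and dividing by that entry solves the system.\<close>

lemma square_system_solvable:
  fixes A :: "'i \<Rightarrow> 'i \<Rightarrow> complex"
  assumes I: "finite I" and inj: "\<And>c. (\<And>j. j \<in> I \<Longrightarrow> (\<Sum>i\<in>I. c i * A i j) = 0) \<Longrightarrow> (\<And>i. i \<in> I \<Longrightarrow> c i = 0)"
  shows "\<exists>c. \<forall>j\<in>I. (\<Sum>i\<in>I. c i * A i j) = d j"
proof -
  let ?A = "\<lambda>x j. case x of None \<Rightarrow> - d j | Some i \<Rightarrow> A i j"
  let ?I = "insert None (Some ` I)"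
  have "card I < card ?I" using I by (simp add: card_image)
  then obtain c where c: "\<exists>x\<in>?I. c x \<noteq> 0" "\<forall>j\<in>I. (\<Sum>x\<in>?I. c x * ?A x j) = 0"
    using homogeneous_system_solution[of I ?I ?A] I by blast
  have sum: "(\<Sum>x\<in>?I. c x * ?A x j) = - (c None * d j) + (\<Sum>i\<in>I. c (Some i) * A i j)" for j
    using I by (subst sum.insert) (auto simp: sum.reindex)
  have eq: "(\<Sum>i\<in>I. c (Some i) * A i j) = c None * d j" if "j \<in> I" for j
    using c(2) that sum[of j] by simp
  have "c None \<noteq> 0"
  proof
    assume 0: "c None = 0"
    then have "c (Some i) = 0" if "i \<in> I" for i
      using inj[of "\<lambda>i. c (Some i)"] eq that by simp
    then show False using c(1) 0 by auto
  qed
  then have "(\<Sum>i\<in>I. c (Some i) / c None * A i j) = d j" if "j \<in> I" for j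
    using eq[OF that] by (simp add: sum_divide_distrib[symmetric] divide_simps mult.commute)
  then show ?thesis by (intro exI[where x = "\<lambda>i. c (Some i) / c None"] ballI)
qed

text \<open>Scalars are complex, so this is not the \<open>span\<close> of a real vector
  space.\<close>

definition cspan :: "'i set \<Rightarrow> ('i \<Rightarrow> 'x \<Rightarrow> complex) \<Rightarrow> ('x \<Rightarrow> complex) set" where
  "cspan I b = {f. \<exists>c. f = (\<lambda>x. \<Sum>i\<in>I. c i * b i x)}"

lemma cspan_mono:
  assumes "finite I" "J \<subseteq> I"
  shows "cspan J b \<subseteq> cspan I b"
proof
  fix f assume "f \<in> cspan J b"
  then obtain c where c: "f = (\<lambda>x. \<Sum>i\<in>J. c i * b i x)" by (auto simp: cspan_def)
  have "(\<Sum>i\<in>J. c i * b i x) = (\<Sum>i\<in>I. (if i \<in> J then c i else 0) * b i x)" for x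
    using assms by (intro sum.mono_neutral_cong_left) auto
  then show "f \<in> cspan I b" unfolding c cspan_def by (intro CollectI exI) (rule ext)
qed

lemma cspan_remove_dependent:
  assumes I: "finite I" and k: "k \<in> I" "c k \<noteq> 0" and dep: "\<And>x. (\<Sum>i\<in>I. c i * b i x) = 0"
  shows "cspan (I - {k}) b = cspan I b"
proof
  show "cspan (I - {k}) b \<subseteq> cspan I b" by (rule cspan_mono[OF I]) auto
  show "cspan I b \<subseteq> cspan (I - {k}) b"
  proof
    fix f assume "f \<in> cspan I b"
    then obtain a where a: "f = (\<lambda>x. \<Sum>i\<in>I. a i * b i x)" by (auto simp: cspan_def)
    have "f x = (\<Sum>i\<in>I - {k}. (a i - a k / c k * c i) * b i x)" for x
    proof -
      have "f x = (\<Sum>i\<in>I. a i * b i x) - a k / c k * (\<Sum>i\<in>I. c i * b i x)"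
        by (simp add: a dep)
      also have "\<dots> = (\<Sum>i\<in>I. (a i - a k / c k * c i) * b i x)"
        by (simp add: sum_distrib_left sum_subtractf[symmetric] algebra_simps)
      also have "\<dots> = (\<Sum>i\<in>I - {k}. (a i - a k / c k * c i) * b i x)"
        using k(2) by (subst sum.remove[OF I k(1)]) simp
      finally show ?thesis .
    qed
    then show "f \<in> cspan (I - {k}) b" unfolding cspan_def by (intro CollectI exI) (rule ext)
  qed
qed

text \<open>Lets the monomials enter as a mere generating family: discarding dependent members one
  by one leaves an independent family with the same span.\<close>

lemma cspan_independent_subset:
  assumes "finite I"
  shows "\<exists>J\<subseteq>I. cspan J b = cspan I b \<and> (\<forall>c. (\<forall>x. (\<Sum>i\<in>J. c i * b i x) = 0) \<longrightarrow> (\<forall>i\<in>J. c i = 0))"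
  using assms
proof (induction "card I" arbitrary: I rule: less_induct)
  case less
  show ?case
  proof (cases "\<forall>c. (\<forall>x. (\<Sum>i\<in>I. c i * b i x) = 0) \<longrightarrow> (\<forall>i\<in>I. c i = 0)")
    case False
    then obtain c k where c: "\<forall>x. (\<Sum>i\<in>I. c i * b i x) = 0" "k \<in> I" "c k \<noteq> 0" by blast
    have "card (I - {k}) < card I" using less.prems c(2) by (rule card_Diff1_less)
    then obtain J where J: "J \<subseteq> I - {k}" "cspan J b = cspan (I - {k}) b"
        "\<forall>c. (\<forall>x. (\<Sum>i\<in>J. c i * b i x) = 0) \<longrightarrow> (\<forall>i\<in>J. c i = 0)"
      using less.hyps[of "I - {k}"] less.prems by (metis finite_Diff)
    moreover have "cspan (I - {k}) b = cspan I b"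
      by (rule cspan_remove_dependent[where c = c, OF less.prems c(2,3)]) (use c(1) in blast)
    ultimately show ?thesis by (intro exI[of _ J]) auto
  qed blast
qed

text \<open>The map \<sigma> is the identity for linear functionals and \<open>cnj\<close> for
  conjugate-linear ones.\<close>

lemma linear_functional_on_cspan:
  fixes L :: "('x \<Rightarrow> complex) \<Rightarrow> complex"
  assumes "finite I" and lin: "\<And>a f g. f \<in> cspan I b \<Longrightarrow> g \<in> cspan I b \<Longrightarrow> L (\<lambda>x. a * f x + g x) = \<sigma> a * L f + L g"
    and J: "J \<subseteq> I" and \<sigma>: "\<sigma> 1 = (1 :: complex)"
  shows "L (\<lambda>x. \<Sum>i\<in>J. c i * b i x) = (\<Sum>i\<in>J. \<sigma> (c i) * L (b i))"
proof -
  have b: "b i \<in> cspan I b" if i: "i \<in> I" for i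
  proof -
    have "(\<Sum>j\<in>I. (if j = i then 1 else 0) * b j x) = (\<Sum>j\<in>I. if j = i then b i x else 0)" for x
      by (rule sum.cong) auto
    then have "b i = (\<lambda>x. \<Sum>j\<in>I. (if j = i then 1 else 0) * b j x)"
      using i assms(1) by (simp add: fun_eq_iff)
    then show ?thesis unfolding cspan_def by (intro CollectI exI)
  qed
  have zero: "(\<lambda>x. 0) \<in> cspan I b" unfolding cspan_def by (auto intro!: exI[of _ "\<lambda>_. 0"])
  have "L (\<lambda>x. 0) = \<sigma> 1 * L (\<lambda>x. 0) + L (\<lambda>x. 0)" using lin[OF zero zero, of 1] by simp
  then have L0: "L (\<lambda>x. 0) = 0" by (simp add: \<sigma>)
  have "finite J" using J assms(1) finite_subset by blast
  then show ?thesis using J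
  proof (induction J)
    case empty
    then show ?case by (simp add: L0)
  next
    case (insert k J)
    have "(\<lambda>x. \<Sum>i\<in>J. c i * b i x) \<in> cspan J b" unfolding cspan_def by blast
    then have "(\<lambda>x. \<Sum>i\<in>J. c i * b i x) \<in> cspan I b" using cspan_mono[OF assms(1), of J b] insert.prems by blast
    then show ?case using insert lin[OF b[of k]] by simp
  qed
qed

text \<open>Trial and test space coincide, so in an independent generating family the problem is a
  square system, and nondegeneracy is its injectivity.\<close>

lemma sesquilinear_problem_solvable:
  fixes B :: "('x \<Rightarrow> complex) \<Rightarrow> ('x \<Rightarrow> complex) \<Rightarrow> complex"
  assumes I: "finite I"
    and lin: "\<And>a f g h. f \<in> cspan I b \<Longrightarrow> g \<in> cspan I b \<Longrightarrow> h \<in> cspan I b \<Longrightarrow> B (\<lambda>x. a * f x + g x) h = a * B f h + B g h"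
    and antilin: "\<And>a f g h. f \<in> cspan I b \<Longrightarrow> g \<in> cspan I b \<Longrightarrow> h \<in> cspan I b \<Longrightarrow> B h (\<lambda>x. a * f x + g x) = cnj a * B h f + B h g"
    and l: "\<And>a f g. f \<in> cspan I b \<Longrightarrow> g \<in> cspan I b \<Longrightarrow> l (\<lambda>x. a * f x + g x) = cnj a * l f + l g"
    and nondeg: "\<And>f. f \<in> cspan I b \<Longrightarrow> (\<And>g. g \<in> cspan I b \<Longrightarrow> B f g = 0) \<Longrightarrow> f = (\<lambda>x. 0)"
  shows "\<exists>f\<in>cspan I b. \<forall>g\<in>cspan I b. B f g = l g"
proof -
  obtain J where J: "J \<subseteq> I" and span: "cspan J b = cspan I b"
    and indep: "\<And>c. (\<forall>x. (\<Sum>i\<in>J. c i * b i x) = 0) \<Longrightarrow> (\<forall>i\<in>J. c i = 0)"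
    using cspan_independent_subset[OF I] by metis
  have finJ: "finite J" using J I finite_subset by blast
  let ?f = "\<lambda>c x. \<Sum>i\<in>J. c i * b i x"
  have "?f c \<in> cspan J b" for c unfolding cspan_def by (intro CollectI exI) (rule refl)
  then have mem: "?f c \<in> cspan I b" for c unfolding span .
  have rep: "\<exists>d. g = ?f d" if "g \<in> cspan I b" for g
    using that unfolding span[symmetric] unfolding cspan_def by (rule CollectD)
  have bJ: "b j \<in> cspan I b" if j: "j \<in> J" for j
  proof -
    have "(\<Sum>i\<in>J. (if i = j then 1 else 0) * b i x) = (\<Sum>i\<in>J. if i = j then b j x else 0)" for x
      by (rule sum.cong) auto
    then have "b j = ?f (\<lambda>i. if i = j then 1 else 0)" using j finJ by (simp add: fun_eq_iff)
    then show ?thesis using mem[of "\<lambda>i. if i = j then 1 else 0"] by (simp only:)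
  qed
  have Bsum: "B (?f c) h = (\<Sum>i\<in>J. c i * B (b i) h)" if "h \<in> cspan I b" for c h
    by (rule linear_functional_on_cspan[where L = "\<lambda>f. B f h" and \<sigma> = "\<lambda>a. a", OF I lin[OF _ _ that] J]) auto
  have Banti: "B h (?f c) = (\<Sum>i\<in>J. cnj (c i) * B h (b i))" if "h \<in> cspan I b" for c h
    by (rule linear_functional_on_cspan[where L = "B h" and \<sigma> = cnj, OF I antilin[OF _ _ that] J]) auto
  have lsum: "l (?f c) = (\<Sum>i\<in>J. cnj (c i) * l (b i))" for c
    by (rule linear_functional_on_cspan[where L = l and \<sigma> = cnj, OF I l J]) auto
  have "\<exists>c. \<forall>j\<in>J. (\<Sum>i\<in>J. c i * B (b i) (b j)) = l (b j)"
  proof (rule square_system_solvable[OF finJ])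
    fix c i assume z: "\<And>j. j \<in> J \<Longrightarrow> (\<Sum>i\<in>J. c i * B (b i) (b j)) = 0" and i: "i \<in> J"
    have "B (?f c) g = 0" if g: "g \<in> cspan I b" for g
    proof -
      obtain d where d: "g = ?f d" using rep[OF g] by (elim exE)
      show ?thesis unfolding d Banti[OF mem] using Bsum[OF bJ] z by simp
    qed
    then have "?f c = (\<lambda>x. 0)" by (rule nondeg[OF mem])
    then have "\<forall>x. (\<Sum>i\<in>J. c i * b i x) = 0" by (simp add: fun_eq_iff)
    then show "c i = 0" using indep i by blast
  qed
  then obtain c where c: "\<And>j. j \<in> J \<Longrightarrow> (\<Sum>i\<in>J. c i * B (b i) (b j)) = l (b j)" by blast
  have "B (?f c) g = l g" if g: "g \<in> cspan I b" for g
  proof -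
    obtain d where d: "g = ?f d" using rep[OF g] by (elim exE)
    show ?thesis unfolding d Banti[OF mem] lsum using Bsum[OF bJ] c by simp
  qed
  then show ?thesis using mem by blast
qed

text \<open>A tuple of scalar polynomials \<open>f m\<close> is encoded as the function \<open>(m, x) \<mapsto> f m x\<close>.\<close>

lemma poly_tuples_eq_cspan:
  "{f. \<forall>m. (\<lambda>x. f (m, x)) \<in> poly_space c p}
    = cspan (UNIV \<times> exponents c p) (\<lambda>(m :: 'm::finite, \<alpha>) (m', x :: real^'n). if m' = m then monomial \<alpha> x else 0)"
    (is "?P = cspan ?I ?b")
proof -
  have eq: "(\<Sum>i\<in>?I. a i * ?b i (m, x)) = (\<Sum>\<alpha>\<in>exponents c p. a (m, \<alpha>) * monomial \<alpha> x)" for a m x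
  proof -
    have "(\<Sum>i\<in>?I. a i * ?b i (m, x)) = (\<Sum>m'\<in>UNIV. \<Sum>\<alpha>\<in>exponents c p. a (m', \<alpha>) * ?b (m', \<alpha>) (m, x))"
      unfolding sum.cartesian_product by (rule sum.cong) auto
    also have "\<dots> = (\<Sum>m'\<in>UNIV. if m' = m then (\<Sum>\<alpha>\<in>exponents c p. a (m, \<alpha>) * monomial \<alpha> x) else 0)"
      by (rule sum.cong) auto
    finally show ?thesis by simp
  qed
  show ?thesis
  proof
    show "?P \<subseteq> cspan ?I ?b"
    proof
      fix f assume "f \<in> ?P"
      then have "\<forall>m. \<exists>a. (\<lambda>x. f (m, x)) = (\<lambda>x. \<Sum>\<alpha>\<in>exponents c p. a \<alpha> * monomial \<alpha> x)"
        unfolding poly_space_iff by simp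
      then obtain a where a: "\<And>m. (\<lambda>x. f (m, x)) = (\<lambda>x. \<Sum>\<alpha>\<in>exponents c p. a m \<alpha> * monomial \<alpha> x)"
        by metis
      have "f z = (\<Sum>i\<in>?I. (\<lambda>(m, \<alpha>). a m \<alpha>) i * ?b i z)" for z
        using fun_cong[OF a[of "fst z"], of "snd z"] eq[of "\<lambda>(m, \<alpha>). a m \<alpha>" "fst z" "snd z"] by simp
      then show "f \<in> cspan ?I ?b" unfolding cspan_def by (intro CollectI exI) (rule ext)
    qed
    show "cspan ?I ?b \<subseteq> ?P"
    proof
      fix f assume "f \<in> cspan ?I ?b"
      then obtain a where a: "f = (\<lambda>z. \<Sum>i\<in>?I. a i * ?b i z)" unfolding cspan_def by blast
      have "(\<lambda>x. f (m, x)) = (\<lambda>x. \<Sum>\<alpha>\<in>exponents c p. a (m, \<alpha>) * monomial \<alpha> x)" for m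
        unfolding a eq ..
      then show "f \<in> ?P" unfolding poly_space_iff by (intro CollectI allI exI)
    qed
  qed
qed

lemma poly_tuple_problem_solvable:
  fixes B :: "('m::finite \<times> (real^'n) \<Rightarrow> complex) \<Rightarrow> ('m \<times> (real^'n) \<Rightarrow> complex) \<Rightarrow> complex" and c :: cell_kind and p :: nat
  defines "V \<equiv> {f. \<forall>m. (\<lambda>x. f (m, x)) \<in> poly_space c p}"
  assumes "\<And>a f g h. f \<in> V \<Longrightarrow> g \<in> V \<Longrightarrow> h \<in> V \<Longrightarrow> B (\<lambda>x. a * f x + g x) h = a * B f h + B g h"
    and "\<And>a f g h. f \<in> V \<Longrightarrow> g \<in> V \<Longrightarrow> h \<in> V \<Longrightarrow> B h (\<lambda>x. a * f x + g x) = cnj a * B h f + B h g"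
    and "\<And>a f g. f \<in> V \<Longrightarrow> g \<in> V \<Longrightarrow> l (\<lambda>x. a * f x + g x) = cnj a * l f + l g"
    and "\<And>f. f \<in> V \<Longrightarrow> (\<And>g. g \<in> V \<Longrightarrow> B f g = 0) \<Longrightarrow> f = (\<lambda>x. 0)"
  shows "\<exists>f\<in>V. \<forall>g\<in>V. B f g = l g"
  using assms(2-) unfolding V_def poly_tuples_eq_cspan
  by (intro sesquilinear_problem_solvable) (simp_all add: finite_exponents)

section \<open>Sesquilinear forms on a cell and its boundary\<close>

text \<open>The products \<open>ip\<close>, \<open>vip\<close>, \<open>bip\<close> and
  \<open>vbip\<close> all reduce to this integral or to \<open>fint\<close>, so that linearity,
  conjugation and positivity are treated once for cells and once for boundaries.\<close>

definition cint :: "(real^'n) set \<Rightarrow> (real^'n \<Rightarrow> complex) \<Rightarrow> complex" where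
  "cint K f = (LINT x:K|lebesgue. f x)"

definition fint :: "(real^'n) set \<Rightarrow> ((real^'n) set \<Rightarrow> real^'n \<Rightarrow> complex) \<Rightarrow> complex" where
  "fint K g = (\<Sum>F\<in>faces K. LINT x:F|face_measure F. g F x)"

text \<open>Continuity on each face separately: trace data need not agree where two faces
  meet.\<close>

definition fcont :: "(real^'n) set \<Rightarrow> ((real^'n) set \<Rightarrow> real^'n \<Rightarrow> 'b::topological_space) \<Rightarrow> bool" where
  "fcont K g \<longleftrightarrow> (\<forall>F\<in>faces K. continuous_on F (g F))"

lemma ip_cint: "ip K f g = cint K (\<lambda>x. f x * cnj (g x))"
  by (simp add: ip_def cint_def)

lemma vip_cint: "vip K f g = cint K (\<lambda>x. hdot (f x) (g x))"
  by (simp add: vip_def cint_def)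

lemma bip_fint: "bip K f g = fint K (\<lambda>F x. f F x * cnj (g F x))"
  by (simp add: bip_def fint_def)

lemma vbip_fint: "vbip K f g = fint K (\<lambda>F x. hdot (f F x) (g F x))"
  by (simp add: vbip_def fint_def)

lemma cint_cnj: "cint K (\<lambda>x. cnj (f x)) = cnj (cint K f)"
proof -
  have "indicator K x *\<^sub>R cnj (f x) = cnj (indicator K x *\<^sub>R f x)" for x by simp
  then show ?thesis unfolding cint_def set_lebesgue_integral_def by (simp only: Bochner_Integration.integral_cnj)
qed

lemma fint_cnj: "fint K (\<lambda>F x. cnj (g F x)) = cnj (fint K g)"
proof -
  have "indicator F x *\<^sub>R cnj (g F x) = cnj (indicator F x *\<^sub>R g F x)" for F x by simp
  then show ?thesis unfolding fint_def set_lebesgue_integral_def by (simp only: Bochner_Integration.integral_cnj cnj_sum)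
qed

lemma cint_scale: "cint K (\<lambda>x. a * f x) = a * cint K f"
  unfolding cint_def by (rule set_integral_mult_right)

lemma fint_scale: "fint K (\<lambda>F x. a * g F x) = a * fint K g"
  unfolding fint_def sum_distrib_left by (intro sum.cong refl set_integral_mult_right)

lemma cint_minus: "cint K (\<lambda>x. - f x) = - cint K f"
  using cint_scale[of K "-1" f] by simp

lemma fint_minus: "fint K (\<lambda>F x. - g F x) = - fint K g"
  using fint_scale[of K "-1" g] by simp

lemma cint_zero: "cint K (\<lambda>x. 0) = 0"
  by (simp add: cint_def set_lebesgue_integral_def)

lemma fint_zero: "fint K (\<lambda>F x. 0) = 0"
  by (simp add: fint_def set_lebesgue_integral_def)

lemma fint_cong: "(\<And>F x. F \<in> faces K \<Longrightarrow> x \<in> F \<Longrightarrow> f F x = g F x) \<Longrightarrow> fint K f = fint K g"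
  unfolding fint_def set_lebesgue_integral_def
  by (intro sum.cong refl Bochner_Integration.integral_cong) (auto simp: indicator_def)

lemma cint_add_integrable:
  assumes "set_integrable lebesgue K f" "set_integrable lebesgue K g"
  shows "cint K (\<lambda>x. f x + g x) = cint K f + cint K g"
  unfolding cint_def by (rule set_integral_add(2)[OF assms])

lemma cint_add:
  assumes "polycell K" "continuous_on UNIV f" "continuous_on UNIV g"
  shows "cint K (\<lambda>x. f x + g x) = cint K f + cint K g"
  using assms by (intro cint_add_integrable cell_integrable(2))

lemma fint_add:
  assumes K: "polycell K" and fg: "fcont K f" "fcont K g"
  shows "fint K (\<lambda>F x. f F x + g F x) = fint K f + fint K g"
  unfolding fint_def sum.distrib[symmetric]
proof (rule sum.cong[OF refl])
  fix F assume F: "F \<in> faces K"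
  have "continuous_on F (f F)" "continuous_on F (g F)" using fg F by (simp_all add: fcont_def)
  then show "(LINT x:F|face_measure F. f F x + g F x) = (LINT x:F|face_measure F. f F x) + (LINT x:F|face_measure F. g F x)"
    by (intro set_integral_add(2) face_integrable[OF K F])
qed

lemma cint_diff:
  assumes "polycell K" "continuous_on UNIV f" "continuous_on UNIV g"
  shows "cint K (\<lambda>x. f x - g x) = cint K f - cint K g"
  using cint_add[OF assms(1,2) continuous_on_minus[OF assms(3)]] by (simp add: cint_minus)

lemma fint_diff:
  assumes "polycell K" "fcont K f" "fcont K g"
  shows "fint K (\<lambda>F x. f F x - g F x) = fint K f - fint K g"
proof -
  have "fcont K (\<lambda>F x. - g F x)" using assms(3) by (auto simp: fcont_def intro: continuous_on_minus)
  from fint_add[OF assms(1,2) this] show ?thesis by (simp add: fint_minus)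
qed

text \<open>Packages a squared norm as a real number that vanishes only together with its integrand,
  as the energy identities use it.\<close>

lemma cint_nonneg:
  assumes K: "polycell K" and g: "continuous_on UNIV g" and nn: "\<And>x. g x \<ge> (0::real)"
  obtains r where "r \<ge> 0" "cint K (\<lambda>x. of_real (g x)) = of_real r" "r = 0 \<Longrightarrow> \<forall>x\<in>K. g x = 0"
proof -
  let ?r = "LINT x:K|lebesgue. g x"
  have "cint K (\<lambda>x. of_real (g x)) = of_real ?r"
  proof -
    have "indicator K x *\<^sub>R complex_of_real (g x) = of_real (indicator K x *\<^sub>R g x)" for x
      by (simp add: scaleR_conv_of_real)
    then show ?thesis unfolding cint_def set_lebesgue_integral_def by (simp only: integral_complex_of_real)
  qed
  moreover have "?r \<ge> 0"
    unfolding set_lebesgue_integral_def using nn by (intro Bochner_Integration.integral_nonneg) simp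
  moreover have "?r = 0 \<Longrightarrow> \<forall>x\<in>K. g x = 0"
    using cell_integral_zero[OF K g nn] by blast
  ultimately show ?thesis by (intro that[of ?r])
qed

lemma fint_nonneg:
  assumes K: "polycell K" and g: "fcont K g" and nn: "\<And>F x. g F x \<ge> (0::real)"
  obtains r where "r \<ge> 0" "fint K (\<lambda>F x. of_real (g F x)) = of_real r" "r = 0 \<Longrightarrow> \<forall>F\<in>faces K. \<forall>x\<in>F. g F x = 0"
proof -
  let ?s = "\<lambda>F. LINT x:F|face_measure F. g F x"
  let ?r = "\<Sum>F\<in>faces K. ?s F"
  have "fint K (\<lambda>F x. of_real (g F x)) = of_real ?r"
  proof -
    have "indicator F x *\<^sub>R complex_of_real (g F x) = of_real (indicator F x *\<^sub>R g F x)" for F x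
      by (simp add: scaleR_conv_of_real)
    then show ?thesis unfolding fint_def set_lebesgue_integral_def by (simp only: integral_complex_of_real of_real_sum)
  qed
  moreover have s: "?s F \<ge> 0" for F
    unfolding set_lebesgue_integral_def using nn by (intro Bochner_Integration.integral_nonneg) simp
  moreover have "?r \<ge> 0" using s by (rule sum_nonneg)
  moreover have "\<forall>F\<in>faces K. \<forall>x\<in>F. g F x = 0" if r: "?r = 0"
  proof (intro ballI)
    fix F x assume F: "F \<in> faces K" and x: "x \<in> F"
    have "?s F = 0" using r sum_nonneg_eq_0_iff[OF finite_faces[OF K], of ?s] s F by blast
    moreover have "continuous_on F (g F)" using g F by (simp add: fcont_def)
    ultimately show "g F x = 0" using face_integral_zero[OF K F] nn x by blast
  qed
  ultimately show ?thesis by (intro that[of ?r]) auto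
qed

section \<open>Hermitian products and polynomial fields\<close>

lemma hdot_self: "hdot u u = of_real (\<Sum>i\<in>UNIV. (cmod (u $ i))\<^sup>2)"
  by (simp only: hdot_def of_real_sum complex_norm_square)

lemma hdot_self_zero: "(\<Sum>i\<in>UNIV. (cmod ((u :: complex^'n) $ i))\<^sup>2) = 0 \<longleftrightarrow> u = 0"
  by (simp add: sum_nonneg_eq_0_iff vec_eq_iff)

lemma continuous_on_vec_iff: "continuous_on S (f :: _ \<Rightarrow> 'b::topological_space^'n) \<longleftrightarrow> (\<forall>i. continuous_on S (\<lambda>x. f x $ i))"
proof
  assume *: "\<forall>i. continuous_on S (\<lambda>x. f x $ i)"
  have "continuous_on S (\<lambda>x. \<chi> i. f x $ i)" using * by (intro continuous_on_vec_lambda) simp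
  then show "continuous_on S f" by simp
qed (auto intro: continuous_on_component)

lemma continuous_on_hdot [continuous_intros]:
  "continuous_on S u \<Longrightarrow> continuous_on S v \<Longrightarrow> continuous_on S (\<lambda>x. hdot (u x) (v x))"
  unfolding hdot_def by (intro continuous_intros)

lemma continuous_on_ccross [continuous_intros]:
  assumes "continuous_on S u" "continuous_on S v"
  shows "continuous_on S (\<lambda>x. ccross (u x) (v x))"
proof -
  have "continuous_on S (\<lambda>x. ccross (u x) (v x) $ 1)" "continuous_on S (\<lambda>x. ccross (u x) (v x) $ 2)"
    "continuous_on S (\<lambda>x. ccross (u x) (v x) $ 3)"
    unfolding ccross_def vector_3 by (intro continuous_intros assms)+
  then show ?thesis unfolding continuous_on_vec_iff[of S "\<lambda>x. ccross (u x) (v x)"] forall_3 by simp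
qed

lemma continuous_on_vector_smult [continuous_intros]:
  "continuous_on S u \<Longrightarrow> continuous_on S (\<lambda>x. (a :: complex) *s u x)"
  unfolding continuous_on_vec_iff by (simp add: continuous_on_mult_left)

lemma hdot_add_left: "hdot (u + w) v = hdot u v + hdot w v"
  and hdot_smult_left: "hdot (a *s u) v = a * hdot u v"
  and hdot_add_right: "hdot u (v + w) = hdot u v + hdot u w"
  and hdot_smult_right: "hdot u (a *s v) = cnj a * hdot u v"
  by (simp_all add: hdot_def distrib_left distrib_right sum.distrib sum_distrib_left mult.assoc mult.left_commute)

lemma hdot_zero [simp]: "hdot 0 v = 0" "hdot v 0 = 0"
  by (simp_all add: hdot_def)

lemma hdot_cnj: "cnj (hdot u v) = hdot v u"
  by (simp add: hdot_def mult.commute)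

lemma vpoly_spaceD: "v \<in> vpoly_space c p \<Longrightarrow> (\<lambda>x. v x $ i) \<in> poly_space c p"
  by (simp add: vpoly_space_def)

lemma vpoly_spaceI: "(\<And>i. (\<lambda>x. v x $ i) \<in> poly_space c p) \<Longrightarrow> v \<in> vpoly_space c p"
  by (simp add: vpoly_space_def)

lemma vpoly_0: "(\<lambda>x. 0) \<in> vpoly_space c p"
  by (rule vpoly_spaceI) (simp add: poly_space_0)

lemma vpoly_add: "u \<in> vpoly_space c p \<Longrightarrow> v \<in> vpoly_space c p \<Longrightarrow> (\<lambda>x. u x + v x) \<in> vpoly_space c p"
  by (rule vpoly_spaceI) (simp add: poly_space_add vpoly_spaceD)

lemma vpoly_smult: "u \<in> vpoly_space c p \<Longrightarrow> (\<lambda>x. a *s u x) \<in> vpoly_space c p"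
  by (rule vpoly_spaceI) (simp add: poly_space_scale vpoly_spaceD)

lemma continuous_vpoly: "v \<in> vpoly_space c p \<Longrightarrow> continuous_on S v"
  unfolding continuous_on_vec_iff using continuous_poly vpoly_spaceD by blast

lemma vpoly_eq_0_on_open:
  assumes v: "v \<in> vpoly_space c p" and U: "open U" "U \<noteq> {}" and z: "\<And>x. x \<in> U \<Longrightarrow> v x = 0"
  shows "v = (\<lambda>x. 0)"
proof
  fix x
  have "(\<lambda>x. v x $ i) = (\<lambda>x. 0)" for i
    by (rule poly_eq_0_on_open[OF vpoly_spaceD[OF v] U]) (simp add: z)
  then show "v x = 0" by (simp add: vec_eq_iff fun_eq_iff)
qed

lemma pderivative_combination:
  assumes "f \<in> poly_space c p" "g \<in> poly_space c p"
  shows "pderivative i (\<lambda>x. a * f x + g x) = (\<lambda>x. a * pderivative i f x + pderivative i g x)"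
proof
  fix x
  have "((\<lambda>x. a * f x + g x) has_derivative (\<lambda>h. a * frechet_derivative f (at x) h + frechet_derivative g (at x) h)) (at x)"
    by (intro has_derivative_add has_derivative_mult_right poly_has_derivative[OF assms(1)] poly_has_derivative[OF assms(2)])
  then show "pderivative i (\<lambda>x. a * f x + g x) x = a * pderivative i f x + pderivative i g x"
    unfolding pderivative_def by (simp add: frechet_derivative_at[symmetric])
qed

lemma pderivative_zero: "pderivative i (\<lambda>x. 0) = (\<lambda>x. 0)"
  by (rule ext) (simp add: pderivative_def)

text \<open>A zero norm on the cell makes the field zero on the whole space, because polynomials are
  determined by their values on an open set.\<close>

lemma vip_self:
  assumes K: "polycell K" and v: "v \<in> vpoly_space c p"
  obtains r where "r \<ge> 0" "vip K v v = of_real r" "r = 0 \<Longrightarrow> v = (\<lambda>x. 0)"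
proof -
  have cont: "continuous_on UNIV (\<lambda>x. \<Sum>i\<in>UNIV. (cmod (v x $ i))\<^sup>2)"
    by (intro continuous_intros continuous_vpoly[OF v])
  obtain r where r: "r \<ge> 0" "cint K (\<lambda>x. of_real (\<Sum>i\<in>UNIV. (cmod (v x $ i))\<^sup>2)) = of_real r"
    "r = 0 \<Longrightarrow> \<forall>x\<in>K. (\<Sum>i\<in>UNIV. (cmod (v x $ i))\<^sup>2) = 0"
    by (rule cint_nonneg[OF K cont]) (simp_all add: sum_nonneg)
  have "v = (\<lambda>x. 0)" if "r = 0"
    by (rule vpoly_eq_0_on_open[OF v, of K]) (use K r(3)[OF that] in \<open>simp_all add: hdot_self_zero polycell_def\<close>)
  then show ?thesis using that r(1,2) unfolding vip_cint hdot_self by blast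
qed

lemma ip_self:
  assumes K: "polycell K" and f: "f \<in> poly_space c p"
  obtains r where "r \<ge> 0" "ip K f f = of_real r" "r = 0 \<Longrightarrow> f = (\<lambda>x. 0)"
proof -
  have cont: "continuous_on UNIV (\<lambda>x. (cmod (f x))\<^sup>2)"
    by (intro continuous_intros continuous_poly[OF f])
  obtain r where r: "r \<ge> 0" "cint K (\<lambda>x. of_real ((cmod (f x))\<^sup>2)) = of_real r"
    "r = 0 \<Longrightarrow> \<forall>x\<in>K. (cmod (f x))\<^sup>2 = 0"
    by (rule cint_nonneg[OF K cont]) simp_all
  have "f = (\<lambda>x. 0)" if "r = 0"
    by (rule poly_eq_0_on_open[OF f, of K]) (use K r(3)[OF that] in \<open>simp_all add: polycell_def\<close>)
  then show ?thesis using that r(1,2) unfolding ip_cint complex_norm_square[symmetric] by blast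
qed

lemma vbip_self:
  assumes K: "polycell K" and u: "fcont K (u :: _ \<Rightarrow> _ \<Rightarrow> complex^'n)"
  obtains r where "r \<ge> 0" "vbip K u u = of_real r" "r = 0 \<Longrightarrow> \<forall>F\<in>faces K. \<forall>x\<in>F. u F x = 0"
proof -
  have cont: "fcont K (\<lambda>F x. \<Sum>i\<in>UNIV. (cmod (u F x $ i))\<^sup>2)"
    using u unfolding fcont_def by (intro ballI continuous_intros) auto
  obtain r where r: "r \<ge> 0" "fint K (\<lambda>F x. of_real (\<Sum>i\<in>UNIV. (cmod (u F x $ i))\<^sup>2)) = of_real r"
    "r = 0 \<Longrightarrow> \<forall>F\<in>faces K. \<forall>x\<in>F. (\<Sum>i\<in>UNIV. (cmod (u F x $ i))\<^sup>2) = 0"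
    by (rule fint_nonneg[OF K cont]) (simp_all add: sum_nonneg)
  show ?thesis using that[OF r(1)] r(2,3) unfolding vbip_fint hdot_self hdot_self_zero by blast
qed

lemma bip_self:
  assumes K: "polycell K" and u: "fcont K (u :: _ \<Rightarrow> _ \<Rightarrow> complex)"
  obtains r where "r \<ge> 0" "bip K u u = of_real r" "r = 0 \<Longrightarrow> \<forall>F\<in>faces K. \<forall>x\<in>F. u F x = 0"
proof -
  have cont: "fcont K (\<lambda>F x. (cmod (u F x))\<^sup>2)"
    using u unfolding fcont_def by (intro ballI continuous_intros) auto
  obtain r where r: "r \<ge> 0" "fint K (\<lambda>F x. of_real ((cmod (u F x))\<^sup>2)) = of_real r"
    "r = 0 \<Longrightarrow> \<forall>F\<in>faces K. \<forall>x\<in>F. (cmod (u F x))\<^sup>2 = 0"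
    by (rule fint_nonneg[OF K cont]) simp_all
  have "\<forall>F\<in>faces K. \<forall>x\<in>F. u F x = 0" if "r = 0" using r(3)[OF that] by simp
  then show ?thesis using that[OF r(1)] r(2) unfolding bip_fint complex_norm_square[symmetric] by blast
qed

lemma integral_by_parts:
  fixes f g :: "real^'n::{finite,wellorder} \<Rightarrow> complex"
  assumes K: "polycell K" and f: "f \<in> poly_space c p" and g: "g \<in> poly_space c p"
  shows "cint K (\<lambda>x. pderivative i f x * cnj (g x)) + cint K (\<lambda>x. f x * cnj (pderivative i g x))
    = fint K (\<lambda>F x. of_real (outward_normal K F $ i) * (f x * cnj (g x)))"
  using product_integral_by_parts[OF K f g, of i] unfolding ip_cint fint_def
  by (simp add: set_integral_mult_right)

text \<open>On the bounded cell \<open>g\<close> is bounded, and \<open>cmod (f x)\<close> is at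
  most \<open>1 + (cmod (f x))\<^sup>2\<close>, which is integrable there.\<close>

lemma square_integrable_mult:
  fixes f g :: "real^'n \<Rightarrow> complex"
  assumes K: "polycell K" and f: "square_integrable K f" and g: "continuous_on UNIV g"
  shows "set_integrable lebesgue K (\<lambda>x. f x * g x)"
proof -
  have meas: "set_borel_measurable lebesgue K f" and sq: "set_integrable lebesgue K (\<lambda>x. (norm (f x))\<^sup>2)"
    using f by (simp_all add: square_integrable_def)
  obtain B where B: "\<And>x. x \<in> K \<Longrightarrow> norm x \<le> B"
    using polycell_bounded[OF K] unfolding bounded_iff by blast
  obtain M where M: "M \<ge> 0" "\<And>x. norm x \<le> B \<Longrightarrow> norm (g x) \<le> M"
    using bounded_norm_on_cball[OF g] by blast
  have one: "set_integrable lebesgue K (\<lambda>x. 1 :: real)" by (rule cell_integrable(2)[OF K]) simp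
  have dom: "set_integrable lebesgue K (\<lambda>x. M * (1 + (norm (f x))\<^sup>2))"
    by (intro set_integrable_mult_right set_integral_add(1) one sq)
  have gm: "g \<in> borel_measurable lebesgue"
    using borel_measurable_continuous_onI[OF g] by (intro measurable_completion) simp
  have eq: "indicator K x *\<^sub>R (f x * g x) = (indicator K x *\<^sub>R f x) * g x" for x by simp
  have "(\<lambda>x. indicator K x *\<^sub>R (f x * g x)) \<in> borel_measurable lebesgue"
    unfolding eq using meas gm unfolding set_borel_measurable_def by (rule borel_measurable_times)
  moreover have "norm (indicator K x *\<^sub>R (f x * g x)) \<le> norm (indicator K x *\<^sub>R (M * (1 + (norm (f x))\<^sup>2)))" for x
  proof (cases "x \<in> K")
    case True
    have "cmod (f x) \<le> 1 + (cmod (f x))\<^sup>2"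
    proof -
      have "2 * cmod (f x) \<le> 1 + (cmod (f x))\<^sup>2"
        using zero_le_power2[of "cmod (f x) - 1"] by (simp add: power2_diff)
      then show ?thesis using norm_ge_zero[of "f x"] by linarith
    qed
    then have "cmod (f x) * cmod (g x) \<le> (1 + (cmod (f x))\<^sup>2) * M"
      using M(2)[OF B[OF True]] by (intro mult_mono) auto
    then show ?thesis using True M(1) by (simp add: norm_mult mult.commute)
  qed simp
  ultimately show ?thesis
    using Bochner_Integration.integrable_bound[OF dom[unfolded set_integrable_def]]
    unfolding set_integrable_def by (metis (no_types, lifting) AE_I2)
qed

lemma square_integrable_component:
  fixes J :: "real^'n \<Rightarrow> complex^'m"
  assumes K: "polycell K" and J: "square_integrable K J"
  shows "square_integrable K (\<lambda>x. J x $ i)"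
proof -
  have meas: "(\<lambda>x. indicator K x *\<^sub>R J x) \<in> borel_measurable lebesgue"
    and sq: "set_integrable lebesgue K (\<lambda>x. (norm (J x))\<^sup>2)"
    using J by (simp_all add: square_integrable_def set_borel_measurable_def)
  have nth: "(\<lambda>v :: complex^'m. v $ i) \<in> borel_measurable borel"
    by (intro borel_measurable_continuous_onI continuous_intros)
  have m: "(\<lambda>x. indicator K x *\<^sub>R (J x $ i)) \<in> borel_measurable lebesgue"
    using measurable_compose[OF meas nth] by simp
  have m2: "(\<lambda>x. indicator K x *\<^sub>R (norm (J x $ i))\<^sup>2) \<in> borel_measurable lebesgue"
  proof -
    have "(\<lambda>x. (norm (indicator K x *\<^sub>R (J x $ i)))\<^sup>2) \<in> borel_measurable lebesgue"
      by (rule measurable_compose[OF m]) (intro borel_measurable_continuous_onI continuous_intros)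
    moreover have "(norm (indicator K x *\<^sub>R (J x $ i)))\<^sup>2 = indicator K x *\<^sub>R (norm (J x $ i))\<^sup>2" for x
      by (simp add: indicator_def)
    ultimately show ?thesis by simp
  qed
  have "norm (indicator K x *\<^sub>R (norm (J x $ i))\<^sup>2) \<le> norm (indicator K x *\<^sub>R (norm (J x))\<^sup>2)" for x
    using Finite_Cartesian_Product.norm_nth_le[of "J x" i] by (auto simp: indicator_def intro: power_mono)
  then have "set_integrable lebesgue K (\<lambda>x. (norm (J x $ i))\<^sup>2)"
    using Bochner_Integration.integrable_bound[OF sq[unfolded set_integrable_def] m2]
    unfolding set_integrable_def by simp
  then show ?thesis using m by (simp add: square_integrable_def set_borel_measurable_def)
qed

lemma square_integrable_hdot:
  fixes J :: "real^'n \<Rightarrow> complex^'m"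
  assumes K: "polycell K" and J: "square_integrable K J" and v: "continuous_on UNIV v"
  shows "set_integrable lebesgue K (\<lambda>x. hdot (J x) (v x))"
  unfolding hdot_def set_integrable_def scaleR_sum_right
  by (intro Bochner_Integration.integrable_sum square_integrable_mult[OF K square_integrable_component[OF K J], unfolded set_integrable_def]
      continuous_intros v)

lemma vip_lin_left:
  assumes K: "polycell K" and c: "continuous_on UNIV u" "continuous_on UNIV w" "continuous_on UNIV v"
  shows "vip K (\<lambda>x. a *s u x + w x) v = a * vip K u v + vip K w v"
proof -
  have "continuous_on UNIV (\<lambda>x. a * hdot (u x) (v x))" "continuous_on UNIV (\<lambda>x. hdot (w x) (v x))"
    by (intro continuous_intros c)+
  from cint_add[OF K this] show ?thesis
    by (simp add: vip_cint hdot_add_left hdot_smult_left cint_scale)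
qed

text \<open>Assumes integrability instead of continuity, because the source term of the element
  problem is only square integrable.\<close>

lemma vip_lin_right_integrable:
  assumes "set_integrable lebesgue K (\<lambda>x. hdot (v x) (u x))" "set_integrable lebesgue K (\<lambda>x. hdot (v x) (w x))"
  shows "vip K v (\<lambda>x. a *s u x + w x) = cnj a * vip K v u + vip K v w"
  using cint_add_integrable[OF set_integrable_mult_right[of "cnj a", OF assms(1)] assms(2)]
  by (simp add: vip_cint hdot_add_right hdot_smult_right cint_scale)

lemma vip_lin_right:
  assumes K: "polycell K" and c: "continuous_on UNIV u" "continuous_on UNIV w" "continuous_on UNIV v"
  shows "vip K v (\<lambda>x. a *s u x + w x) = cnj a * vip K v u + vip K v w"
  by (intro vip_lin_right_integrable cell_integrable(2)[OF K] continuous_intros c)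

lemma fcont_hdot: "fcont K u \<Longrightarrow> fcont K v \<Longrightarrow> fcont K (\<lambda>F x. hdot (u F x) (v F x))"
  by (simp add: fcont_def continuous_on_hdot)

lemma fcont_scale: "fcont K u \<Longrightarrow> fcont K (\<lambda>F x. (a::complex) * u F x)"
  by (simp add: fcont_def continuous_on_mult_left)

lemma fcont_diff: "fcont K u \<Longrightarrow> fcont K v \<Longrightarrow> fcont K (\<lambda>F x. u F x - v F x :: 'b::real_normed_vector)"
  by (simp add: fcont_def continuous_on_diff)

lemma fcont_ccross: "fcont K u \<Longrightarrow> fcont K v \<Longrightarrow> fcont K (\<lambda>F x. ccross (u F x) (v F x))"
  by (simp add: fcont_def continuous_on_ccross)

lemma fcont_const: "fcont K (\<lambda>F x. n F)"
  by (simp add: fcont_def)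

lemma fcont_vpoly: "v \<in> vpoly_space c p \<Longrightarrow> fcont K (\<lambda>F. v)"
  by (simp add: fcont_def continuous_vpoly)

lemma vbip_lin_left:
  assumes K: "polycell K" and c: "fcont K u" "fcont K w" "fcont K v"
  shows "vbip K (\<lambda>F x. a *s u F x + w F x) v = a * vbip K u v + vbip K w v"
  using fint_add[OF K fcont_scale[OF fcont_hdot[OF c(1,3)], of a] fcont_hdot[OF c(2,3)]]
  by (simp add: vbip_fint hdot_add_left hdot_smult_left fint_scale)

lemma vbip_lin_right:
  assumes K: "polycell K" and c: "fcont K u" "fcont K w" "fcont K v"
  shows "vbip K v (\<lambda>F x. a *s u F x + w F x) = cnj a * vbip K v u + vbip K v w"
  using fint_add[OF K fcont_scale[OF fcont_hdot[OF c(3,1)], of "cnj a"] fcont_hdot[OF c(3,2)]]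
  by (simp add: vbip_fint hdot_add_right hdot_smult_right fint_scale)

lemma vbip_scale_left: "vbip K (\<lambda>F x. a *s u F x) v = a * vbip K u v"
  by (simp add: vbip_fint hdot_smult_left fint_scale)

lemma vip_zero: "vip K (\<lambda>x. 0) v = 0" "vip K v (\<lambda>x. 0) = 0"
  by (simp_all add: vip_cint cint_zero)

lemma vbip_zero: "vbip K (\<lambda>F x. 0) v = 0" "vbip K v (\<lambda>F x. 0) = 0"
  by (simp_all add: vbip_fint fint_zero)

lemma vip_cnj: "cnj (vip K u v) = vip K v u"
  by (simp add: vip_cint cint_cnj[symmetric] hdot_cnj)

section \<open>The Maxwell problem\<close>

lemma ccross_lin: "ccross (a *s u + w) n = a *s ccross u n + ccross w n"
  "ccross n (a *s u + w) = a *s ccross n u + ccross n w"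
  by (simp_all add: ccross_def vec_eq_iff forall_3 algebra_simps)

lemma ccross_diff: "ccross (u - w) n = ccross u n - ccross w n"
  by (simp add: ccross_def vec_eq_iff forall_3 algebra_simps)

lemma ccross_zero [simp]: "ccross 0 n = 0" "ccross n 0 = 0"
  by (simp_all add: ccross_def vec_eq_iff forall_3)

text \<open>This and the next two are triple product identities; \<open>cvec n\<close> is real, so
  conjugation leaves it alone. They translate between the boundary pairings of the element equations
  and of the flux.\<close>

lemma hdot_ccross_normal: "hdot u (ccross (cvec n) w) = hdot (ccross u (cvec n)) w"
  by (simp add: hdot_def ccross_def sum_3 cvec_def algebra_simps)

lemma hdot_ccross_swap: "hdot (ccross h (cvec n)) u = - cnj (hdot u (ccross (cvec n) h))"
  by (simp add: hdot_def ccross_def sum_3 cvec_def algebra_simps)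

lemma hdot_tangential: "hdot (tangential n u) v = hdot (ccross u (cvec n)) (ccross v (cvec n))"
  by (simp add: tangential_def hdot_def ccross_def sum_3 cvec_def algebra_simps)

text \<open>A vector whose cross product with \<open>n\<close> vanishes is a multiple of
  \<open>n\<close>. So a tangential trace is zero as soon as its cross product with the normal
  is.\<close>

lemma ccross_eq_0_normal:
  assumes "ccross u (cvec n) = 0" "hdot u (cvec n) = 0" "norm n = 1"
  shows "u = 0"
proof -
  have n2: "(n$1)*(n$1) + (n$2)*(n$2) + (n$3)*(n$3) = 1"
    using assms(3) by (simp add: norm_eq_1 inner_vec_def sum_3)
  let ?a = "complex_of_real (n$1)" and ?b = "complex_of_real (n$2)" and ?c = "complex_of_real (n$3)"
  have n: "?a * ?a + ?b * ?b + ?c * ?c = 1"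
    using arg_cong[OF n2, of complex_of_real] by simp
  have e: "u$2 * ?c = u$3 * ?b" "u$3 * ?a = u$1 * ?c" "u$1 * ?b = u$2 * ?a"
    "u$1 * ?a + u$2 * ?b + u$3 * ?c = 0"
    using assms(1,2) by (simp_all add: ccross_def vec_eq_iff forall_3 cvec_def hdot_def sum_3)
  have "u$1 = 0" "u$2 = 0" "u$3 = 0" using n e by algebra+
  then show ?thesis by (simp add: vec_eq_iff forall_3)
qed

lemma curl_nth:
  "curl v x $ 1 = pderivative 2 (\<lambda>y. v y $ 3) x - pderivative 3 (\<lambda>y. v y $ 2) x"
  "curl v x $ 2 = pderivative 3 (\<lambda>y. v y $ 1) x - pderivative 1 (\<lambda>y. v y $ 3) x"
  "curl v x $ 3 = pderivative 1 (\<lambda>y. v y $ 2) x - pderivative 2 (\<lambda>y. v y $ 1) x"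
  by (simp_all add: curl_def)

lemma vpoly_space_3:
  assumes "(\<lambda>x. v x $ 1) \<in> poly_space c p" "(\<lambda>x. v x $ 2) \<in> poly_space c p" "(\<lambda>x. v x $ 3) \<in> poly_space c p"
  shows "(v :: real^3 \<Rightarrow> complex^3) \<in> vpoly_space c p"
proof (rule vpoly_spaceI)
  fix i :: 3
  show "(\<lambda>x. v x $ i) \<in> poly_space c p" using exhaust_3[of i] assms by (elim disjE) simp_all
qed

lemma curl_vpoly: "v \<in> vpoly_space c p \<Longrightarrow> curl v \<in> vpoly_space c p"
  by (rule vpoly_space_3; unfold curl_nth; intro poly_space_diff pderivative_poly vpoly_spaceD)

lemma curl_Simplicial_Suc: "v \<in> vpoly_space Simplicial (Suc d) \<Longrightarrow> curl v \<in> vpoly_space Simplicial d"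
  by (rule vpoly_space_3; unfold curl_nth; intro poly_space_diff pderivative_Simplicial_Suc vpoly_spaceD)

lemma curl_Simplicial_0: "v \<in> vpoly_space Simplicial 0 \<Longrightarrow> curl v = (\<lambda>x. 0)"
  by (rule ext) (simp add: vec_eq_iff forall_3 curl_nth pderivative_Simplicial_0[OF vpoly_spaceD])

lemma curl_combination:
  assumes "u \<in> vpoly_space c p" "v \<in> vpoly_space c p"
  shows "curl (\<lambda>x. a *s u x + v x) = (\<lambda>x. a *s curl u x + curl v x)"
proof -
  note pd = pderivative_combination[OF vpoly_spaceD[OF assms(1)] vpoly_spaceD[OF assms(2)]]
  show ?thesis
    unfolding fun_eq_iff vec_eq_iff forall_3 vector_add_component vector_smult_component curl_nth pd
    by (simp add: right_diff_distrib)
qed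

lemma curl_zero: "curl (\<lambda>x. 0) = (\<lambda>x. 0)"
  by (rule ext) (simp add: vec_eq_iff forall_3 curl_nth pderivative_zero)

text \<open>Six instances of \<open>integral_by_parts\<close>, one for each term of the
  curl.\<close>

lemma curl_by_parts:
  assumes K: "polycell (K :: (real^3) set)" and u: "u \<in> vpoly_space c p" and w: "w \<in> vpoly_space c p"
  shows "vip K u (curl w) = vip K (curl u) w + vbip K (\<lambda>F. u) (\<lambda>F x. ccross (cvec (outward_normal K F)) (w x))"
proof -
  let ?u = "\<lambda>i x. u x $ i" and ?w = "\<lambda>i x. w x $ i"
  note up = vpoly_spaceD[OF u] and wp = vpoly_spaceD[OF w]
  note cu = continuous_poly[OF up] and cw = continuous_poly[OF wp]
  note cdu = continuous_poly[OF pderivative_poly[OF up]] and cdw = continuous_poly[OF pderivative_poly[OF wp]]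
  let ?D = "\<lambda>i a b. cint K (\<lambda>x. pderivative i (?u a) x * cnj (w x $ b))"
  let ?G = "\<lambda>i a b. cint K (\<lambda>x. u x $ a * cnj (pderivative i (?w b) x))"
  let ?S = "\<lambda>i a b. fint K (\<lambda>F x. of_real (outward_normal K F $ i) * (u x $ a * cnj (w x $ b)))"
  have parts: "?D i a b + ?G i a b = ?S i a b" for i a b
    by (rule integral_by_parts[OF K up wp])
  have c1: "continuous_on UNIV (\<lambda>x. pderivative i (?u a) x * cnj (w x $ b))"
    and c2: "continuous_on UNIV (\<lambda>x. u x $ a * cnj (pderivative i (?w b) x))" for i a b
    by (intro continuous_intros cdu cw cu cdw)+
  have c3: "fcont K (\<lambda>F x. of_real (outward_normal K F $ i) * (u x $ a * cnj (w x $ b)))" for i a b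
    unfolding fcont_def by (intro ballI continuous_intros cu cw)
  have A: "vip K (curl u) w = ((?D 2 3 1 - ?D 3 2 1) + (?D 3 1 2 - ?D 1 3 2)) + (?D 1 2 3 - ?D 2 1 3)"
    unfolding vip_cint hdot_def sum_3 curl_nth left_diff_distrib
    by (simp only: cint_add[OF K] cint_diff[OF K] c1 continuous_on_add continuous_on_diff)
  have B: "vip K u (curl w) = ((?G 2 1 3 - ?G 3 1 2) + (?G 3 2 1 - ?G 1 2 3)) + (?G 1 3 2 - ?G 2 3 1)"
    unfolding vip_cint hdot_def sum_3 curl_nth right_diff_distrib complex_cnj_diff
    by (simp only: cint_add[OF K] cint_diff[OF K] c2 continuous_on_add continuous_on_diff)
  have C: "vbip K (\<lambda>F. u) (\<lambda>F x. ccross (cvec (outward_normal K F)) (w x))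
      = ((?S 2 1 3 - ?S 3 1 2) + (?S 3 2 1 - ?S 1 2 3)) + (?S 1 3 2 - ?S 2 3 1)"
  proof -
    let ?s = "\<lambda>i a b F x. of_real (outward_normal K F $ i) * (u x $ a * cnj (w x $ b))"
    have fa: "fcont K f \<Longrightarrow> fcont K g \<Longrightarrow> fcont K (\<lambda>F x. f F x + g F x)" for f g :: "_ \<Rightarrow> _ \<Rightarrow> complex"
      by (simp add: fcont_def continuous_on_add)
    have "vbip K (\<lambda>F. u) (\<lambda>F x. ccross (cvec (outward_normal K F)) (w x))
        = fint K (\<lambda>F x. ((?s 2 1 3 F x - ?s 3 1 2 F x) + (?s 3 2 1 F x - ?s 1 2 3 F x)) + (?s 1 3 2 F x - ?s 2 3 1 F x))"
      unfolding vbip_fint by (rule fint_cong) (simp add: hdot_def sum_3 ccross_def cvec_def algebra_simps)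
    then show ?thesis by (simp only: fint_add[OF K] fint_diff[OF K] c3 fa fcont_diff)
  qed
  \<comment> \<open>The letters \<open>d\<close> and \<open>g\<close> stand for the values of
    \<open>?D\<close> and \<open>?G\<close>, numbered in the order of the boundary terms in
    \<open>C\<close>; each boundary term is a sum of one \<open>d\<close> and one
    \<open>g\<close>.\<close>
  have "((g1 - g2) + (g3 - g4)) + (g5 - g6) = (((d6 - d3) + (d2 - d5)) + (d4 - d1))
      + ((((d1 + g1) - (d2 + g2)) + ((d3 + g3) - (d4 + g4))) + ((d5 + g5) - (d6 + g6)))"
    for d1 d2 d3 d4 d5 d6 g1 g2 g3 g4 g5 g6 :: complex by simp
  then show ?thesis unfolding A B C parts[symmetric] .
qed

section \<open>The Maxwell element problem\<close>

definition maxwell_lhs :: "complex \<Rightarrow> complex \<Rightarrow> (real^3) set \<Rightarrow> (real^3 \<Rightarrow> complex^3) \<Rightarrow> (real^3 \<Rightarrow> complex^3)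
    \<Rightarrow> (real^3 \<Rightarrow> complex^3) \<Rightarrow> (real^3 \<Rightarrow> complex^3) \<Rightarrow> complex" where
  "maxwell_lhs k \<tau> K E H v w = (\<i> * k * vip K E v - vip K (curl H) v
      + \<tau> * vbip K (\<lambda>F x. ccross (E x) (cvec (outward_normal K F))) (\<lambda>F x. ccross (v x) (cvec (outward_normal K F))))
    + (- vip K E (curl w) - \<i> * k * vip K H w)"

definition maxwell_rhs :: "complex \<Rightarrow> (real^3) set \<Rightarrow> ((real^3) set \<Rightarrow> real^3 \<Rightarrow> complex^3) \<Rightarrow> (real^3 \<Rightarrow> complex^3)
    \<Rightarrow> (real^3 \<Rightarrow> complex^3) \<Rightarrow> (real^3 \<Rightarrow> complex^3) \<Rightarrow> complex" where
  "maxwell_rhs \<tau> K Eh J v w = (\<tau> * vbip K (\<lambda>F x. ccross (Eh F x) (cvec (outward_normal K F))) (\<lambda>F x. ccross (v x) (cvec (outward_normal K F)))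
      - vip K J v) + - vbip K Eh (\<lambda>F x. ccross (cvec (outward_normal K F)) (w x))"

text \<open>Adding the two equations gives one sesquilinear form on pairs, as
  \<open>poly_tuple_problem_solvable\<close> expects; test pairs with a zero entry separate them
  again.\<close>

lemma maxwell_solutions_iff:
  "(E, H) \<in> maxwell_solutions k p c \<tau> K Eh J \<longleftrightarrow> E \<in> vpoly_space c p \<and> H \<in> vpoly_space c p \<and>
    (\<forall>v\<in>vpoly_space c p. \<forall>w\<in>vpoly_space c p. maxwell_lhs k \<tau> K E H v w = maxwell_rhs \<tau> K Eh J v w)"
    (is "?S \<longleftrightarrow> ?E \<and> ?H \<and> ?eq")
proof -
  let ?l1 = "\<lambda>v. \<i> * k * vip K E v - vip K (curl H) v
      + \<tau> * vbip K (\<lambda>F x. ccross (E x) (cvec (outward_normal K F))) (\<lambda>F x. ccross (v x) (cvec (outward_normal K F)))"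
  let ?l2 = "\<lambda>w. - vip K E (curl w) - \<i> * k * vip K H w"
  let ?r1 = "\<lambda>v. \<tau> * vbip K (\<lambda>F x. ccross (Eh F x) (cvec (outward_normal K F))) (\<lambda>F x. ccross (v x) (cvec (outward_normal K F))) - vip K J v"
  let ?r2 = "\<lambda>w. - vbip K Eh (\<lambda>F x. ccross (cvec (outward_normal K F)) (w x))"
  have S: "?S \<longleftrightarrow> ?E \<and> ?H \<and> (\<forall>v\<in>vpoly_space c p. ?l1 v = ?r1 v) \<and> (\<forall>w\<in>vpoly_space c p. ?l2 w = ?r2 w)"
    unfolding maxwell_solutions_def by (simp add: Let_def vbip_scale_left)
  have eq: "?eq \<longleftrightarrow> (\<forall>v\<in>vpoly_space c p. \<forall>w\<in>vpoly_space c p. ?l1 v + ?l2 w = ?r1 v + ?r2 w)"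
    unfolding maxwell_lhs_def maxwell_rhs_def ..
  have z: "?l1 (\<lambda>x. 0) = 0" "?r1 (\<lambda>x. 0) = 0" "?l2 (\<lambda>x. 0) = 0" "?r2 (\<lambda>x. 0) = 0"
    by (simp_all add: vip_zero vbip_zero curl_zero)
  have "(\<forall>v\<in>vpoly_space c p. \<forall>w\<in>vpoly_space c p. ?l1 v + ?l2 w = ?r1 v + ?r2 w)
      \<longleftrightarrow> (\<forall>v\<in>vpoly_space c p. ?l1 v = ?r1 v) \<and> (\<forall>w\<in>vpoly_space c p. ?l2 w = ?r2 w)" (is "?A \<longleftrightarrow> ?B")
  proof
    assume A: ?A
    have "?l1 v = ?r1 v" if "v \<in> vpoly_space c p" for v
      using A[rule_format, OF that vpoly_0] unfolding z by simp
    moreover have "?l2 w = ?r2 w" if "w \<in> vpoly_space c p" for w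
      using A[rule_format, OF vpoly_0 that] unfolding z by simp
    ultimately show ?B by blast
  next
    assume B: ?B
    show ?A using B[THEN conjunct1, rule_format] B[THEN conjunct2, rule_format] by (intro ballI) (rule arg_cong2[where f = "(+)"])
  qed
  then show ?thesis unfolding S eq by simp
qed

lemma maxwell_solutionsD:
  assumes "(E, H) \<in> maxwell_solutions k p c \<tau> K Eh J"
  shows "E \<in> vpoly_space c p" "H \<in> vpoly_space c p"
    "\<And>v. v \<in> vpoly_space c p \<Longrightarrow> \<i> * k * vip K E v - vip K (curl H) v
        + \<tau> * vbip K (\<lambda>F x. ccross (E x) (cvec (outward_normal K F))) (\<lambda>F x. ccross (v x) (cvec (outward_normal K F)))
      = \<tau> * vbip K (\<lambda>F x. ccross (Eh F x) (cvec (outward_normal K F))) (\<lambda>F x. ccross (v x) (cvec (outward_normal K F))) - vip K J v"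
    "\<And>w. w \<in> vpoly_space c p \<Longrightarrow> - vip K E (curl w) - \<i> * k * vip K H w
      = - vbip K Eh (\<lambda>F x. ccross (cvec (outward_normal K F)) (w x))"
  using assms unfolding maxwell_solutions_def by (simp_all add: Let_def vbip_scale_left)

text \<open>The first equation is tested with \<open>E\<close>, the second with \<open>H\<close> and
  then conjugated; the two curl terms become equal and cancel without integration by parts. What
  remains on the boundary is regrouped into the flux and the squared mismatch.\<close>

lemma maxwell_energy:
  assumes K: "polycell K" and sol: "(E, H) \<in> maxwell_solutions k p c \<tau> K \<Lambda> (\<lambda>x. 0)" and \<Lambda>: "fcont K \<Lambda>"
  obtains \<alpha> \<beta> \<gamma> :: real where "\<alpha> \<ge> 0" "\<beta> \<ge> 0" "\<gamma> \<ge> 0"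
    "\<i> * k * \<alpha> - \<i> * cnj k * \<beta> + \<tau> * \<gamma> + vbip K (\<lambda>F x. ccross (H x) (cvec (outward_normal K F))
        + \<tau> *s tangential (outward_normal K F) (E x - \<Lambda> F x)) \<Lambda> = 0"
    "\<alpha> = 0 \<Longrightarrow> E = (\<lambda>x. 0)" "\<beta> = 0 \<Longrightarrow> H = (\<lambda>x. 0)"
    "\<gamma> = 0 \<Longrightarrow> \<forall>F\<in>faces K. \<forall>x\<in>F. ccross (E x - \<Lambda> F x) (cvec (outward_normal K F)) = 0"
proof -
  let ?n = "\<lambda>F. cvec (outward_normal K F)"
  note S = maxwell_solutionsD[OF sol]
  obtain \<alpha> where \<alpha>: "\<alpha> \<ge> 0" "vip K E E = of_real \<alpha>" "\<alpha> = 0 \<Longrightarrow> E = (\<lambda>x. 0)"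
    using vip_self[OF K S(1)] by blast
  obtain \<beta> where \<beta>: "\<beta> \<ge> 0" "vip K H H = of_real \<beta>" "\<beta> = 0 \<Longrightarrow> H = (\<lambda>x. 0)"
    using vip_self[OF K S(2)] by blast
  let ?A = "\<lambda>F x. ccross (E x) (?n F)" and ?B = "\<lambda>F x. ccross (\<Lambda> F x) (?n F)"
  let ?D = "\<lambda>F x. ccross (E x - \<Lambda> F x) (?n F)"
  note cE = fcont_vpoly[OF S(1), of K] and cH = fcont_vpoly[OF S(2), of K]
  have cA: "fcont K ?A" and cB: "fcont K ?B" and cD: "fcont K ?D"
    by (intro fcont_ccross fcont_const fcont_diff cE \<Lambda>)+
  obtain \<gamma> where \<gamma>: "\<gamma> \<ge> 0" "vbip K ?D ?D = of_real \<gamma>" "\<gamma> = 0 \<Longrightarrow> \<forall>F\<in>faces K. \<forall>x\<in>F. ?D F x = 0"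
    using vbip_self[OF K cD] by blast
  have D: "?D = (\<lambda>F x. (-1) *s ?B F x + ?A F x)"
    by (intro ext) (simp add: ccross_diff vec_eq_iff)
  have Dl: "vbip K ?D v = vbip K ?A v - vbip K ?B v" if "fcont K v" for v
    unfolding D vbip_lin_left[OF K cB cA that] by simp
  have Dr: "vbip K ?D ?D = vbip K ?D ?A - vbip K ?D ?B"
    using vbip_lin_right[OF K cB cA cD, of "- 1"] unfolding D[symmetric] by simp
  have e1: "\<i> * k * \<alpha> - vip K (curl H) E + \<tau> * vbip K ?D ?A = 0"
    using S(3)[OF S(1)] by (simp add: \<alpha>(2) vip_zero Dl[OF cA] algebra_simps)
  have e2: "cnj (- vip K E (curl H) - \<i> * k * vip K H H) = cnj (- vbip K \<Lambda> (\<lambda>F x. ccross (?n F) (H x)))"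
    using S(4)[OF S(2)] by (rule arg_cong)
  have e3: "vip K (curl H) E - \<i> * cnj k * \<beta> = cnj (vbip K \<Lambda> (\<lambda>F x. ccross (?n F) (H x)))"
  proof -
    have "\<i> * cnj k * \<beta> - vip K (curl H) E = - cnj (vbip K \<Lambda> (\<lambda>F x. ccross (?n F) (H x)))"
      using e2 by (simp add: \<beta>(2) vip_cnj)
    from arg_cong[OF this, of uminus] show ?thesis by simp
  qed
  have flux: "vbip K (\<lambda>F x. ccross (H x) (?n F) + \<tau> *s tangential (outward_normal K F) (E x - \<Lambda> F x)) \<Lambda>
      = - cnj (vbip K \<Lambda> (\<lambda>F x. ccross (?n F) (H x))) + \<tau> * vbip K ?D ?B"
  proof -
    have "fcont K (\<lambda>F x. - cnj (hdot (\<Lambda> F x) (ccross (?n F) (H x))))"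
      using fcont_hdot[OF \<Lambda> fcont_ccross[OF fcont_const[of K ?n] cH]]
      unfolding fcont_def by (intro ballI continuous_on_minus continuous_on_cnj) auto
    from fint_add[OF K this fcont_scale[OF fcont_hdot[OF cD cB], of \<tau>]]
    show ?thesis
      unfolding vbip_fint hdot_add_left hdot_smult_left hdot_ccross_swap hdot_tangential fint_cnj[symmetric]
      by (simp add: fint_minus fint_scale)
  qed
  have "\<i> * k * \<alpha> - \<i> * cnj k * \<beta> + \<tau> * \<gamma> + vbip K (\<lambda>F x. ccross (H x) (?n F)
      + \<tau> *s tangential (outward_normal K F) (E x - \<Lambda> F x)) \<Lambda> = 0"
  proof -
    have "x - y + \<tau> * g + \<Phi> = 0" if "x - X + \<tau> * P = 0" "X - y = R" "\<Phi> = - R + \<tau> * Q" "g = P - Q"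
      for x y g \<Phi> X P R Q using that by algebra
    from this[OF e1 e3 flux Dr[unfolded \<gamma>(2)]] show ?thesis .
  qed
  then show ?thesis using that \<alpha> \<beta> \<gamma> by blast
qed

text \<open>For \<open>Im k \<noteq> 0\<close> the identity is multiplied by \<open>Im k\<close>: a
  positive multiple of \<open>\<alpha> + \<beta>\<close> then equals a number that is not
  positive.\<close>

lemma stab_energy:
  assumes "stab_condition k \<tau>" and nn: "\<alpha> \<ge> 0" "\<beta> \<ge> 0" "\<gamma> \<ge> (0::real)"
    and re: "- Im k * (\<alpha> + \<beta>) + Re \<tau> * \<gamma> = 0"
  shows "Im k = 0 \<Longrightarrow> \<gamma> = 0" "Im k \<noteq> 0 \<Longrightarrow> \<alpha> = 0 \<and> \<beta> = 0"
proof -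
  show "\<gamma> = 0" if "Im k = 0" using assms that by (simp add: stab_condition_def)
  assume k: "Im k \<noteq> 0"
  then have "Im k * Re \<tau> \<le> 0" using assms by (simp add: stab_condition_def)
  then have "Im k * Re \<tau> * \<gamma> \<le> 0" using nn by (simp add: mult_nonpos_nonneg)
  moreover have "Im k * Re \<tau> * \<gamma> = (Im k)\<^sup>2 * (\<alpha> + \<beta>)"
    using re by (simp add: power2_eq_square mult.assoc)
  ultimately have "(Im k)\<^sup>2 * (\<alpha> + \<beta>) \<le> 0" by simp
  moreover have "(Im k)\<^sup>2 > 0" using k by simp
  ultimately have "\<alpha> + \<beta> \<le> 0" by (simp add: mult_le_0_iff)
  then show "\<alpha> = 0 \<and> \<beta> = 0" using nn by simp
qed

text \<open>The difference of \<open>w\<close> and \<open>a *s u\<close> lies in the test space, so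
  it is orthogonal to itself.\<close>

lemma vpoly_orthogonal_zero:
  assumes K: "polycell K" and u: "u \<in> vpoly_space c p" "w \<in> vpoly_space c p"
    and eq: "\<And>v. v \<in> vpoly_space c p \<Longrightarrow> a * vip K u v = vip K w v"
  shows "w = (\<lambda>x. a *s u x)"
proof -
  let ?d = "\<lambda>x. (- a) *s u x + w x"
  have d: "?d \<in> vpoly_space c p" by (intro vpoly_add vpoly_smult u)
  obtain r where r: "vip K ?d ?d = of_real r" "r = 0 \<Longrightarrow> ?d = (\<lambda>x. 0)"
    using vip_self[OF K d] by blast
  have "vip K ?d ?d = (- a) * vip K u ?d + vip K w ?d"
    by (rule vip_lin_left[OF K continuous_vpoly[OF u(1)] continuous_vpoly[OF u(2)] continuous_vpoly[OF d]])
  then have "vip K ?d ?d = 0" using eq[OF d] by simp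
  then have "?d = (\<lambda>x. 0)" using r by simp
  then show ?thesis by (simp add: fun_eq_iff vec_eq_iff add_eq_0_iff)
qed

lemma curl_eigen_zero:
  assumes a: "a \<noteq> 0" "b \<noteq> 0" and E: "curl H = (\<lambda>x. a *s E x)" "curl E = (\<lambda>x. b *s H x)"
    and d: "E \<in> vpoly_space Simplicial d" "H \<in> vpoly_space Simplicial d"
  shows "E = (\<lambda>x. 0) \<and> H = (\<lambda>x. 0)"
proof -
  have eq: "E = (\<lambda>x. inverse a *s curl H x)" "H = (\<lambda>x. inverse b *s curl E x)"
    unfolding E using a by (simp_all add: fun_eq_iff vec_eq_iff)
  show ?thesis using d
  proof (induction d)
    case 0
    have "curl H x = 0" "curl E x = 0" for x
      using fun_cong[OF curl_Simplicial_0[OF 0(2)], of x] fun_cong[OF curl_Simplicial_0[OF 0(1)], of x] by simp_all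
    then have "E x = 0 \<and> H x = 0" for x
      using fun_cong[OF eq(1), of x] fun_cong[OF eq(2), of x] by (simp add: vec_eq_iff)
    then show ?case by (simp add: fun_eq_iff)
  next
    case (Suc d)
    have "E \<in> vpoly_space Simplicial d" by (subst eq(1)) (intro vpoly_smult curl_Simplicial_Suc Suc.prems)
    moreover have "H \<in> vpoly_space Simplicial d" by (subst eq(2)) (intro vpoly_smult curl_Simplicial_Suc Suc.prems)
    ultimately show ?case by (rule Suc.IH)
  qed
qed

text \<open>Stated for any \<Lambda>, because zero data serve the element problem and general data
  the condensed one. Equal tangential traces cancel the stabilization terms and turn the datum of
  the second equation into the boundary term of \<open>curl_by_parts\<close>.\<close>

lemma maxwell_matching_trace_zero:
  assumes K: "polycell (K :: (real^3) set)" and k: "k \<noteq> 0" and sol: "(E, H) \<in> maxwell_solutions k p c \<tau> K \<Lambda> (\<lambda>x. 0)"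
    and trace: "\<And>F x. F \<in> faces K \<Longrightarrow> x \<in> F \<Longrightarrow> ccross (E x - \<Lambda> F x) (cvec (outward_normal K F)) = 0"
  shows "E = (\<lambda>x. 0) \<and> H = (\<lambda>x. 0)"
proof -
  let ?n = "\<lambda>F. cvec (outward_normal K F)"
  note S = maxwell_solutionsD[OF sol]
  have eq: "ccross (\<Lambda> F x) (?n F) = ccross (E x) (?n F)" if "F \<in> faces K" "x \<in> F" for F x
    using trace[OF that] by (simp add: ccross_diff)
  have "\<i> * k * vip K E v = vip K (curl H) v" if v: "v \<in> vpoly_space c p" for v
  proof -
    have "vbip K (\<lambda>F x. ccross (\<Lambda> F x) (?n F)) (\<lambda>F x. ccross (v x) (?n F))
        = vbip K (\<lambda>F x. ccross (E x) (?n F)) (\<lambda>F x. ccross (v x) (?n F))"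
      unfolding vbip_fint by (rule fint_cong) (simp only: eq)
    then show ?thesis using S(3)[OF v] by (simp add: vip_zero)
  qed
  then have c1: "curl H = (\<lambda>x. (\<i> * k) *s E x)"
    by (rule vpoly_orthogonal_zero[OF K S(1) curl_vpoly[OF S(2)]])
  have "(- \<i> * k) * vip K H w = vip K (curl E) w" if w: "w \<in> vpoly_space c p" for w
  proof -
    have "vbip K \<Lambda> (\<lambda>F x. ccross (?n F) (w x)) = vbip K (\<lambda>F. E) (\<lambda>F x. ccross (?n F) (w x))"
      unfolding vbip_fint hdot_ccross_normal by (rule fint_cong) (simp only: eq)
    then have "- vip K (curl E) w = \<i> * k * vip K H w"
      using S(4)[OF w] curl_by_parts[OF K S(1) w] by simp
    from arg_cong[OF this, of uminus] show ?thesis by simp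
  qed
  then have c2: "curl E = (\<lambda>x. (- \<i> * k) *s H x)"
    by (rule vpoly_orthogonal_zero[OF K S(2) curl_vpoly[OF S(1)]])
  have "u \<in> vpoly_space Simplicial (CARD(3) * p)" if "u \<in> vpoly_space c p" for u :: "real^3 \<Rightarrow> complex^3"
    by (rule vpoly_spaceI, rule poly_space_subset_Simplicial, rule vpoly_spaceD[OF that])
  note d = this[OF S(1)] this[OF S(2)]
  show ?thesis by (rule curl_eigen_zero[OF _ _ c1 c2 d]) (use k in simp_all)
qed

lemma maxwell_homogeneous_zero:
  assumes K: "polycell (K :: (real^3) set)" and k: "k \<noteq> 0" and stab: "stab_condition k \<tau>"
    and sol: "(E, H) \<in> maxwell_solutions k p c \<tau> K (\<lambda>F x. 0) (\<lambda>x. 0)"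
  shows "E = (\<lambda>x. 0) \<and> H = (\<lambda>x. 0)"
proof -
  have z: "fcont K (\<lambda>F x. 0 :: complex^3)" by (simp add: fcont_def)
  obtain \<alpha> \<beta> \<gamma> :: real where nn: "\<alpha> \<ge> 0" "\<beta> \<ge> 0" "\<gamma> \<ge> 0"
    and id: "\<i> * k * \<alpha> - \<i> * cnj k * \<beta> + \<tau> * \<gamma> + vbip K (\<lambda>F x. ccross (H x) (cvec (outward_normal K F))
        + \<tau> *s tangential (outward_normal K F) (E x - 0)) (\<lambda>F x. 0) = 0"
    and zero: "\<alpha> = 0 \<Longrightarrow> E = (\<lambda>x. 0)" "\<beta> = 0 \<Longrightarrow> H = (\<lambda>x. 0)"
      "\<gamma> = 0 \<Longrightarrow> \<forall>F\<in>faces K. \<forall>x\<in>F. ccross (E x - 0) (cvec (outward_normal K F)) = 0"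
    using maxwell_energy[OF K sol z] by blast
  have "- Im k * (\<alpha> + \<beta>) + Re \<tau> * \<gamma> = 0"
    using arg_cong[OF id, of Re] by (simp add: vbip_zero algebra_simps)
  note en = stab_energy[OF stab nn this]
  show ?thesis
  proof (cases "Im k = 0")
    case True
    show ?thesis by (rule maxwell_matching_trace_zero[OF K k sol]) (use zero(3) en(1)[OF True] in blast)
  next
    case False
    show ?thesis using en(2)[OF False] zero(1,2) by blast
  qed
qed

lemma maxwell_lhs_lin_left:
  assumes K: "polycell K" and V: "E \<in> vpoly_space c p" "H \<in> vpoly_space c p" "E' \<in> vpoly_space c p" "H' \<in> vpoly_space c p"
    "v \<in> vpoly_space c p" "w \<in> vpoly_space c p"
  shows "maxwell_lhs k \<tau> K (\<lambda>x. a *s E x + E' x) (\<lambda>x. a *s H x + H' x) v w = a * maxwell_lhs k \<tau> K E H v w + maxwell_lhs k \<tau> K E' H' v w"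
proof -
  note c = continuous_vpoly[OF V(1)] continuous_vpoly[OF V(2)] continuous_vpoly[OF V(3)] continuous_vpoly[OF V(4)] continuous_vpoly[OF V(5)]
    continuous_vpoly[OF V(6)] continuous_vpoly[OF curl_vpoly[OF V(2)]] continuous_vpoly[OF curl_vpoly[OF V(4)]] continuous_vpoly[OF curl_vpoly[OF V(6)]]
  have f: "u \<in> vpoly_space c p \<Longrightarrow> fcont K (\<lambda>F x. ccross (u x) (cvec (outward_normal K F)))" for u
    by (intro fcont_ccross fcont_const fcont_vpoly)
  show ?thesis
    unfolding maxwell_lhs_def curl_combination[OF V(2,4)] ccross_lin
    by (simp only: vip_lin_left[OF K] vbip_lin_left[OF K] c f V) (simp add: algebra_simps)
qed

lemma maxwell_lhs_lin_right:
  assumes K: "polycell K" and V: "E \<in> vpoly_space c p" "H \<in> vpoly_space c p" "v \<in> vpoly_space c p" "w \<in> vpoly_space c p"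
    "v' \<in> vpoly_space c p" "w' \<in> vpoly_space c p"
  shows "maxwell_lhs k \<tau> K E H (\<lambda>x. a *s v x + v' x) (\<lambda>x. a *s w x + w' x) = cnj a * maxwell_lhs k \<tau> K E H v w + maxwell_lhs k \<tau> K E H v' w'"
proof -
  note c = continuous_vpoly[OF V(1)] continuous_vpoly[OF V(2)] continuous_vpoly[OF V(3)] continuous_vpoly[OF V(4)] continuous_vpoly[OF V(5)]
    continuous_vpoly[OF V(6)] continuous_vpoly[OF curl_vpoly[OF V(2)]] continuous_vpoly[OF curl_vpoly[OF V(4)]] continuous_vpoly[OF curl_vpoly[OF V(6)]]
  have f: "u \<in> vpoly_space c p \<Longrightarrow> fcont K (\<lambda>F x. ccross (u x) (cvec (outward_normal K F)))" for u
    by (intro fcont_ccross fcont_const fcont_vpoly)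
  show ?thesis
    unfolding maxwell_lhs_def curl_combination[OF V(4,6)] ccross_lin
    by (simp only: vip_lin_right[OF K] vbip_lin_right[OF K] c f V) (simp add: algebra_simps)
qed

lemma maxwell_rhs_lin:
  assumes K: "polycell K" and J: "square_integrable K J" and Eh: "fcont K Eh"
    and V: "v \<in> vpoly_space c p" "w \<in> vpoly_space c p" "v' \<in> vpoly_space c p" "w' \<in> vpoly_space c p"
  shows "maxwell_rhs \<tau> K Eh J (\<lambda>x. a *s v x + v' x) (\<lambda>x. a *s w x + w' x) = cnj a * maxwell_rhs \<tau> K Eh J v w + maxwell_rhs \<tau> K Eh J v' w'"
proof -
  have f: "u \<in> vpoly_space c p \<Longrightarrow> fcont K (\<lambda>F x. ccross (u x) (cvec (outward_normal K F)))"
    "u \<in> vpoly_space c p \<Longrightarrow> fcont K (\<lambda>F x. ccross (cvec (outward_normal K F)) (u x))" for u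
    by (intro fcont_ccross fcont_const fcont_vpoly; assumption)+
  have g: "fcont K (\<lambda>F x. ccross (Eh F x) (cvec (outward_normal K F)))"
    by (intro fcont_ccross fcont_const Eh)
  have J': "vip K J (\<lambda>x. a *s v x + v' x) = cnj a * vip K J v + vip K J v'"
    by (intro vip_lin_right_integrable square_integrable_hdot[OF K J] continuous_vpoly[OF V(1)] continuous_vpoly[OF V(3)])
  show ?thesis
    unfolding maxwell_rhs_def ccross_lin J'
    by (simp only: vbip_lin_right[OF K] f g Eh V) (simp add: algebra_simps)
qed

lemma fcont_face_tpoly:
  assumes "\<And>F. F \<in> faces K \<Longrightarrow> \<Lambda> F \<in> face_tpoly c p F"
  shows "fcont K \<Lambda>"
  unfolding fcont_def
proof
  fix F assume "F \<in> faces K"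
  then obtain q where "q \<in> vpoly_space c p" "\<forall>x\<in>F. \<Lambda> F x = q x" using assms unfolding face_tpoly_def by blast
  then show "continuous_on F (\<Lambda> F)" using continuous_vpoly continuous_on_cong by (metis (no_types, lifting))
qed

theorem maxwell_local_unisolvent:
  assumes K: "polycell (K :: (real^3) set)" and k: "k \<noteq> 0" and stab: "stab_condition k \<tau>"
    and Eh: "\<And>F. F \<in> faces K \<Longrightarrow> Eh F \<in> face_tpoly c p F" and J: "square_integrable K J"
  shows "\<exists>!X. X \<in> maxwell_solutions k p c \<tau> K Eh J"
proof -
  \<comment> \<open>The pair is coded over the index set \<open>bool \<times> 3\<close>, with
    \<open>True\<close> for \<open>E\<close> and \<open>False\<close> for \<open>H\<close>;
    \<open>?enc\<close> codes, \<open>?E\<close> and \<open>?H\<close> decode.\<close>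
  let ?E = "\<lambda>(f :: (bool \<times> 3) \<times> (real^3) \<Rightarrow> complex) x. \<chi> i. f ((True, i), x)"
  let ?H = "\<lambda>(f :: (bool \<times> 3) \<times> (real^3) \<Rightarrow> complex) x. \<chi> i. f ((False, i), x)"
  let ?V = "{f :: (bool \<times> 3) \<times> (real^3) \<Rightarrow> complex. \<forall>m. (\<lambda>x. f (m, x)) \<in> poly_space c p}"
  let ?enc = "\<lambda>(v :: real^3 \<Rightarrow> complex^3) (w :: real^3 \<Rightarrow> complex^3) z. if fst (fst z) then v (snd z) $ snd (fst z) else w (snd z) $ snd (fst z)"
  have EV: "?E f \<in> vpoly_space c p" "?H f \<in> vpoly_space c p" if "f \<in> ?V" for f
    using that by (simp_all add: vpoly_space_def)
  have lin: "?E (\<lambda>z. a * f z + g z) = (\<lambda>x. a *s ?E f x + ?E g x)" "?H (\<lambda>z. a * f z + g z) = (\<lambda>x. a *s ?H f x + ?H g x)" for a f g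
    by (simp_all add: fun_eq_iff vec_eq_iff)
  have enc: "?enc v w \<in> ?V" if "v \<in> vpoly_space c p" "w \<in> vpoly_space c p" for v w
  proof -
    have "(\<lambda>x. ?enc v w ((b, i), x)) \<in> poly_space c p" for b i
      using vpoly_spaceD[OF that(1)] vpoly_spaceD[OF that(2)] by (cases b) simp_all
    then show ?thesis by (simp only: mem_Collect_eq split_paired_All) blast
  qed
  have Eenc: "?E (?enc v w) = v" "?H (?enc v w) = w" for v w
    by (simp_all add: fun_eq_iff vec_eq_iff)
  have cEh: "fcont K Eh" using Eh by (rule fcont_face_tpoly)
  have "\<exists>f\<in>?V. \<forall>g\<in>?V. maxwell_lhs k \<tau> K (?E f) (?H f) (?E g) (?H g) = maxwell_rhs \<tau> K Eh J (?E g) (?H g)"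
  proof (rule poly_tuple_problem_solvable[where B = "\<lambda>f g. maxwell_lhs k \<tau> K (?E f) (?H f) (?E g) (?H g)" and l = "\<lambda>g. maxwell_rhs \<tau> K Eh J (?E g) (?H g)"])
    fix a f g h assume V: "f \<in> ?V" "g \<in> ?V" "h \<in> ?V"
    show "maxwell_lhs k \<tau> K (?E (\<lambda>x. a * f x + g x)) (?H (\<lambda>x. a * f x + g x)) (?E h) (?H h)
        = a * maxwell_lhs k \<tau> K (?E f) (?H f) (?E h) (?H h) + maxwell_lhs k \<tau> K (?E g) (?H g) (?E h) (?H h)"
      unfolding lin by (rule maxwell_lhs_lin_left[OF K EV(1)[OF V(1)] EV(2)[OF V(1)] EV(1)[OF V(2)] EV(2)[OF V(2)] EV(1)[OF V(3)] EV(2)[OF V(3)]])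
    show "maxwell_lhs k \<tau> K (?E h) (?H h) (?E (\<lambda>x. a * f x + g x)) (?H (\<lambda>x. a * f x + g x))
        = cnj a * maxwell_lhs k \<tau> K (?E h) (?H h) (?E f) (?H f) + maxwell_lhs k \<tau> K (?E h) (?H h) (?E g) (?H g)"
      unfolding lin by (rule maxwell_lhs_lin_right[OF K EV(1)[OF V(3)] EV(2)[OF V(3)] EV(1)[OF V(1)] EV(2)[OF V(1)] EV(1)[OF V(2)] EV(2)[OF V(2)]])
  next
    fix a f g assume V: "f \<in> ?V" "g \<in> ?V"
    show "maxwell_rhs \<tau> K Eh J (?E (\<lambda>x. a * f x + g x)) (?H (\<lambda>x. a * f x + g x))
        = cnj a * maxwell_rhs \<tau> K Eh J (?E f) (?H f) + maxwell_rhs \<tau> K Eh J (?E g) (?H g)"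
      unfolding lin by (rule maxwell_rhs_lin[OF K J cEh EV(1)[OF V(1)] EV(2)[OF V(1)] EV(1)[OF V(2)] EV(2)[OF V(2)]])
  next
    \<comment> \<open>Nondegeneracy of the form is uniqueness for zero data.\<close>
    fix f assume f: "f \<in> ?V" and z: "\<And>g. g \<in> ?V \<Longrightarrow> maxwell_lhs k \<tau> K (?E f) (?H f) (?E g) (?H g) = 0"
    have "maxwell_lhs k \<tau> K (?E f) (?H f) v w = maxwell_rhs \<tau> K (\<lambda>F x. 0) (\<lambda>x. 0) v w"
      if vw: "v \<in> vpoly_space c p" "w \<in> vpoly_space c p" for v w
      using z[OF enc[OF vw]] unfolding Eenc by (simp add: maxwell_rhs_def vip_zero vbip_zero)
    then have "(?E f, ?H f) \<in> maxwell_solutions k p c \<tau> K (\<lambda>F x. 0) (\<lambda>x. 0)"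
      unfolding maxwell_solutions_iff using EV[OF f] by blast
    then have "?E f = (\<lambda>x. 0) \<and> ?H f = (\<lambda>x. 0)" by (rule maxwell_homogeneous_zero[OF K k stab])
    then have "f ((b, i), x) = 0" for b i x
      by (cases b) (simp_all add: fun_eq_iff vec_eq_iff)
    then show "f = (\<lambda>x. 0)" by (simp add: fun_eq_iff)
  qed
  then obtain f where f: "f \<in> ?V" and eq: "\<And>g. g \<in> ?V \<Longrightarrow> maxwell_lhs k \<tau> K (?E f) (?H f) (?E g) (?H g) = maxwell_rhs \<tau> K Eh J (?E g) (?H g)"
    by blast
  have "maxwell_lhs k \<tau> K (?E f) (?H f) v w = maxwell_rhs \<tau> K Eh J v w"
    if vw: "v \<in> vpoly_space c p" "w \<in> vpoly_space c p" for v w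
    using eq[OF enc[OF vw]] unfolding Eenc .
  then have ex: "(?E f, ?H f) \<in> maxwell_solutions k p c \<tau> K Eh J"
    unfolding maxwell_solutions_iff using EV[OF f] by blast
  have un: "X = Y" if XY: "X \<in> maxwell_solutions k p c \<tau> K Eh J" "Y \<in> maxwell_solutions k p c \<tau> K Eh J" for X Y
  proof -
    obtain E H E' H' where X: "X = (E, H)" and Y: "Y = (E', H')" by (cases X, cases Y)
    have V: "E \<in> vpoly_space c p" "H \<in> vpoly_space c p" "E' \<in> vpoly_space c p" "H' \<in> vpoly_space c p"
      and eqs: "\<And>v w. v \<in> vpoly_space c p \<Longrightarrow> w \<in> vpoly_space c p \<Longrightarrow> maxwell_lhs k \<tau> K E H v w = maxwell_rhs \<tau> K Eh J v w"
        "\<And>v w. v \<in> vpoly_space c p \<Longrightarrow> w \<in> vpoly_space c p \<Longrightarrow> maxwell_lhs k \<tau> K E' H' v w = maxwell_rhs \<tau> K Eh J v w"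
      using XY unfolding X Y maxwell_solutions_iff by simp_all
    let ?d = "\<lambda>x. (-1) *s E x + E' x" and ?e = "\<lambda>x. (-1) *s H x + H' x"
    have "maxwell_lhs k \<tau> K ?d ?e v w = maxwell_rhs \<tau> K (\<lambda>F x. 0) (\<lambda>x. 0) v w"
      if vw: "v \<in> vpoly_space c p" "w \<in> vpoly_space c p" for v w
      unfolding maxwell_lhs_lin_left[OF K V vw] eqs(1)[OF vw] eqs(2)[OF vw]
      by (simp add: maxwell_rhs_def vip_zero vbip_zero)
    moreover have "?d \<in> vpoly_space c p" "?e \<in> vpoly_space c p" by (intro vpoly_add vpoly_smult V)+
    ultimately have "(?d, ?e) \<in> maxwell_solutions k p c \<tau> K (\<lambda>F x. 0) (\<lambda>x. 0)"
      unfolding maxwell_solutions_iff by blast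
    then have "?d = (\<lambda>x. 0) \<and> ?e = (\<lambda>x. 0)" by (rule maxwell_homogeneous_zero[OF K k stab])
    then show "X = Y" unfolding X Y by (simp add: fun_eq_iff vec_eq_iff)
  qed
  show ?thesis using ex un by blast
qed

section \<open>The condensed Maxwell problem\<close>

definition cut :: "(real^'n) set set \<Rightarrow> ((real^'n) set \<Rightarrow> real^'n \<Rightarrow> 'b::zero) \<Rightarrow> (real^'n) set \<Rightarrow> real^'n \<Rightarrow> 'b" where
  "cut A \<Lambda> F = (if \<exists>K\<in>A. F \<in> faces K then \<Lambda> F else (\<lambda>x. 0))"

text \<open>
  Neighbouring cells have stabilization parameters with real parts of the same sign, so the
  energy identities may be summed over the cells of one sign only.
\<close>

lemma sign_decoupling:
  fixes t \<gamma> :: "(real^'n) set \<Rightarrow> real" and G :: "(real^'n) set \<Rightarrow> ((real^'n) set \<Rightarrow> real^'n \<Rightarrow> 'b::zero) \<Rightarrow> complex"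
  assumes fin: "finite \<T>" and t: "\<And>K. K \<in> \<T> \<Longrightarrow> t K \<noteq> 0"
    and adj: "\<And>K L. K \<in> \<T> \<Longrightarrow> L \<in> \<T> \<Longrightarrow> adjacent K L \<Longrightarrow> t K * t L > 0"
    and cong: "\<And>K \<eta> \<eta>'. (\<And>F. F \<in> faces K \<Longrightarrow> \<eta> F = \<eta>' F) \<Longrightarrow> G K \<eta> = G K \<eta>'"
    and zero: "\<And>K. G K (\<lambda>F x. 0) = 0"
    and energy: "\<And>K. K \<in> \<T> \<Longrightarrow> Re (G K \<Lambda>) = - t K * \<gamma> K" and \<gamma>: "\<And>K. K \<in> \<T> \<Longrightarrow> \<gamma> K \<ge> 0"
    and form: "\<And>A. A \<subseteq> \<T> \<Longrightarrow> (\<Sum>K\<in>\<T>. G K (cut A \<Lambda>)) = 0"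
    and K: "K \<in> \<T>"
  shows "\<gamma> K = 0"
proof -
  define A where "A = {L \<in> \<T>. t L * t K > 0}"
  have A: "A \<subseteq> \<T>" by (auto simp: A_def)
  have GA: "G L (cut A \<Lambda>) = (if L \<in> A then G L \<Lambda> else 0)" if L: "L \<in> \<T>" for L
  proof (cases "L \<in> A")
    case True
    then have "G L (cut A \<Lambda>) = G L \<Lambda>" by (intro cong) (auto simp: cut_def)
    then show ?thesis using True by simp
  next
    case False
    \<comment> \<open>If \<open>L\<close> shared the face with some \<open>M\<close> in
      \<open>A\<close>, the two would be adjacent, so \<open>t L\<close> would have the sign of
      \<open>t M\<close> and hence that of \<open>t K\<close>, and \<open>L\<close> would be in
      \<open>A\<close>.\<close>
    have "cut A \<Lambda> F = (\<lambda>x. 0)" if F: "F \<in> faces L" for F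
    proof -
      have "F \<notin> faces M" if M: "M \<in> A" for M
      proof
        assume "F \<in> faces M"
        then have "adjacent L M" using F M False by (auto simp: adjacent_def)
        then have "t L * t M > 0" using adj L M A by blast
        moreover have "t M * t K > 0" using M by (simp add: A_def)
        ultimately have "t L * t K > 0" by (auto simp: zero_less_mult_iff)
        then show False using False L by (simp add: A_def)
      qed
      then show ?thesis by (auto simp: cut_def)
    qed
    then have "G L (cut A \<Lambda>) = G L (\<lambda>F x. 0)" by (intro cong)
    then show ?thesis using False zero by simp
  qed
  have "0 = (\<Sum>L\<in>\<T>. G L (cut A \<Lambda>))" using form[OF A] by simp
  also have "\<dots> = (\<Sum>L\<in>\<T>. if L \<in> A then G L \<Lambda> else 0)" by (rule sum.cong) (simp_all add: GA)
  also have "\<dots> = (\<Sum>L\<in>A. G L \<Lambda>)" using A by (simp add: sum.inter_restrict[OF fin, symmetric] Int_absorb1)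
  finally have "(\<Sum>L\<in>A. Re (G L \<Lambda>)) = 0" by (simp add: Re_sum[symmetric])
  then have "(\<Sum>L\<in>A. t L * \<gamma> L) = 0"
    using energy A by (simp add: sum_negf subset_iff)
  \<comment> \<open>The factor \<open>t K\<close> makes every summand nonnegative.\<close>
  then have "(\<Sum>L\<in>A. t K * t L * \<gamma> L) = 0"
    by (simp add: sum_distrib_left[symmetric] mult.assoc)
  moreover have "t K * t L * \<gamma> L \<ge> 0" if "L \<in> A" for L
    using that \<gamma>[of L] mult_nonneg_nonneg[of "t K * t L" "\<gamma> L"] by (simp add: A_def mult.commute)
  moreover have "finite A" using A fin finite_subset by blast
  moreover have KA: "K \<in> A" using K t[OF K] by (auto simp: A_def zero_less_mult_iff)
  ultimately have "t K * t K * \<gamma> K = 0" using sum_nonneg_eq_0_iff[of A "\<lambda>L. t K * t L * \<gamma> L"] by blast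
  then show ?thesis using t[OF K] by simp
qed

text \<open>Multiplied by \<open>- Im k\<close>, the contribution of each cell is nonnegative, so a
  zero sum makes each of them zero. The mismatch stays open where
  \<open>Re (\<tau> K) = 0\<close>.\<close>

lemma damped_energies_vanish:
  assumes fin: "finite \<T>" and k: "Im k \<noteq> 0" and stab: "\<And>K. K \<in> \<T> \<Longrightarrow> stab_condition k (\<tau> K)"
    and nn: "\<And>K. K \<in> \<T> \<Longrightarrow> \<alpha> K \<ge> 0" "\<And>K. K \<in> \<T> \<Longrightarrow> \<beta> K \<ge> 0" "\<And>K. K \<in> \<T> \<Longrightarrow> \<gamma> K \<ge> (0::real)"
    and sum: "(\<Sum>K\<in>\<T>. - Im k * (\<alpha> K + \<beta> K) + Re (\<tau> K) * \<gamma> K) = 0" and K: "K \<in> \<T>"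
  shows "\<alpha> K = 0 \<and> \<beta> K = 0"
proof -
  let ?s = "\<lambda>K. - Im k * (\<alpha> K + \<beta> K) + Re (\<tau> K) * \<gamma> K"
  have "0 \<le> - (Im k * ?s L)" if L: "L \<in> \<T>" for L
  proof -
    have "Im k * Re (\<tau> L) \<le> 0" using stab[OF L] k by (simp add: stab_condition_def)
    then have "Im k * Re (\<tau> L) * \<gamma> L \<le> 0" using nn(3)[OF L] by (simp add: mult_nonpos_nonneg)
    moreover have "(Im k)\<^sup>2 * (\<alpha> L + \<beta> L) \<ge> 0" using nn[OF L] by simp
    ultimately show ?thesis by (simp add: algebra_simps power2_eq_square)
  qed
  moreover have "(\<Sum>K\<in>\<T>. - (Im k * ?s K)) = 0"
    unfolding sum_negf sum_distrib_left[symmetric] sum by simp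
  ultimately have "- (Im k * ?s K) = 0"
    using sum_nonneg_eq_0_iff[OF fin, of "\<lambda>K. - (Im k * ?s K)"] K by blast
  then have "?s K = 0" using k by simp
  then show ?thesis by (rule stab_energy(2)[OF stab[OF K] nn(1)[OF K] nn(2)[OF K] nn(3)[OF K] _ k])
qed

lemma ccross_minus: "ccross (- u) n = - ccross u n"
  by (simp add: ccross_def vec_eq_iff forall_3)

lemma square_integrable_zero: "square_integrable K (\<lambda>x. 0)"
  by (simp add: square_integrable_def set_borel_measurable_def set_integrable_def)

lemma zero_face_tpoly: "(\<lambda>x. 0) \<in> face_tpoly c p F"
  unfolding face_tpoly_def using vpoly_0[of c p] by (intro CollectI conjI bexI[of _ "\<lambda>x. 0"]) auto

text \<open>Traces on different faces are independent of each other, so replacing some of them by 0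
  stays in the space. This supplies the localized test functions.\<close>

lemma cut_N_h:
  assumes "\<eta> \<in> N_h c p \<Omega> \<T>"
  shows "(\<lambda>F. if P F then \<eta> F else (\<lambda>x. 0)) \<in> N_h c p \<Omega> \<T>"
  using assms zero_face_tpoly unfolding N_h_def by auto

lemma face_tpoly_normal:
  assumes K: "polycell K" and F: "F \<in> faces K" and \<eta>: "\<eta> \<in> face_tpoly c p F" and x: "x \<in> F"
    and z: "ccross (\<eta> x) (cvec (outward_normal K F)) = 0"
  shows "\<eta> x = 0"
proof (rule ccross_eq_0_normal[OF z _ norm_outward_normal[OF K F]])
  show "hdot (\<eta> x) (cvec (outward_normal K F)) = 0"
    using \<eta> x unit_normal_outward_normal[OF K F] unfolding face_tpoly_def by blast
qed

lemma single_face_fint: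
  assumes K: "polycell K" and F: "F \<in> faces K" and z: "\<And>G x. G \<in> faces K \<Longrightarrow> G \<noteq> F \<Longrightarrow> x \<in> G \<Longrightarrow> g G x = 0"
  shows "fint K g = (LINT x:F|face_measure F. g F x)"
proof -
  have "(LINT x:G|face_measure G. g G x) = 0" if G: "G \<in> faces K - {F}" for G
  proof -
    have "indicator G x *\<^sub>R g G x = 0" for x using z[of G x] G by (auto simp: indicator_def)
    then show ?thesis unfolding set_lebesgue_integral_def by (simp only: Bochner_Integration.integral_zero)
  qed
  then have "(\<Sum>G\<in>faces K - {F}. LINT x:G|face_measure G. g G x) = 0" by (intro sum.neutral) blast
  then show ?thesis unfolding fint_def sum.remove[OF finite_faces[OF K] F] by simp
qed

theorem maxwell_global_unisolvent:
  fixes \<T> :: "(real^3) set set"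
  assumes k: "k \<noteq> 0" and mesh: "is_mesh c \<Omega> \<T>" and stab: "\<And>K. K \<in> \<T> \<Longrightarrow> stab_condition k (\<tau> K)"
    and adj: "\<And>K L. K \<in> \<T> \<Longrightarrow> L \<in> \<T> \<Longrightarrow> adjacent K L \<Longrightarrow>
      (Im k = 0 \<longrightarrow> Re (\<tau> K) * Re (\<tau> L) > 0) \<and> (Im k \<noteq> 0 \<longrightarrow> \<tau> K + \<tau> L \<noteq> 0)"
    and \<Lambda>: "\<Lambda> \<in> N_h c p \<Omega> \<T>"
  shows "(\<forall>\<eta>\<in>N_h c p \<Omega> \<T>. maxwell_form k p c \<T> \<tau> \<Lambda> \<eta> = 0) \<longleftrightarrow> (\<forall>F\<in>mesh_faces \<T>. \<forall>x\<in>F. \<Lambda> F x = 0)"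
proof -
  note fin = meshD(2)[OF mesh] and pc = mesh_polycell[OF mesh]
  let ?n = "\<lambda>K F. cvec (outward_normal K F)"
  have \<Lambda>F: "\<Lambda> F \<in> face_tpoly c p F" if "K \<in> \<T>" "F \<in> faces K" for K F
    using \<Lambda> that unfolding N_h_def mesh_faces_def by blast
  have fc: "fcont K \<Lambda>" if "K \<in> \<T>" for K using \<Lambda>F[OF that] by (rule fcont_face_tpoly)
  define E where "E K = fst (maxwell_sol k p c (\<tau> K) K \<Lambda>)" for K
  define H where "H K = snd (maxwell_sol k p c (\<tau> K) K \<Lambda>)" for K
  have ex1: "\<exists>!X. X \<in> maxwell_solutions k p c (\<tau> K) K \<Lambda> (\<lambda>x. 0)" if K: "K \<in> \<T>" for K
    by (rule maxwell_local_unisolvent[OF pc[OF K] k stab[OF K] \<Lambda>F[OF K] square_integrable_zero])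
  \<comment> \<open>Unisolvence of the element problem makes the description in
    \<open>maxwell_sol\<close> denote a solution.\<close>
  have sol: "(E K, H K) \<in> maxwell_solutions k p c (\<tau> K) K \<Lambda> (\<lambda>x. 0)" if K: "K \<in> \<T>" for K
    using theI'[OF ex1[OF K]] by (simp add: E_def H_def maxwell_sol_def)
  have flux: "maxwell_flux k p c (\<tau> K) K \<Lambda> = (\<lambda>F x. ccross (H K x) (?n K F)
      + \<tau> K *s tangential (outward_normal K F) (E K x - \<Lambda> F x))" for K
    by (simp add: fun_eq_iff maxwell_flux_def Let_def case_prod_unfold E_def H_def)
  let ?G = "\<lambda>K \<eta>. vbip K (maxwell_flux k p c (\<tau> K) K \<Lambda>) \<eta>"
  show ?thesis
  proof
    assume zero: "\<forall>F\<in>mesh_faces \<T>. \<forall>x\<in>F. \<Lambda> F x = 0"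
    have \<Lambda>0: "\<Lambda> F x = 0" if "K \<in> \<T>" "F \<in> faces K" "x \<in> F" for K F x
      using zero that unfolding mesh_faces_def by blast
    have G0: "?G K \<eta> = 0" if K: "K \<in> \<T>" for K \<eta>
    proof -
      have "vbip K (\<lambda>F x. ccross (\<Lambda> F x) (?n K F)) v = vbip K (\<lambda>F x. 0) v" "vbip K \<Lambda> v = vbip K (\<lambda>F x. 0) v" for v
        unfolding vbip_fint by (rule fint_cong, simp add: \<Lambda>0[OF K])+
      then have "((\<lambda>x. 0), (\<lambda>x. 0)) \<in> maxwell_solutions k p c (\<tau> K) K \<Lambda> (\<lambda>x. 0)"
        unfolding maxwell_solutions_iff by (simp add: maxwell_lhs_def maxwell_rhs_def vip_zero vbip_zero curl_zero vpoly_0)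
      then have "E K = (\<lambda>x. 0) \<and> H K = (\<lambda>x. 0)" using ex1[OF K] sol[OF K] by blast
      then have "?G K \<eta> = vbip K (\<lambda>F x. 0) \<eta>"
        unfolding vbip_fint flux by (intro fint_cong) (simp add: \<Lambda>0[OF K] tangential_def)
      then show ?thesis by (simp add: vbip_zero)
    qed
    show "\<forall>\<eta>\<in>N_h c p \<Omega> \<T>. maxwell_form k p c \<T> \<tau> \<Lambda> \<eta> = 0"
    proof
      fix \<eta>
      have "\<forall>K\<in>\<T>. ?G K \<eta> = 0" using G0 by (rule ballI)
      then show "maxwell_form k p c \<T> \<tau> \<Lambda> \<eta> = 0" unfolding maxwell_form_def by (rule sum.neutral)
    qed
  next
    assume form: "\<forall>\<eta>\<in>N_h c p \<Omega> \<T>. maxwell_form k p c \<T> \<tau> \<Lambda> \<eta> = 0"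
    \<comment> \<open>Collects what \<open>maxwell_energy\<close> says about one cell, so that the
      three numbers can be chosen for all cells at once.\<close>
    define P where "P K \<alpha> \<beta> \<gamma> \<longleftrightarrow> 0 \<le> \<alpha> \<and> 0 \<le> \<beta> \<and> 0 \<le> \<gamma> \<and>
      \<i> * k * complex_of_real \<alpha> - \<i> * cnj k * complex_of_real \<beta> + \<tau> K * complex_of_real \<gamma> + ?G K \<Lambda> = 0 \<and>
      (\<alpha> = 0 \<longrightarrow> E K = (\<lambda>x. 0)) \<and> (\<beta> = 0 \<longrightarrow> H K = (\<lambda>x. 0)) \<and>
      (\<gamma> = 0 \<longrightarrow> (\<forall>F\<in>faces K. \<forall>x\<in>F. ccross (E K x - \<Lambda> F x) (?n K F) = 0))" for K \<alpha> \<beta> \<gamma>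
    have "\<exists>\<alpha> \<beta> \<gamma>. P K \<alpha> \<beta> \<gamma>" if K: "K \<in> \<T>" for K
    proof (rule maxwell_energy[OF pc[OF K] sol[OF K] fc[OF K]], intro exI)
      fix \<alpha> \<beta> \<gamma>
      assume "0 \<le> \<alpha>" "0 \<le> \<beta>" "0 \<le> \<gamma>" and "\<i> * k * complex_of_real \<alpha> - \<i> * cnj k * complex_of_real \<beta>
          + \<tau> K * complex_of_real \<gamma> + vbip K (\<lambda>F x. ccross (H K x) (?n K F)
          + \<tau> K *s tangential (outward_normal K F) (E K x - \<Lambda> F x)) \<Lambda> = 0"
        and "\<alpha> = 0 \<Longrightarrow> E K = (\<lambda>x. 0)" "\<beta> = 0 \<Longrightarrow> H K = (\<lambda>x. 0)"
          "\<gamma> = 0 \<Longrightarrow> \<forall>F\<in>faces K. \<forall>x\<in>F. ccross (E K x - \<Lambda> F x) (?n K F) = 0"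
      then show "P K \<alpha> \<beta> \<gamma>" unfolding P_def flux by (intro conjI impI)
    qed
    then obtain \<alpha> \<beta> \<gamma> where P: "\<And>K. K \<in> \<T> \<Longrightarrow> P K (\<alpha> K) (\<beta> K) (\<gamma> K)" by metis
    have nn: "\<alpha> K \<ge> 0" "\<beta> K \<ge> 0" "\<gamma> K \<ge> 0"
      and id: "\<i> * k * complex_of_real (\<alpha> K) - \<i> * cnj k * complex_of_real (\<beta> K) + \<tau> K * complex_of_real (\<gamma> K) + ?G K \<Lambda> = 0"
      and z: "\<alpha> K = 0 \<Longrightarrow> E K = (\<lambda>x. 0)" "\<beta> K = 0 \<Longrightarrow> H K = (\<lambda>x. 0)"
        "\<And>F x. \<gamma> K = 0 \<Longrightarrow> F \<in> faces K \<Longrightarrow> x \<in> F \<Longrightarrow> ccross (E K x - \<Lambda> F x) (?n K F) = 0"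
      if K: "K \<in> \<T>" for K
      using P[OF K] unfolding P_def by simp_all
    have re: "Re (?G K \<Lambda>) = Im k * (\<alpha> K + \<beta> K) - Re (\<tau> K) * \<gamma> K" if "K \<in> \<T>" for K
      using arg_cong[OF id[OF that], of Re] by (simp add: algebra_simps)
    show "\<forall>F\<in>mesh_faces \<T>. \<forall>x\<in>F. \<Lambda> F x = 0"
    proof (cases "Im k = 0")
      case True
      have \<gamma>0: "\<gamma> K = 0" if K: "K \<in> \<T>" for K
      proof (rule sign_decoupling[where t = "\<lambda>K. Re (\<tau> K)" and G = ?G and \<Lambda> = \<Lambda> and \<T> = \<T>])
        show "?G L \<eta> = ?G L \<eta>'" if "\<And>F. F \<in> faces L \<Longrightarrow> \<eta> F = \<eta>' F" for L \<eta> \<eta>'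
          unfolding vbip_fint by (rule fint_cong) (simp add: that)
        show "(\<Sum>K\<in>\<T>. ?G K (cut A \<Lambda>)) = 0" for A
          using form cut_N_h[OF \<Lambda>, of "\<lambda>F. \<exists>K\<in>A. F \<in> faces K"] unfolding maxwell_form_def cut_def[abs_def] by blast
      qed (use fin stab adj True re nn K in \<open>simp_all add: vbip_zero stab_condition_def\<close>)
      show ?thesis
      proof (intro ballI)
        fix F x assume "F \<in> mesh_faces \<T>" and x: "x \<in> F"
        then obtain K where K: "K \<in> \<T>" and F: "F \<in> faces K" by (auto simp: mesh_faces_def)
        have "E K = (\<lambda>x. 0) \<and> H K = (\<lambda>x. 0)"
          by (rule maxwell_matching_trace_zero[OF pc[OF K] k sol[OF K]]) (rule z(3)[OF K \<gamma>0[OF K]])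
        then have "ccross (\<Lambda> F x) (?n K F) = 0" using z(3)[OF K \<gamma>0[OF K] F x] by (simp add: ccross_minus)
        then show "\<Lambda> F x = 0" by (rule face_tpoly_normal[OF pc[OF K] F \<Lambda>F[OF K F] x])
      qed
    next
      case False
      have "(\<Sum>K\<in>\<T>. Re (?G K \<Lambda>)) = 0"
        using form \<Lambda> unfolding maxwell_form_def by (simp add: Re_sum[symmetric])
      then have "(\<Sum>K\<in>\<T>. - (Re (?G K \<Lambda>))) = 0" by (simp add: sum_negf)
      moreover have "(\<Sum>K\<in>\<T>. - (Re (?G K \<Lambda>))) = (\<Sum>K\<in>\<T>. - Im k * (\<alpha> K + \<beta> K) + Re (\<tau> K) * \<gamma> K)"
        by (rule sum.cong) (simp_all add: re)
      ultimately have sum0: "(\<Sum>K\<in>\<T>. - Im k * (\<alpha> K + \<beta> K) + Re (\<tau> K) * \<gamma> K) = 0" by simp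
      have EH: "E K = (\<lambda>x. 0)" "H K = (\<lambda>x. 0)" if K: "K \<in> \<T>" for K
        using damped_energies_vanish[OF fin False stab nn sum0 K] z(1,2)[OF K] by simp_all
      show ?thesis
      proof (intro ballI)
        fix F x assume "F \<in> mesh_faces \<T>" and x: "x \<in> F"
        then obtain K where K: "K \<in> \<T>" and F: "F \<in> faces K" by (auto simp: mesh_faces_def)
        show "\<Lambda> F x = 0"
        proof (cases "F \<subseteq> frontier \<Omega>")
          case True
          then show ?thesis using \<Lambda> x \<open>F \<in> mesh_faces \<T>\<close> unfolding N_h_def by blast
        next
          case nf: False
          obtain L where L: "L \<in> \<T>" "L \<noteq> K" "F \<in> faces L" by (rule mesh_neighbour[OF mesh K F nf])
          define \<eta> where "\<eta> G = (if G = F then \<Lambda> G else (\<lambda>x. 0))" for G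
          have \<eta>: "\<eta> \<in> N_h c p \<Omega> \<T>" unfolding \<eta>_def[abs_def] by (rule cut_N_h[OF \<Lambda>])
          \<comment> \<open>The normal of \<open>K\<close> serves for both neighbours: it enters
            \<open>?r\<close> twice, so its sign does not matter.\<close>
          let ?D = "\<lambda>x. ccross (\<Lambda> F x) (?n K F)"
          let ?r = "LINT x:F|face_measure F. hdot (?D x) (?D x)"
          have G: "?G M \<eta> = (if F \<in> faces M then - \<tau> M * ?r else 0)" if M: "M \<in> \<T>" for M
          proof (cases "F \<in> faces M")
            case FM: True
            have "?G M \<eta> = (LINT x:F|face_measure F. hdot (maxwell_flux k p c (\<tau> M) M \<Lambda> F x) (\<eta> F x))"
              unfolding vbip_fint by (rule single_face_fint[OF pc[OF M] FM]) (simp add: \<eta>_def)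
            also have "\<dots> = (LINT x:F|face_measure F. - \<tau> M * hdot (?D x) (?D x))"
            proof -
              have nM: "outward_normal M F = outward_normal K F \<or> outward_normal M F = - outward_normal K F"
                using mesh_opposite_normal[OF mesh K M _ F FM] by (cases "M = K") auto
              have "hdot (maxwell_flux k p c (\<tau> M) M \<Lambda> F x) (\<eta> F x) = - \<tau> M * hdot (?D x) (?D x)" for x
              proof -
                have "maxwell_flux k p c (\<tau> M) M \<Lambda> F x = \<tau> M *s tangential (outward_normal M F) (- \<Lambda> F x)"
                  by (simp add: flux EH[OF M])
                moreover have "hdot (tangential (outward_normal M F) (- \<Lambda> F x)) (\<Lambda> F x) = - hdot (?D x) (?D x)"
                  using nM unfolding hdot_tangential
                  by (elim disjE) (simp_all add: ccross_def hdot_def sum_3 cvec_def algebra_simps)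
                ultimately show ?thesis by (simp add: \<eta>_def hdot_smult_left)
              qed
              then show ?thesis by simp
            qed
            also have "\<dots> = - \<tau> M * ?r" by (rule set_integral_mult_right)
            finally show ?thesis using FM by simp
          next
            case FM: False
            have "?G M \<eta> = vbip M (maxwell_flux k p c (\<tau> M) M \<Lambda>) (\<lambda>F x. 0)"
              unfolding vbip_fint by (rule fint_cong) (use FM in \<open>auto simp: \<eta>_def\<close>)
            then show ?thesis using FM by (simp add: vbip_zero)
          qed
          have "(\<Sum>M\<in>\<T>. ?G M \<eta>) = 0" using form \<eta> unfolding maxwell_form_def by blast
          \<comment> \<open>The sum reduces to two cells because no third one has the face
            \<open>F\<close>.\<close>
          moreover have "(\<Sum>M\<in>\<T>. ?G M \<eta>) = (\<Sum>M\<in>{K, L}. - \<tau> M * ?r)"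
          proof (rule sum.mono_neutral_cong_right[OF fin])
            show "{K, L} \<subseteq> \<T>" using K L by simp
            show "\<forall>M\<in>\<T> - {K, L}. ?G M \<eta> = 0"
            proof
              fix M assume M: "M \<in> \<T> - {K, L}"
              have "F \<notin> faces M"
                using mesh_face_two_cells[OF mesh K L(1), of M F] M F L by auto
              then show "?G M \<eta> = 0" using G M by simp
            qed
            show "?G M \<eta> = - \<tau> M * ?r" if "M \<in> {K, L}" for M
              using that G[of M] K L F by auto
          qed
          ultimately have "(\<Sum>M\<in>{K, L}. - \<tau> M * ?r) = 0" by simp
          then have "- \<tau> K * ?r + - \<tau> L * ?r = 0" using L(2) by simp
          then have "(- \<tau> K + - \<tau> L) * ?r = 0" unfolding distrib_right .
          then have "- ((\<tau> K + \<tau> L) * ?r) = 0" by (simp only: minus_add_distrib[symmetric] mult_minus_left)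
          then have "(\<tau> K + \<tau> L) * ?r = 0" by (simp only: neg_equal_0_iff_equal)
          moreover have "\<tau> K + \<tau> L \<noteq> 0"
            using adj[OF K L(1)] F L False by (auto simp: adjacent_def)
          ultimately have r0: "?r = 0" by (simp only: mult_eq_0_iff) blast
          have "?r = of_real (LINT x:F|face_measure F. (\<Sum>i\<in>UNIV. (cmod (?D x $ i))\<^sup>2))"
            unfolding hdot_self by (rule set_integral_complex_of_real)
          then have s0: "(LINT x:F|face_measure F. (\<Sum>i\<in>UNIV. (cmod (?D x $ i))\<^sup>2)) = 0" using r0 by simp
          have cont: "continuous_on F (\<lambda>x. \<Sum>i\<in>UNIV. (cmod (?D x $ i))\<^sup>2)"
            using fc[OF K] F unfolding fcont_def by (intro continuous_intros) auto
          have "(\<Sum>i\<in>UNIV. (cmod (?D x $ i))\<^sup>2) = 0"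
            by (rule face_integral_zero[OF pc[OF K] F cont _ s0 x]) (simp add: sum_nonneg)
          then have "?D x = 0" unfolding hdot_self_zero .
          then show "\<Lambda> F x = 0" by (rule face_tpoly_normal[OF pc[OF K] F \<Lambda>F[OF K F] x])
        qed
      qed
    qed
  qed
qed

section \<open>The Helmholtz problem\<close>

lemma ip_lin_left:
  assumes K: "polycell K" and c: "continuous_on UNIV u" "continuous_on UNIV w" "continuous_on UNIV v"
  shows "ip K (\<lambda>x. a * u x + w x) v = a * ip K u v + ip K w v"
proof -
  have "continuous_on UNIV (\<lambda>x. a * (u x * cnj (v x)))" "continuous_on UNIV (\<lambda>x. w x * cnj (v x))"
    by (intro continuous_intros c)+
  from cint_add[OF K this] show ?thesis by (simp add: ip_cint cint_scale distrib_right mult.assoc)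
qed

lemma ip_lin_right_integrable:
  assumes "set_integrable lebesgue K (\<lambda>x. v x * cnj (u x))" "set_integrable lebesgue K (\<lambda>x. v x * cnj (w x))"
  shows "ip K v (\<lambda>x. a * u x + w x) = cnj a * ip K v u + ip K v w"
  using cint_add_integrable[OF set_integrable_mult_right[of "cnj a", OF assms(1)] assms(2)]
  by (simp add: ip_cint cint_scale distrib_left mult.left_commute)

lemma ip_lin_right:
  assumes K: "polycell K" and c: "continuous_on UNIV u" "continuous_on UNIV w" "continuous_on UNIV v"
  shows "ip K v (\<lambda>x. a * u x + w x) = cnj a * ip K v u + ip K v w"
  by (intro ip_lin_right_integrable cell_integrable(2)[OF K] continuous_intros c)

lemma fcont_prod: "fcont K u \<Longrightarrow> fcont K v \<Longrightarrow> fcont K (\<lambda>F x. u F x * cnj (v F x))"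
  unfolding fcont_def by (intro ballI continuous_intros) auto

lemma bip_lin_left:
  assumes K: "polycell K" and c: "fcont K u" "fcont K w" "fcont K v"
  shows "bip K (\<lambda>F x. a * u F x + w F x) v = a * bip K u v + bip K w v"
  using fint_add[OF K fcont_scale[OF fcont_prod[OF c(1,3)], of a] fcont_prod[OF c(2,3)]]
  by (simp add: bip_fint fint_scale distrib_right mult.assoc)

lemma bip_lin_right:
  assumes K: "polycell K" and c: "fcont K u" "fcont K w" "fcont K v"
  shows "bip K v (\<lambda>F x. a * u F x + w F x) = cnj a * bip K v u + bip K v w"
  using fint_add[OF K fcont_scale[OF fcont_prod[OF c(3,1)], of "cnj a"] fcont_prod[OF c(3,2)]]
  by (simp add: bip_fint fint_scale distrib_left mult.left_commute)

lemma bip_scale_left: "bip K (\<lambda>F x. a * u F x) v = a * bip K u v"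
  by (simp add: bip_fint fint_scale mult.assoc)

lemma ip_zero: "ip K (\<lambda>x. 0) v = 0" "ip K v (\<lambda>x. 0) = 0"
  by (simp_all add: ip_cint cint_zero)

lemma bip_zero: "bip K (\<lambda>F x. 0) v = 0" "bip K v (\<lambda>F x. 0) = 0"
  by (simp_all add: bip_fint fint_zero)

lemma ip_cnj: "cnj (ip K u v) = ip K v u"
  by (simp add: ip_cint cint_cnj[symmetric] mult.commute)

lemma fcont_poly: "q \<in> poly_space c p \<Longrightarrow> fcont K (\<lambda>F. q)"
  by (simp add: fcont_def continuous_poly)

lemma divg_poly: "v \<in> vpoly_space c p \<Longrightarrow> divg v \<in> poly_space c p"
  unfolding divg_def[abs_def] by (intro poly_space_sum pderivative_poly vpoly_spaceD)

lemma divg_Simplicial_Suc: "v \<in> vpoly_space Simplicial (Suc d) \<Longrightarrow> divg v \<in> poly_space Simplicial d"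
  unfolding divg_def[abs_def] by (intro poly_space_sum pderivative_Simplicial_Suc vpoly_spaceD)

lemma divg_Simplicial_0: "v \<in> vpoly_space Simplicial 0 \<Longrightarrow> divg v = (\<lambda>x. 0)"
  unfolding divg_def[abs_def] by (simp add: pderivative_Simplicial_0[OF vpoly_spaceD])

lemma divg_combination:
  assumes "u \<in> vpoly_space c p" "v \<in> vpoly_space c p"
  shows "divg (\<lambda>x. a *s u x + v x) = (\<lambda>x. a * divg u x + divg v x)"
  unfolding divg_def[abs_def] vector_add_component vector_smult_component
    pderivative_combination[OF vpoly_spaceD[OF assms(1)] vpoly_spaceD[OF assms(2)]]
  by (simp add: sum.distrib sum_distrib_left)

lemma divg_zero: "divg (\<lambda>x. 0) = (\<lambda>x. 0)"
  unfolding divg_def[abs_def] by (simp add: pderivative_zero)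

definition grad :: "(real^'n \<Rightarrow> complex) \<Rightarrow> real^'n \<Rightarrow> complex^'n" where
  "grad f x = (\<chi> i. pderivative i f x)"

lemma grad_vpoly: "f \<in> poly_space c p \<Longrightarrow> grad f \<in> vpoly_space c p"
  by (rule vpoly_spaceI) (simp add: grad_def pderivative_poly)

lemma grad_Simplicial_Suc: "f \<in> poly_space Simplicial (Suc d) \<Longrightarrow> grad f \<in> vpoly_space Simplicial d"
  by (rule vpoly_spaceI) (simp add: grad_def pderivative_Simplicial_Suc)

lemma grad_Simplicial_0: "f \<in> poly_space Simplicial 0 \<Longrightarrow> grad f = (\<lambda>x. 0)"
  by (rule ext) (simp add: vec_eq_iff grad_def pderivative_Simplicial_0)

lemma divg_by_parts:
  fixes K :: "(real^'n::{finite,wellorder}) set"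
  assumes K: "polycell K" and f: "f \<in> poly_space c p" and v: "v \<in> vpoly_space c p"
  shows "ip K f (divg v) = - vip K (grad f) v + bip K (\<lambda>F. f) (\<lambda>F x. hdot (v x) (cvec (outward_normal K F)))"
proof -
  note vp = vpoly_spaceD[OF v]
  note cf = continuous_poly[OF f] and cv = continuous_poly[OF vp]
  note cdf = continuous_poly[OF pderivative_poly[OF f]] and cdv = continuous_poly[OF pderivative_poly[OF vp]]
  have cs: "cint K (\<lambda>x. \<Sum>i\<in>UNIV. g i x) = (\<Sum>i\<in>UNIV. cint K (g i))"
    if "\<And>i. continuous_on UNIV (g i)" for g :: "'n::{finite,wellorder} \<Rightarrow> real^'n::_ \<Rightarrow> complex"
    unfolding cint_def set_lebesgue_integral_def scaleR_sum_right
    by (rule Bochner_Integration.integral_sum) (rule cell_integrable(2)[OF K that, unfolded set_integrable_def])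
  have fs: "fint K (\<lambda>F x. \<Sum>i\<in>I. g i F x) = (\<Sum>i\<in>I. fint K (g i)) \<and> fcont K (\<lambda>F x. \<Sum>i\<in>I. g i F x)"
    if "finite I" "\<And>i. fcont K (g i)" for I :: "'n::{finite,wellorder} set" and g :: "'n \<Rightarrow> _ \<Rightarrow> real^'n::_ \<Rightarrow> complex"
    using that
  proof (induction I)
    case empty
    then show ?case by (simp add: fint_zero fcont_def)
  next
    case (insert i I)
    have c: "fcont K (g i)" "fcont K (\<lambda>F x. \<Sum>i\<in>I. g i F x)" using insert by simp_all
    then have "fcont K (\<lambda>F x. g i F x + (\<Sum>i\<in>I. g i F x))" by (simp add: fcont_def continuous_on_add)
    then show ?case using insert fint_add[OF K c] by simp
  qed
  have A: "vip K (grad f) v = (\<Sum>i\<in>UNIV. cint K (\<lambda>x. pderivative i f x * cnj (v x $ i)))"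
    unfolding vip_cint hdot_def grad_def vec_lambda_beta by (rule cs) (intro continuous_intros cdf cv)
  have B: "ip K f (divg v) = (\<Sum>i\<in>UNIV. cint K (\<lambda>x. f x * cnj (pderivative i (\<lambda>y. v y $ i) x)))"
    unfolding ip_cint divg_def cnj_sum sum_distrib_left by (rule cs) (intro continuous_intros cf cdv)
  have C: "bip K (\<lambda>F. f) (\<lambda>F x. hdot (v x) (cvec (outward_normal K F)))
      = (\<Sum>i\<in>UNIV. fint K (\<lambda>F x. of_real (outward_normal K F $ i) * (f x * cnj (v x $ i))))"
  proof -
    have "bip K (\<lambda>F. f) (\<lambda>F x. hdot (v x) (cvec (outward_normal K F)))
        = fint K (\<lambda>F x. \<Sum>i\<in>UNIV. of_real (outward_normal K F $ i) * (f x * cnj (v x $ i)))"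
      unfolding bip_fint by (rule fint_cong) (simp add: hdot_def cvec_def sum_distrib_left mult.commute mult.left_commute)
    moreover have "fcont K (\<lambda>F x. of_real (outward_normal K F $ i) * (f x * cnj (v x $ i)))" for i
      unfolding fcont_def by (intro ballI continuous_intros cf cv)
    ultimately show ?thesis using fs[of UNIV] by simp
  qed
  show ?thesis unfolding A B C integral_by_parts[OF K f vp, symmetric] sum.distrib by simp
qed

section \<open>The Helmholtz element problem\<close>

lemma helmholtz_solutionsD:
  assumes "(u, \<phi>) \<in> helmholtz_solutions k p c \<tau> K \<phi>h f"
  shows "u \<in> vpoly_space c p" "\<phi> \<in> poly_space c p"
    "\<And>v. v \<in> vpoly_space c p \<Longrightarrow> \<i> * k * vip K u v - ip K \<phi> (divg v) = - bip K \<phi>h (\<lambda>F x. hdot (v x) (cvec (outward_normal K F)))"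
    "\<And>\<psi>. \<psi> \<in> poly_space c p \<Longrightarrow> - ip K (divg u) \<psi> - \<tau> * bip K (\<lambda>F. \<phi>) (\<lambda>F. \<psi>) - \<i> * k * ip K \<phi> \<psi>
      = - (\<tau> * bip K \<phi>h (\<lambda>F. \<psi>)) - ip K f \<psi>"
  using assms unfolding helmholtz_solutions_def by (simp_all add: Let_def bip_scale_left)

text \<open>Here the first equation, tested with \<open>u\<close>, is the one to be conjugated.
  Accordingly \<alpha> is the squared norm of \<phi> and \<beta> that of \<open>u\<close>, which
  gives the identity the same form as in \<open>maxwell_energy\<close>, so that the sign arguments
  can be shared.\<close>

lemma helmholtz_energy:
  assumes K: "polycell K" and sol: "(u, \<phi>) \<in> helmholtz_solutions k p c \<tau> K \<Lambda> (\<lambda>x. 0)" and \<Lambda>: "fcont K \<Lambda>"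
  obtains \<alpha> \<beta> \<gamma> :: real where "\<alpha> \<ge> 0" "\<beta> \<ge> 0" "\<gamma> \<ge> 0"
    "\<i> * k * \<alpha> - \<i> * cnj k * \<beta> + \<tau> * \<gamma>
      + bip K (\<lambda>F x. hdot (u x) (cvec (outward_normal K F)) + \<tau> * (\<phi> x - \<Lambda> F x)) \<Lambda> = 0"
    "\<alpha> = 0 \<Longrightarrow> \<phi> = (\<lambda>x. 0)" "\<beta> = 0 \<Longrightarrow> u = (\<lambda>x. 0)"
    "\<gamma> = 0 \<Longrightarrow> \<forall>F\<in>faces K. \<forall>x\<in>F. \<phi> x - \<Lambda> F x = 0"
proof -
  let ?n = "\<lambda>F. cvec (outward_normal K F)"
  note S = helmholtz_solutionsD[OF sol]
  obtain \<beta> where \<beta>: "\<beta> \<ge> 0" "vip K u u = of_real \<beta>" "\<beta> = 0 \<Longrightarrow> u = (\<lambda>x. 0)"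
    using vip_self[OF K S(1)] by blast
  obtain \<alpha> where \<alpha>: "\<alpha> \<ge> 0" "ip K \<phi> \<phi> = of_real \<alpha>" "\<alpha> = 0 \<Longrightarrow> \<phi> = (\<lambda>x. 0)"
    using ip_self[OF K S(2)] by blast
  let ?D = "\<lambda>F x. \<phi> x - \<Lambda> F x" and ?un = "\<lambda>F x. hdot (u x) (?n F)"
  note c\<phi> = fcont_poly[OF S(2), of K] and cu = fcont_vpoly[OF S(1), of K]
  have cD: "fcont K ?D" by (intro fcont_diff c\<phi> \<Lambda>)
  have cun: "fcont K ?un" by (intro fcont_hdot fcont_const cu)
  obtain \<gamma> where \<gamma>: "\<gamma> \<ge> 0" "bip K ?D ?D = of_real \<gamma>" "\<gamma> = 0 \<Longrightarrow> \<forall>F\<in>faces K. \<forall>x\<in>F. ?D F x = 0"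
    using bip_self[OF K cD] by blast
  have D: "?D = (\<lambda>F x. (-1) * \<Lambda> F x + \<phi> x)" by (intro ext) simp
  have Dl: "bip K ?D v = bip K (\<lambda>F. \<phi>) v - bip K \<Lambda> v" if "fcont K v" for v
    unfolding D bip_lin_left[OF K \<Lambda> c\<phi> that] by simp
  have Dr: "bip K ?D ?D = bip K ?D (\<lambda>F. \<phi>) - bip K ?D \<Lambda>"
    using bip_lin_right[OF K \<Lambda> c\<phi> cD, of "- 1"] unfolding D[symmetric] by simp
  have e1: "- ip K (divg u) \<phi> - \<tau> * bip K ?D (\<lambda>F. \<phi>) - \<i> * k * \<alpha> = 0"
    using S(4)[OF S(2)] by (simp add: \<alpha>(2) ip_zero Dl[OF c\<phi>] algebra_simps)
  have e2: "cnj (\<i> * k * vip K u u - ip K \<phi> (divg u)) = cnj (- bip K \<Lambda> ?un)"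
    using S(3)[OF S(1)] by (rule arg_cong)
  have e3: "\<i> * cnj k * \<beta> + ip K (divg u) \<phi> = cnj (bip K \<Lambda> ?un)"
  proof -
    have "- (\<i> * cnj k * \<beta>) - ip K (divg u) \<phi> = - cnj (bip K \<Lambda> ?un)"
      using e2 by (simp add: \<beta>(2) ip_cnj)
    from arg_cong[OF this, of uminus] show ?thesis by (simp add: add.commute)
  qed
  have flux: "bip K (\<lambda>F x. ?un F x + \<tau> * ?D F x) \<Lambda> = cnj (bip K \<Lambda> ?un) + \<tau> * bip K ?D \<Lambda>"
  proof -
    have "bip K (\<lambda>F x. \<tau> * ?D F x + ?un F x) \<Lambda> = \<tau> * bip K ?D \<Lambda> + bip K ?un \<Lambda>"
      by (rule bip_lin_left[OF K cD cun \<Lambda>])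
    moreover have "bip K ?un \<Lambda> = cnj (bip K \<Lambda> ?un)"
      by (simp add: bip_fint fint_cnj[symmetric] mult.commute)
    ultimately show ?thesis by (simp add: add.commute)
  qed
  have "\<i> * k * \<alpha> - \<i> * cnj k * \<beta> + \<tau> * \<gamma> + bip K (\<lambda>F x. ?un F x + \<tau> * ?D F x) \<Lambda> = 0"
  proof -
    have "x - y + \<tau> * g + \<Phi> = 0" if "- X - \<tau> * P - x = 0" "y + X = R" "\<Phi> = R + \<tau> * Q" "g = P - Q"
      for x y g \<Phi> X P R Q using that by algebra
    from this[OF e1 e3 flux Dr[unfolded \<gamma>(2)]] show ?thesis .
  qed
  then show ?thesis using that \<alpha> \<beta> \<gamma> by blast
qed

lemma poly_orthogonal_zero:
  assumes K: "polycell K" and u: "u \<in> poly_space c p" "w \<in> poly_space c p"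
    and eq: "\<And>v. v \<in> poly_space c p \<Longrightarrow> a * ip K u v = ip K w v"
  shows "w = (\<lambda>x. a * u x)"
proof -
  let ?d = "\<lambda>x. (- a) * u x + w x"
  have d: "?d \<in> poly_space c p" by (intro poly_space_add poly_space_scale u)
  obtain r where r: "ip K ?d ?d = of_real r" "r = 0 \<Longrightarrow> ?d = (\<lambda>x. 0)"
    using ip_self[OF K d] by blast
  have "ip K ?d ?d = (- a) * ip K u ?d + ip K w ?d"
    by (rule ip_lin_left[OF K continuous_poly[OF u(1)] continuous_poly[OF u(2)] continuous_poly[OF d]])
  then have "ip K ?d ?d = 0" using eq[OF d] by simp
  then have "?d = (\<lambda>x. 0)" using r by simp
  then show ?thesis by (simp add: fun_eq_iff add_eq_0_iff)
qed

lemma grad_divg_eigen_zero: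
  assumes a: "a \<noteq> 0" "b \<noteq> 0" and E: "grad \<phi> = (\<lambda>x. a *s u x)" "divg u = (\<lambda>x. b * \<phi> x)"
    and d: "u \<in> vpoly_space Simplicial d" "\<phi> \<in> poly_space Simplicial d"
  shows "u = (\<lambda>x. 0) \<and> \<phi> = (\<lambda>x. 0)"
proof -
  have eq: "u = (\<lambda>x. inverse a *s grad \<phi> x)" "\<phi> = (\<lambda>x. inverse b * divg u x)"
    unfolding E using a by (simp_all add: fun_eq_iff vec_eq_iff)
  show ?thesis using d
  proof (induction d)
    case 0
    have "grad \<phi> x = 0" "divg u x = 0" for x
      using fun_cong[OF grad_Simplicial_0[OF 0(2)], of x] fun_cong[OF divg_Simplicial_0[OF 0(1)], of x] by simp_all
    then have "u x = 0 \<and> \<phi> x = 0" for x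
      using fun_cong[OF eq(1), of x] fun_cong[OF eq(2), of x] by (simp add: vec_eq_iff)
    then show ?case by (simp add: fun_eq_iff)
  next
    case (Suc d)
    have "u \<in> vpoly_space Simplicial d" by (subst eq(1)) (intro vpoly_smult grad_Simplicial_Suc Suc.prems)
    moreover have "\<phi> \<in> poly_space Simplicial d" by (subst eq(2)) (intro poly_space_scale divg_Simplicial_Suc Suc.prems)
    ultimately show ?case by (rule Suc.IH)
  qed
qed

lemma helmholtz_matching_trace_zero:
  assumes K: "polycell (K :: (real^2) set)" and k: "k \<noteq> 0" and sol: "(u, \<phi>) \<in> helmholtz_solutions k p c \<tau> K \<Lambda> (\<lambda>x. 0)"
    and trace: "\<And>F x. F \<in> faces K \<Longrightarrow> x \<in> F \<Longrightarrow> \<phi> x - \<Lambda> F x = 0"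
  shows "u = (\<lambda>x. 0) \<and> \<phi> = (\<lambda>x. 0)"
proof -
  note S = helmholtz_solutionsD[OF sol]
  have eq: "\<Lambda> F x = \<phi> x" if "F \<in> faces K" "x \<in> F" for F x
    using trace[OF that] by simp
  have b: "bip K \<Lambda> v = bip K (\<lambda>F. \<phi>) v" for v
    unfolding bip_fint by (rule fint_cong) (simp only: eq)
  have "(- \<i> * k) * ip K \<phi> \<psi> = ip K (divg u) \<psi>" if \<psi>: "\<psi> \<in> poly_space c p" for \<psi>
  proof -
    have "- ip K (divg u) \<psi> = \<i> * k * ip K \<phi> \<psi>" using S(4)[OF \<psi>] by (simp add: b ip_zero)
    from arg_cong[OF this, of uminus] show ?thesis by simp
  qed
  then have c1: "divg u = (\<lambda>x. (- \<i> * k) * \<phi> x)"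
    by (rule poly_orthogonal_zero[OF K S(2) divg_poly[OF S(1)]])
  have "(- \<i> * k) * vip K u v = vip K (grad \<phi>) v" if v: "v \<in> vpoly_space c p" for v
  proof -
    have "\<i> * k * vip K u v = - vip K (grad \<phi>) v"
      using S(3)[OF v] divg_by_parts[OF K S(2) v] by (simp add: b eq_neg_iff_add_eq_0)
    from arg_cong[OF this, of uminus] show ?thesis by simp
  qed
  then have c2: "grad \<phi> = (\<lambda>x. (- \<i> * k) *s u x)"
    by (rule vpoly_orthogonal_zero[OF K S(1) grad_vpoly[OF S(2)]])
  have d: "u \<in> vpoly_space Simplicial (CARD(2) * p)" "\<phi> \<in> poly_space Simplicial (CARD(2) * p)"
    by (rule vpoly_spaceI, rule poly_space_subset_Simplicial, rule vpoly_spaceD[OF S(1)])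
      (rule poly_space_subset_Simplicial[OF S(2)])
  show ?thesis by (rule grad_divg_eigen_zero[OF _ _ c2 c1 d]) (use k in simp_all)
qed

lemma helmholtz_homogeneous_zero:
  assumes K: "polycell (K :: (real^2) set)" and k: "k \<noteq> 0" and stab: "stab_condition k \<tau>"
    and sol: "(u, \<phi>) \<in> helmholtz_solutions k p c \<tau> K (\<lambda>F x. 0) (\<lambda>x. 0)"
  shows "u = (\<lambda>x. 0) \<and> \<phi> = (\<lambda>x. 0)"
proof -
  have z: "fcont K (\<lambda>F x. 0 :: complex)" by (simp add: fcont_def)
  obtain \<alpha> \<beta> \<gamma> :: real where nn: "\<alpha> \<ge> 0" "\<beta> \<ge> 0" "\<gamma> \<ge> 0"
    and id: "\<i> * k * \<alpha> - \<i> * cnj k * \<beta> + \<tau> * \<gamma>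
      + bip K (\<lambda>F x. hdot (u x) (cvec (outward_normal K F)) + \<tau> * (\<phi> x - 0)) (\<lambda>F x. 0) = 0"
    and zero: "\<alpha> = 0 \<Longrightarrow> \<phi> = (\<lambda>x. 0)" "\<beta> = 0 \<Longrightarrow> u = (\<lambda>x. 0)"
      "\<gamma> = 0 \<Longrightarrow> \<forall>F\<in>faces K. \<forall>x\<in>F. \<phi> x - 0 = 0"
    using helmholtz_energy[OF K sol z] by blast
  have "- Im k * (\<alpha> + \<beta>) + Re \<tau> * \<gamma> = 0"
    using arg_cong[OF id, of Re] by (simp add: bip_zero algebra_simps)
  note en = stab_energy[OF stab nn this]
  show ?thesis
  proof (cases "Im k = 0")
    case True
    show ?thesis by (rule helmholtz_matching_trace_zero[OF K k sol]) (use zero(3) en(1)[OF True] in blast)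
  next
    case False
    show ?thesis using en(2)[OF False] zero(1,2) by blast
  qed
qed

definition helmholtz_lhs :: "complex \<Rightarrow> complex \<Rightarrow> (real^2) set \<Rightarrow> (real^2 \<Rightarrow> complex^2) \<Rightarrow> (real^2 \<Rightarrow> complex)
    \<Rightarrow> (real^2 \<Rightarrow> complex^2) \<Rightarrow> (real^2 \<Rightarrow> complex) \<Rightarrow> complex" where
  "helmholtz_lhs k \<tau> K u \<phi> v \<psi> = (\<i> * k * vip K u v - ip K \<phi> (divg v))
    + (- ip K (divg u) \<psi> - \<tau> * bip K (\<lambda>F. \<phi>) (\<lambda>F. \<psi>) - \<i> * k * ip K \<phi> \<psi>)"

definition helmholtz_rhs :: "complex \<Rightarrow> (real^2) set \<Rightarrow> ((real^2) set \<Rightarrow> real^2 \<Rightarrow> complex) \<Rightarrow> (real^2 \<Rightarrow> complex)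
    \<Rightarrow> (real^2 \<Rightarrow> complex^2) \<Rightarrow> (real^2 \<Rightarrow> complex) \<Rightarrow> complex" where
  "helmholtz_rhs \<tau> K \<phi>h f v \<psi> = - bip K \<phi>h (\<lambda>F x. hdot (v x) (cvec (outward_normal K F)))
    + (- (\<tau> * bip K \<phi>h (\<lambda>F. \<psi>)) - ip K f \<psi>)"

lemma helmholtz_solutions_iff:
  "(u, \<phi>) \<in> helmholtz_solutions k p c \<tau> K \<phi>h f \<longleftrightarrow> u \<in> vpoly_space c p \<and> \<phi> \<in> poly_space c p \<and>
    (\<forall>v\<in>vpoly_space c p. \<forall>\<psi>\<in>poly_space c p. helmholtz_lhs k \<tau> K u \<phi> v \<psi> = helmholtz_rhs \<tau> K \<phi>h f v \<psi>)"
    (is "?S \<longleftrightarrow> ?E \<and> ?H \<and> ?eq")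
proof -
  let ?l1 = "\<lambda>v. \<i> * k * vip K u v - ip K \<phi> (divg v)"
  let ?l2 = "\<lambda>\<psi>. - ip K (divg u) \<psi> - \<tau> * bip K (\<lambda>F. \<phi>) (\<lambda>F. \<psi>) - \<i> * k * ip K \<phi> \<psi>"
  let ?r1 = "\<lambda>v. - bip K \<phi>h (\<lambda>F x. hdot (v x) (cvec (outward_normal K F)))"
  let ?r2 = "\<lambda>\<psi>. - (\<tau> * bip K \<phi>h (\<lambda>F. \<psi>)) - ip K f \<psi>"
  have S: "?S \<longleftrightarrow> ?E \<and> ?H \<and> (\<forall>v\<in>vpoly_space c p. ?l1 v = ?r1 v) \<and> (\<forall>\<psi>\<in>poly_space c p. ?l2 \<psi> = ?r2 \<psi>)"
    unfolding helmholtz_solutions_def by (simp add: Let_def bip_scale_left)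
  have eq: "?eq \<longleftrightarrow> (\<forall>v\<in>vpoly_space c p. \<forall>\<psi>\<in>poly_space c p. ?l1 v + ?l2 \<psi> = ?r1 v + ?r2 \<psi>)"
    unfolding helmholtz_lhs_def helmholtz_rhs_def ..
  have z: "?l1 (\<lambda>x. 0) = 0" "?r1 (\<lambda>x. 0) = 0" "?l2 (\<lambda>x. 0) = 0" "?r2 (\<lambda>x. 0) = 0"
    by (simp_all add: vip_zero ip_zero bip_zero divg_zero)
  have "(\<forall>v\<in>vpoly_space c p. \<forall>\<psi>\<in>poly_space c p. ?l1 v + ?l2 \<psi> = ?r1 v + ?r2 \<psi>)
      \<longleftrightarrow> (\<forall>v\<in>vpoly_space c p. ?l1 v = ?r1 v) \<and> (\<forall>\<psi>\<in>poly_space c p. ?l2 \<psi> = ?r2 \<psi>)" (is "?A \<longleftrightarrow> ?B")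
  proof
    assume A: ?A
    have "?l1 v = ?r1 v" if "v \<in> vpoly_space c p" for v
      using A[rule_format, OF that poly_space_0] unfolding z by simp
    moreover have "?l2 \<psi> = ?r2 \<psi>" if "\<psi> \<in> poly_space c p" for \<psi>
      using A[rule_format, OF vpoly_0 that] unfolding z by simp
    ultimately show ?B by blast
  next
    assume B: ?B
    show ?A using B[THEN conjunct1, rule_format] B[THEN conjunct2, rule_format] by (intro ballI) (rule arg_cong2[where f = "(+)"])
  qed
  then show ?thesis unfolding S eq by simp
qed

lemma helmholtz_lhs_lin_left:
  assumes K: "polycell K" and V: "u \<in> vpoly_space c p" "\<phi> \<in> poly_space c p" "u' \<in> vpoly_space c p" "\<phi>' \<in> poly_space c p"
    "v \<in> vpoly_space c p" "\<psi> \<in> poly_space c p"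
  shows "helmholtz_lhs k \<tau> K (\<lambda>x. a *s u x + u' x) (\<lambda>x. a * \<phi> x + \<phi>' x) v \<psi>
    = a * helmholtz_lhs k \<tau> K u \<phi> v \<psi> + helmholtz_lhs k \<tau> K u' \<phi>' v \<psi>"
proof -
  note c = continuous_vpoly[OF V(1)] continuous_poly[OF V(2)] continuous_vpoly[OF V(3)] continuous_poly[OF V(4)] continuous_vpoly[OF V(5)]
    continuous_poly[OF V(6)] continuous_poly[OF divg_poly[OF V(1)]] continuous_poly[OF divg_poly[OF V(3)]] continuous_poly[OF divg_poly[OF V(5)]]
  show ?thesis
    unfolding helmholtz_lhs_def divg_combination[OF V(1,3)]
    by (simp only: vip_lin_left[OF K] ip_lin_left[OF K] bip_lin_left[OF K] c fcont_poly[OF V(2)] fcont_poly[OF V(4)] fcont_poly[OF V(6)])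
      (simp add: algebra_simps)
qed

lemma helmholtz_lhs_lin_right:
  assumes K: "polycell K" and V: "u \<in> vpoly_space c p" "\<phi> \<in> poly_space c p" "v \<in> vpoly_space c p" "\<psi> \<in> poly_space c p"
    "v' \<in> vpoly_space c p" "\<psi>' \<in> poly_space c p"
  shows "helmholtz_lhs k \<tau> K u \<phi> (\<lambda>x. a *s v x + v' x) (\<lambda>x. a * \<psi> x + \<psi>' x)
    = cnj a * helmholtz_lhs k \<tau> K u \<phi> v \<psi> + helmholtz_lhs k \<tau> K u \<phi> v' \<psi>'"
proof -
  note c = continuous_vpoly[OF V(1)] continuous_poly[OF V(2)] continuous_vpoly[OF V(3)] continuous_poly[OF V(4)] continuous_vpoly[OF V(5)]
    continuous_poly[OF V(6)] continuous_poly[OF divg_poly[OF V(1)]] continuous_poly[OF divg_poly[OF V(3)]] continuous_poly[OF divg_poly[OF V(5)]]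
  show ?thesis
    unfolding helmholtz_lhs_def divg_combination[OF V(3,5)]
    by (simp only: vip_lin_right[OF K] ip_lin_right[OF K] bip_lin_right[OF K] c fcont_poly[OF V(2)] fcont_poly[OF V(4)] fcont_poly[OF V(6)])
      (simp add: algebra_simps)
qed

lemma helmholtz_rhs_lin:
  assumes K: "polycell K" and f: "square_integrable K f" and \<phi>h: "fcont K \<phi>h"
    and V: "v \<in> vpoly_space c p" "\<psi> \<in> poly_space c p" "v' \<in> vpoly_space c p" "\<psi>' \<in> poly_space c p"
  shows "helmholtz_rhs \<tau> K \<phi>h f (\<lambda>x. a *s v x + v' x) (\<lambda>x. a * \<psi> x + \<psi>' x)
    = cnj a * helmholtz_rhs \<tau> K \<phi>h f v \<psi> + helmholtz_rhs \<tau> K \<phi>h f v' \<psi>'"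
proof -
  have g: "fcont K (\<lambda>F x. hdot (v x) (cvec (outward_normal K F)))" "fcont K (\<lambda>F x. hdot (v' x) (cvec (outward_normal K F)))"
    by (intro fcont_hdot fcont_const fcont_vpoly[OF V(1)] fcont_vpoly[OF V(3)])+
  have f': "ip K f (\<lambda>x. a * \<psi> x + \<psi>' x) = cnj a * ip K f \<psi> + ip K f \<psi>'"
    by (intro ip_lin_right_integrable square_integrable_mult[OF K f] continuous_intros continuous_poly[OF V(2)] continuous_poly[OF V(4)])
  show ?thesis
    unfolding helmholtz_rhs_def hdot_add_left hdot_smult_left f'
    by (simp only: bip_lin_right[OF K] g \<phi>h fcont_poly[OF V(2)] fcont_poly[OF V(4)]) (simp add: algebra_simps)
qed

lemma fcont_face_poly:
  assumes "\<And>F. F \<in> faces K \<Longrightarrow> \<Lambda> F \<in> face_poly c p F"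
  shows "fcont K \<Lambda>"
  unfolding fcont_def
proof
  fix F assume "F \<in> faces K"
  then obtain q where "q \<in> poly_space c p" "\<forall>x\<in>F. \<Lambda> F x = q x" using assms unfolding face_poly_def by blast
  then show "continuous_on F (\<Lambda> F)" using continuous_poly continuous_on_cong by (metis (no_types, lifting))
qed

theorem helmholtz_local_unisolvent:
  assumes K: "polycell (K :: (real^2) set)" and k: "k \<noteq> 0" and stab: "stab_condition k \<tau>"
    and \<phi>h: "\<And>F. F \<in> faces K \<Longrightarrow> \<phi>h F \<in> face_poly c p F" and f: "square_integrable K f"
  shows "\<exists>!X. X \<in> helmholtz_solutions k p c \<tau> K \<phi>h f"
proof -
  \<comment> \<open>In the index set \<open>2 option\<close>, \<open>None\<close> stands for the
    scalar unknown and \<open>Some i\<close> for the components of the vector field.\<close>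
  let ?u = "\<lambda>(g :: (2 option) \<times> (real^2) \<Rightarrow> complex) x. \<chi> i. g (Some i, x)"
  let ?s = "\<lambda>(g :: (2 option) \<times> (real^2) \<Rightarrow> complex) x. g (None, x)"
  let ?V = "{g :: (2 option) \<times> (real^2) \<Rightarrow> complex. \<forall>m. (\<lambda>x. g (m, x)) \<in> poly_space c p}"
  let ?enc = "\<lambda>(v :: real^2 \<Rightarrow> complex^2) (w :: real^2 \<Rightarrow> complex) z. case fst z of None \<Rightarrow> w (snd z) | Some i \<Rightarrow> v (snd z) $ i"
  have EV: "?u g \<in> vpoly_space c p" "?s g \<in> poly_space c p" if "g \<in> ?V" for g
    using that by (simp_all add: vpoly_space_def)
  have lin: "?u (\<lambda>z. a * g z + h z) = (\<lambda>x. a *s ?u g x + ?u h x)" for a g h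
    by (simp_all add: fun_eq_iff vec_eq_iff)
  have enc: "?enc v w \<in> ?V" if "v \<in> vpoly_space c p" "w \<in> poly_space c p" for v w
  proof -
    have "(\<lambda>x. ?enc v w (m, x)) \<in> poly_space c p" for m
      using vpoly_spaceD[OF that(1)] that(2) by (cases m) simp_all
    then show ?thesis by (simp only: mem_Collect_eq) blast
  qed
  have Eenc: "?u (?enc v w) = v" "?s (?enc v w) = w" for v w
    by (simp_all add: fun_eq_iff vec_eq_iff)
  have c\<phi>h: "fcont K \<phi>h" by (rule fcont_face_poly[OF \<phi>h])
  have "\<exists>g\<in>?V. \<forall>h\<in>?V. helmholtz_lhs k \<tau> K (?u g) (?s g) (?u h) (?s h) = helmholtz_rhs \<tau> K \<phi>h f (?u h) (?s h)"
  proof (rule poly_tuple_problem_solvable[where B = "\<lambda>g h. helmholtz_lhs k \<tau> K (?u g) (?s g) (?u h) (?s h)" and l = "\<lambda>h. helmholtz_rhs \<tau> K \<phi>h f (?u h) (?s h)"])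
    fix a f g h assume V: "f \<in> ?V" "g \<in> ?V" "h \<in> ?V"
    show "helmholtz_lhs k \<tau> K (?u (\<lambda>x. a * f x + g x)) (?s (\<lambda>x. a * f x + g x)) (?u h) (?s h)
        = a * helmholtz_lhs k \<tau> K (?u f) (?s f) (?u h) (?s h) + helmholtz_lhs k \<tau> K (?u g) (?s g) (?u h) (?s h)"
      unfolding lin by (rule helmholtz_lhs_lin_left[OF K EV(1)[OF V(1)] EV(2)[OF V(1)] EV(1)[OF V(2)] EV(2)[OF V(2)] EV(1)[OF V(3)] EV(2)[OF V(3)]])
    show "helmholtz_lhs k \<tau> K (?u h) (?s h) (?u (\<lambda>x. a * f x + g x)) (?s (\<lambda>x. a * f x + g x))
        = cnj a * helmholtz_lhs k \<tau> K (?u h) (?s h) (?u f) (?s f) + helmholtz_lhs k \<tau> K (?u h) (?s h) (?u g) (?s g)"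
      unfolding lin by (rule helmholtz_lhs_lin_right[OF K EV(1)[OF V(3)] EV(2)[OF V(3)] EV(1)[OF V(1)] EV(2)[OF V(1)] EV(1)[OF V(2)] EV(2)[OF V(2)]])
  next
    fix a g h assume V: "g \<in> ?V" "h \<in> ?V"
    show "helmholtz_rhs \<tau> K \<phi>h f (?u (\<lambda>x. a * g x + h x)) (?s (\<lambda>x. a * g x + h x))
        = cnj a * helmholtz_rhs \<tau> K \<phi>h f (?u g) (?s g) + helmholtz_rhs \<tau> K \<phi>h f (?u h) (?s h)"
      unfolding lin by (rule helmholtz_rhs_lin[OF K f c\<phi>h EV(1)[OF V(1)] EV(2)[OF V(1)] EV(1)[OF V(2)] EV(2)[OF V(2)]])
  next
    fix g assume g: "g \<in> ?V" and z: "\<And>h. h \<in> ?V \<Longrightarrow> helmholtz_lhs k \<tau> K (?u g) (?s g) (?u h) (?s h) = 0"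
    have "helmholtz_lhs k \<tau> K (?u g) (?s g) v w = helmholtz_rhs \<tau> K (\<lambda>F x. 0) (\<lambda>x. 0) v w"
      if vw: "v \<in> vpoly_space c p" "w \<in> poly_space c p" for v w
      using z[OF enc[OF vw]] unfolding Eenc by (simp add: helmholtz_rhs_def ip_zero bip_zero)
    then have "(?u g, ?s g) \<in> helmholtz_solutions k p c \<tau> K (\<lambda>F x. 0) (\<lambda>x. 0)"
      unfolding helmholtz_solutions_iff using EV[OF g] by blast
    then have "?u g = (\<lambda>x. 0) \<and> ?s g = (\<lambda>x. 0)" by (rule helmholtz_homogeneous_zero[OF K k stab])
    then have "g (m, x) = 0" for m x
      by (cases m) (simp_all add: fun_eq_iff vec_eq_iff)
    then show "g = (\<lambda>x. 0)" by (simp add: fun_eq_iff)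
  qed
  then obtain g where g: "g \<in> ?V" and eq: "\<And>h. h \<in> ?V \<Longrightarrow> helmholtz_lhs k \<tau> K (?u g) (?s g) (?u h) (?s h) = helmholtz_rhs \<tau> K \<phi>h f (?u h) (?s h)"
    by blast
  have "helmholtz_lhs k \<tau> K (?u g) (?s g) v w = helmholtz_rhs \<tau> K \<phi>h f v w"
    if vw: "v \<in> vpoly_space c p" "w \<in> poly_space c p" for v w
    using eq[OF enc[OF vw]] unfolding Eenc .
  then have ex: "(?u g, ?s g) \<in> helmholtz_solutions k p c \<tau> K \<phi>h f"
    unfolding helmholtz_solutions_iff using EV[OF g] by blast
  have un: "X = Y" if XY: "X \<in> helmholtz_solutions k p c \<tau> K \<phi>h f" "Y \<in> helmholtz_solutions k p c \<tau> K \<phi>h f" for X Y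
  proof -
    obtain u \<phi> u' \<phi>' where X: "X = (u, \<phi>)" and Y: "Y = (u', \<phi>')" by (cases X, cases Y)
    have V: "u \<in> vpoly_space c p" "\<phi> \<in> poly_space c p" "u' \<in> vpoly_space c p" "\<phi>' \<in> poly_space c p"
      and eqs: "\<And>v w. v \<in> vpoly_space c p \<Longrightarrow> w \<in> poly_space c p \<Longrightarrow> helmholtz_lhs k \<tau> K u \<phi> v w = helmholtz_rhs \<tau> K \<phi>h f v w"
        "\<And>v w. v \<in> vpoly_space c p \<Longrightarrow> w \<in> poly_space c p \<Longrightarrow> helmholtz_lhs k \<tau> K u' \<phi>' v w = helmholtz_rhs \<tau> K \<phi>h f v w"
      using XY unfolding X Y helmholtz_solutions_iff by simp_all
    let ?d = "\<lambda>x. (-1) *s u x + u' x" and ?e = "\<lambda>x. (-1) * \<phi> x + \<phi>' x"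
    have "helmholtz_lhs k \<tau> K ?d ?e v w = helmholtz_rhs \<tau> K (\<lambda>F x. 0) (\<lambda>x. 0) v w"
      if vw: "v \<in> vpoly_space c p" "w \<in> poly_space c p" for v w
      unfolding helmholtz_lhs_lin_left[OF K V vw] eqs(1)[OF vw] eqs(2)[OF vw]
      by (simp add: helmholtz_rhs_def ip_zero bip_zero)
    moreover have "?d \<in> vpoly_space c p" by (intro vpoly_add vpoly_smult V)
    moreover have "?e \<in> poly_space c p" by (intro poly_space_add poly_space_scale V)
    ultimately have "(?d, ?e) \<in> helmholtz_solutions k p c \<tau> K (\<lambda>F x. 0) (\<lambda>x. 0)"
      unfolding helmholtz_solutions_iff by blast
    then have "?d = (\<lambda>x. 0) \<and> ?e = (\<lambda>x. 0)" by (rule helmholtz_homogeneous_zero[OF K k stab])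
    then show "X = Y" unfolding X Y by (simp add: fun_eq_iff vec_eq_iff)
  qed
  show ?thesis using ex un by blast
qed

text \<open>
  Summing the divergence theorem for the field \<open>x \<mapsto> x $ i\<close> over the patch, the face terms cancel
  in pairs, so the patch has measure zero.
\<close>

lemma closed_patch_empty:
  fixes \<T> :: "(real^'n::{finite,wellorder}) set set"
  assumes mesh: "is_mesh c \<Omega> \<T>" and B: "B \<subseteq> \<T>"
    and nb: "\<And>K F. K \<in> B \<Longrightarrow> F \<in> faces K \<Longrightarrow> outward_normal K F $ i \<noteq> 0 \<Longrightarrow> \<exists>L\<in>B. L \<noteq> K \<and> F \<in> faces L"
  shows "B = {}"
proof -
  have finB: "finite B" using B meshD(2)[OF mesh] by (rule finite_subset)
  have pc: "polycell K" if "K \<in> B" for K using that B by (intro mesh_polycell[OF mesh]) blast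
  define s where "s F = (LINT x:F|face_measure F. complex_of_real (x $ i))" for F :: "(real^'n::_) set"
  have d: "((\<lambda>x::real^'n::_. complex_of_real (x $ i)) has_derivative (\<lambda>h. of_real (h $ i))) (at x)" for x
    by (intro bounded_linear_imp_has_derivative bounded_linear_compose[OF bounded_linear_of_real] bounded_linear_vec_nth)
  \<comment> \<open>The coordinate \<open>x $ i\<close> has derivative 1 in the direction
    \<open>axis i 1\<close>, so the cell side of the divergence theorem is the volume.\<close>
  have vol: "cint K (\<lambda>x. 1) = (\<Sum>F\<in>faces K. of_real (outward_normal K F $ i) * s F)" if K: "K \<in> B" for K
  proof -
    have "axis i (1::real) $ i = 1" by (simp add: axis_def)
    moreover have "cint K (\<lambda>x. of_real (axis i (1::real) $ i)) = (\<Sum>F\<in>faces K. (outward_normal K F \<bullet> axis i 1) *\<^sub>R s F)"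
      unfolding cint_def s_def by (rule polycell_divergence[OF pc[OF K] d]) simp
    ultimately show ?thesis by (simp add: inner_axis scaleR_conv_of_real)
  qed
  define P where "P = (SIGMA K:B. {F \<in> faces K. outward_normal K F $ i \<noteq> 0})"
  define g where "g z = of_real (outward_normal (fst z) (snd z) $ i) * s (snd z)" for z
  have "\<exists>L. L \<in> B \<and> L \<noteq> fst z \<and> snd z \<in> faces L" if "z \<in> P" for z
    using nb[of "fst z" "snd z"] that by (auto simp: P_def)
  then obtain N where N: "\<And>z. z \<in> P \<Longrightarrow> N z \<in> B \<and> N z \<noteq> fst z \<and> snd z \<in> faces (N z)"
    by metis
  \<comment> \<open>Passes from a cell with a chosen face to the neighbour across that face. As a
    face has at most two cells, \<open>j\<close> is an involution, and it reverses the sign of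
    \<open>g\<close> because the normals are opposite.\<close>
  define j where "j z = (N z, snd z)" for z
  have P: "fst z \<in> B" "snd z \<in> faces (fst z)" "outward_normal (fst z) (snd z) $ i \<noteq> 0" if "z \<in> P" for z
    using that by (auto simp: P_def)
  have opp: "outward_normal (N z) (snd z) = - outward_normal (fst z) (snd z)" if z: "z \<in> P" for z
    using N[OF z] P[OF z] B by (intro mesh_opposite_normal[OF mesh]) auto
  have jP: "j z \<in> P" if z: "z \<in> P" for z
    using N[OF z] P[OF z] opp[OF z] by (simp add: P_def j_def)
  have jj: "j (j z) = z" if z: "z \<in> P" for z
  proof -
    have n: "N z \<in> B" "N z \<noteq> fst z" "snd z \<in> faces (N z)" using N[OF z] by simp_all
    have m: "N (j z) \<in> B" "N (j z) \<noteq> N z" "snd z \<in> faces (N (j z))" using N[OF jP[OF z]] by (simp_all add: j_def)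
    have "N (j z) = fst z"
      by (rule mesh_face_two_cells[OF mesh, of "N z" _ _ "snd z"]) (use n m P[OF z] B in auto)
    then show ?thesis by (simp add: j_def prod_eq_iff)
  qed
  have "(\<Sum>z\<in>P. g z) = (\<Sum>z\<in>P. - g z)"
  proof (rule sum.reindex_bij_witness[of P j j])
    fix z assume z: "z \<in> P"
    show "j (j z) = z" "j (j z) = z" "j z \<in> P" "j z \<in> P" using jj[OF z] jP[OF z] by simp_all
    show "- g (j z) = g z" using opp[OF z] by (simp add: g_def j_def)
  qed
  then have "(\<Sum>z\<in>P. g z) = - (\<Sum>z\<in>P. g z)" unfolding sum_negf .
  then have gP: "(\<Sum>z\<in>P. g z) = 0" by simp
  have vol0: "(\<Sum>K\<in>B. cint K (\<lambda>x. 1)) = 0"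
  proof -
    have "(\<Sum>K\<in>B. cint K (\<lambda>x. 1)) = (\<Sum>K\<in>B. \<Sum>F\<in>{F \<in> faces K. outward_normal K F $ i \<noteq> 0}. g (K, F))"
    proof (rule sum.cong[OF refl])
      fix K assume K: "K \<in> B"
      have "(\<Sum>F\<in>{F \<in> faces K. outward_normal K F $ i \<noteq> 0}. g (K, F)) = (\<Sum>F\<in>faces K. of_real (outward_normal K F $ i) * s F)"
        by (rule sum.mono_neutral_cong_left) (auto simp: g_def finite_faces[OF pc[OF K]])
      then show "cint K (\<lambda>x. 1) = (\<Sum>F\<in>{F \<in> faces K. outward_normal K F $ i \<noteq> 0}. g (K, F))"
        using vol[OF K] by simp
    qed
    also have "\<dots> = (\<Sum>z\<in>P. g z)"
      unfolding P_def by (subst sum.Sigma) (use finB finite_faces[OF pc] in auto)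
    finally show ?thesis using gP by simp
  qed
  have "\<exists>r. r > 0 \<and> cint K (\<lambda>x. 1) = of_real r" if K: "K \<in> B" for K
  proof -
    have one: "continuous_on UNIV (\<lambda>x::real^'n::_. 1 :: real)" by simp
    obtain r where r: "r \<ge> 0" "cint K (\<lambda>x. of_real 1) = of_real r" "r = 0 \<Longrightarrow> \<forall>x\<in>K. (1::real) = 0"
      using cint_nonneg[OF pc[OF K] one] by auto
    have "K \<noteq> {}" using pc[OF K] by (simp add: polycell_def)
    then have "r \<noteq> 0" using r(3) by auto
    then show ?thesis using r by (intro exI[of _ r]) auto
  qed
  then obtain r where r: "\<And>K. K \<in> B \<Longrightarrow> r K > 0" "\<And>K. K \<in> B \<Longrightarrow> cint K (\<lambda>x. 1) = of_real (r K)"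
    by metis
  have "complex_of_real (\<Sum>K\<in>B. r K) = (\<Sum>K\<in>B. cint K (\<lambda>x. 1))"
    unfolding of_real_sum by (rule sum.cong) (simp_all add: r(2))
  then have "(\<Sum>K\<in>B. r K) = 0" unfolding vol0 by (simp only: of_real_eq_0_iff)
  then show "B = {}" using sum_pos[of B r] finB r(1) by force
qed

text \<open>A relative interior point of \<open>F\<close> is not in the open box, so one of its
  coordinates is extreme. The face of the box on which that coordinate is extreme then contains all
  of \<open>F\<close>, which makes \<open>axis j 1\<close> a unit normal of
  \<open>F\<close>.\<close>

lemma cube_normal:
  assumes h: "0 < h" and K: "K = box a (\<chi> i. a $ i + h)" and pc: "polycell (K :: (real^'n) set)" and F: "F \<in> faces K"
  obtains j where "outward_normal K F = axis j 1 \<or> outward_normal K F = - axis j 1"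
proof -
  let ?b = "\<chi> i. a $ i + h"
  obtain x where x: "x \<in> rel_interior F"
    using face_nonempty[OF pc F] convex_face[OF F] rel_interior_eq_empty by blast
  have xF: "x \<in> F" using x rel_interior_subset by blast
  have "K \<noteq> {}" using pc by (simp add: polycell_def)
  then have cl: "closure K = cbox a ?b" unfolding K by (rule closure_box)
  have FK: "F \<subseteq> cbox a ?b" using face_eq[OF pc F] cl by blast
  have "outward_normal K F \<bullet> x = face_offset K F" using face_eq[OF pc F] xF by blast
  then have "x \<notin> K" using cell_below_face[OF pc F, of x] by auto
  moreover have xb: "x \<in> cbox a ?b" using xF FK by blast
  ultimately obtain j where "\<not> (a $ j < x $ j \<and> x $ j < a $ j + h)" "a $ j \<le> x $ j" "x $ j \<le> a $ j + h"
    unfolding K mem_box_cart vec_lambda_beta by blast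
  then have j: "x $ j = a $ j \<or> x $ j = a $ j + h" by linarith
  have flat: "\<forall>y\<in>F. y $ j = d"
    if face: "(cbox a ?b \<inter> {y. axis j 1 \<bullet> y = d}) face_of cbox a ?b" and xd: "x $ j = d" for d
  proof -
    have "axis j 1 \<bullet> x = d" using xd by (simp add: inner_axis')
    then have "x \<in> cbox a ?b \<inter> {y. axis j 1 \<bullet> y = d}" using xb by blast
    then have "(cbox a ?b \<inter> {y. axis j 1 \<bullet> y = d}) \<inter> rel_interior F \<noteq> {}" using x by blast
    then have "F \<subseteq> cbox a ?b \<inter> {y. axis j 1 \<bullet> y = d}" by (rule subset_of_face_of[OF face FK])
    then have "F \<subseteq> {y. axis j 1 \<bullet> y = d}" by blast
    then show ?thesis by (simp add: subset_iff inner_axis')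
  qed
  have box: "a $ j \<le> axis j 1 \<bullet> y" "axis j 1 \<bullet> y \<le> a $ j + h" if "y \<in> cbox a ?b" for y
    using that by (simp_all add: mem_box_cart inner_axis')
  have "\<exists>d. \<forall>y\<in>F. y $ j = d"
  proof (cases "x $ j = a $ j")
    case True
    show ?thesis
      by (rule exI, rule flat[OF face_of_Int_supporting_hyperplane_ge True]) (rule convex_box(1), rule box(1))
  next
    case False
    then have xj: "x $ j = a $ j + h" using j by simp
    show ?thesis
      by (rule exI, rule flat[OF face_of_Int_supporting_hyperplane_le xj]) (rule convex_box(1), rule box(2))
  qed
  then obtain d where d: "\<And>y. y \<in> F \<Longrightarrow> y $ j = d" by blast
  have "unit_normal F (axis j 1)"
    unfolding unit_normal_def using d by (simp add: inner_axis')
  then have "axis j 1 = outward_normal K F \<or> axis j 1 = - outward_normal K F"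
    by (rule unit_normal_unique[OF affine_hull_face[OF pc F] norm_outward_normal[OF pc F]])
  then have "outward_normal K F = axis j 1 \<or> outward_normal K F = - axis j 1"
    by (metis minus_minus)
  then show ?thesis by (rule that)
qed

text \<open>Each facet is the hull of the vertices with one of them left out.\<close>

lemma simplex_card_faces:
  assumes S: "int CARD('n) simplex S" and K: "K = interior S" and pc: "polycell (K :: (real^'n) set)"
  shows "card (faces K) \<le> CARD('n) + 1"
proof -
  obtain C where C: "\<not> affine_dependent C" "int (card C) = int CARD('n) + 1" "S = convex hull C"
    using S unfolding simplex_def by blast
  have fin: "finite C" using C(1) aff_independent_finite by blast
  have "closed S" unfolding C(3) using fin by (simp add: finite_imp_compact_convex_hull compact_imp_closed)
  moreover have "convex S" unfolding C(3) by (rule convex_convex_hull)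
  ultimately have "closure K = S"
    using K pc convex_closure_interior[of S] by (auto simp: polycell_def)
  then have "faces K \<subseteq> (\<lambda>u. convex hull (C - {u})) ` C"
    unfolding faces_def C(3) using facet_of_convex_hull_affine_independent[OF C(1)] by auto
  then have "card (faces K) \<le> card ((\<lambda>u. convex hull (C - {u})) ` C)"
    using fin by (intro card_mono) auto
  also have "\<dots> \<le> card C" using fin by (rule card_image_le)
  finally show ?thesis using C(2) by simp
qed

text \<open>
  On a triangle the direction \<open>t\<close> is tangential to the third side, on a square it is the
  common normal direction of the two sides.
\<close>

lemma tangent_to_other_faces:
  assumes cell: "is_cell c (K :: (real^2) set)" and FG: "F \<in> faces K" "G \<in> faces K" "F \<noteq> G"
    and i: "outward_normal K F $ i \<noteq> 0" "outward_normal K G $ i \<noteq> 0"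
  obtains t where "t \<bullet> outward_normal K F \<noteq> 0" "t \<bullet> outward_normal K G \<noteq> 0"
    "\<And>A. A \<in> faces K \<Longrightarrow> A \<noteq> F \<Longrightarrow> A \<noteq> G \<Longrightarrow> t \<bullet> outward_normal K A = 0"
proof -
  have pc: "polycell K" by (rule is_cell_imp_polycell[OF cell])
  let ?n = "outward_normal K"
  show ?thesis
  proof (cases c)
    case Cubic
    then obtain a h where h: "0 < h" and K: "K = box a (\<chi> i. a $ i + h)" using cell by auto
    have ax: "?n A = axis i 1 \<or> ?n A = - axis i 1" if A: "A \<in> faces K" "?n A $ i \<noteq> 0" for A
    proof -
      obtain j where j: "?n A = axis j 1 \<or> ?n A = - axis j 1" by (rule cube_normal[OF h K pc A(1)])
      then have "j = i" using A(2) by (auto simp: axis_def split: if_splits)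
      then show ?thesis using j by simp
    qed
    have ne: "?n F \<noteq> ?n G" using face_inj_normal[OF pc FG(1,2)] FG(3) by blast
    have "axis i 1 \<bullet> ?n A = 0" if A: "A \<in> faces K" "A \<noteq> F" "A \<noteq> G" for A
    proof (rule ccontr)
      assume "\<not> ?thesis"
      then have "?n A $ i \<noteq> 0" by (simp add: inner_axis')
      \<comment> \<open>\<open>F\<close> and \<open>G\<close> already take up both of the normals
        \<open>axis i 1\<close> and \<open>- axis i 1\<close>, as distinct sides have distinct
        normals.\<close>
      then have "?n A = ?n F \<or> ?n A = ?n G"
        using ax[OF A(1)] ax[OF FG(1) i(1)] ax[OF FG(2) i(2)] ne by auto
      then show False using face_inj_normal[OF pc A(1) FG(1)] face_inj_normal[OF pc A(1) FG(2)] A(2,3) by blast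
    qed
    then show ?thesis using that[of "axis i 1"] i by (simp add: inner_axis')
  next
    case Simplicial
    then obtain S where S: "int CARD(2) simplex S" "K = interior S" using cell by auto
    have fin: "finite (faces K)" by (rule finite_faces[OF pc])
    have card: "card (faces K) \<le> 3" using simplex_card_faces[OF S pc] by simp
    show ?thesis
    proof (cases "\<exists>A\<in>faces K. A \<noteq> F \<and> A \<noteq> G")
      case False
      then show ?thesis using that[of "axis i 1"] i by (auto simp: inner_axis')
    next
      case True
      then obtain A where A: "A \<in> faces K" "A \<noteq> F" "A \<noteq> G" by blast
      have "card {F, G, A} = 3" using A FG(3) by auto
      then have "{F, G, A} = faces K" using A FG card by (intro card_seteq[OF fin]) simp_all
      then have all: "faces K = {F, G, A}" by (rule sym)
      \<comment> \<open>The normal of the third side \<open>A\<close>, turned by a right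
        angle.\<close>
      define t :: "real^2" where "t = vector [- ?n A $ 2, ?n A $ 1]"
      have tA: "t \<bullet> ?n A = 0" by (simp add: t_def inner_vec_def sum_2)
      have t0: "t \<noteq> 0"
      proof
        assume "t = 0"
        then have "?n A = 0" by (simp add: t_def vec_eq_iff forall_2)
        then show False using outward_normal_nonzero[OF pc A(1)] by simp
      qed
      \<comment> \<open>The triangle is bounded, so it is left in both directions \<open>t\<close>
        and \<open>- t\<close>, never through \<open>A\<close>; hence one of \<open>F\<close> and
        \<open>G\<close> accounts for each direction.\<close>
      have pos: "\<exists>B\<in>{F, G}. ?n B \<bullet> t > 0" "\<exists>B\<in>{F, G}. ?n B \<bullet> (- t) > 0"
        using polycell_exit_face[OF pc, of t] polycell_exit_face[OF pc, of "- t"] t0 tA unfolding all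
        by (auto simp: inner_commute)
      have "t \<bullet> ?n F \<noteq> 0" "t \<bullet> ?n G \<noteq> 0" using pos by (auto simp: inner_commute)
      then show ?thesis by (rule that) (use all tA in auto)
    qed
  qed
qed

section \<open>The condensed Helmholtz problem\<close>

lemma zero_face_poly: "(\<lambda>x. 0) \<in> face_poly c p F"
  unfolding face_poly_def using poly_space_0[of c p] by (intro CollectI bexI[of _ "\<lambda>x. 0"]) auto

lemma cut_M_h:
  assumes "\<eta> \<in> M_h c p \<Omega> \<T>"
  shows "(\<lambda>F. if P F then \<eta> F else (\<lambda>x. 0)) \<in> M_h c p \<Omega> \<T>"
  using assms zero_face_poly unfolding M_h_def by auto

lemma hdot_cvec_scale: "hdot (q *s cvec t) (cvec n) = q * of_real (t \<bullet> n)"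
  by (simp add: hdot_def cvec_def inner_vec_def sum_distrib_left mult.assoc)

text \<open>The test field is a polynomial extension \<open>q\<close> of the data on
  \<open>F\<close> times the constant vector \<open>t\<close> from
  \<open>tangent_to_other_faces\<close>, so its degree is admissible. The data vanish on
  \<open>G\<close>, and \<open>t\<close> is tangential to any further side, so only the squared norm
  of the data on \<open>F\<close> remains, with a nonzero factor.\<close>

lemma orthogonal_traces_vanish:
  fixes K :: "(real^2) set"
  assumes cell: "is_cell c K" and FG: "F \<in> faces K" "G \<in> faces K"
    and i: "outward_normal K F $ i \<noteq> 0" "outward_normal K G $ i \<noteq> 0"
    and \<Lambda>: "\<Lambda> F \<in> face_poly c p F" and G0: "\<And>x. x \<in> G \<Longrightarrow> \<Lambda> G x = 0"
    and orth: "\<And>v. v \<in> vpoly_space c p \<Longrightarrow> bip K \<Lambda> (\<lambda>F x. hdot (v x) (cvec (outward_normal K F))) = 0"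
    and x: "x \<in> F"
  shows "\<Lambda> F x = 0"
proof (cases "F = G")
  case True
  then show ?thesis using G0 x by simp
next
  case False
  have pc: "polycell K" by (rule is_cell_imp_polycell[OF cell])
  obtain t where t: "t \<bullet> outward_normal K F \<noteq> 0"
    "\<And>A. A \<in> faces K \<Longrightarrow> A \<noteq> F \<Longrightarrow> A \<noteq> G \<Longrightarrow> t \<bullet> outward_normal K A = 0"
    using tangent_to_other_faces[OF cell FG False i] by metis
  obtain q where q: "q \<in> poly_space c p" "\<And>x. x \<in> F \<Longrightarrow> \<Lambda> F x = q x"
    using \<Lambda> unfolding face_poly_def by blast
  define v where "v x = q x *s cvec t" for x
  have v: "v \<in> vpoly_space c p"
  proof (rule vpoly_spaceI)
    fix j
    have "(\<lambda>x. cvec t $ j * q x) \<in> poly_space c p" by (rule poly_space_scale[OF q(1)])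
    then show "(\<lambda>x. v x $ j) \<in> poly_space c p" by (simp add: v_def mult.commute)
  qed
  let ?a = "complex_of_real (t \<bullet> outward_normal K F)"
  have "0 = bip K \<Lambda> (\<lambda>F x. hdot (v x) (cvec (outward_normal K F)))" using orth[OF v] by simp
  also have "\<dots> = (LINT x:F|face_measure F. \<Lambda> F x * cnj (hdot (v x) (cvec (outward_normal K F))))"
    unfolding bip_fint
  proof (rule single_face_fint[OF pc FG(1)])
    fix A x assume A: "A \<in> faces K" "A \<noteq> F" "x \<in> A"
    show "\<Lambda> A x * cnj (hdot (v x) (cvec (outward_normal K A))) = 0"
      using G0 t(2)[OF A(1,2)] A(3) by (cases "A = G") (simp_all add: v_def hdot_cvec_scale)
  qed
  also have "\<dots> = (LINT x:F|face_measure F. ?a * of_real ((cmod (q x))\<^sup>2))"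
  proof -
    have "indicator F x *\<^sub>R (\<Lambda> F x * cnj (hdot (v x) (cvec (outward_normal K F)))) = indicator F x *\<^sub>R (?a * of_real ((cmod (q x))\<^sup>2))" for x
    proof (cases "x \<in> F")
      case True
      have "\<Lambda> F x * cnj (hdot (v x) (cvec (outward_normal K F))) = ?a * (q x * cnj (q x))"
        using q(2)[OF True] by (simp add: v_def hdot_cvec_scale)
      then show ?thesis by (simp only: complex_norm_square)
    qed simp
    then show ?thesis unfolding set_lebesgue_integral_def by (simp only:)
  qed
  also have "\<dots> = ?a * of_real (LINT x:F|face_measure F. (cmod (q x))\<^sup>2)"
    unfolding set_integral_mult_right set_integral_complex_of_real ..
  finally have z: "(LINT x:F|face_measure F. (cmod (q x))\<^sup>2) = 0" using t(1) by simp
  have "continuous_on F (\<lambda>x. (cmod (q x))\<^sup>2)" by (intro continuous_intros continuous_poly[OF q(1)])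
  then have "(cmod (q x))\<^sup>2 = 0" by (rule face_integral_zero[OF pc FG(1) _ _ z x]) simp
  then show ?thesis using q(2)[OF x] by simp
qed

theorem helmholtz_global_unisolvent:
  fixes \<T> :: "(real^2) set set"
  assumes k: "k \<noteq> 0" and mesh: "is_mesh c \<Omega> \<T>" and stab: "\<And>K. K \<in> \<T> \<Longrightarrow> stab_condition k (\<tau> K)"
    and adj: "\<And>K L. K \<in> \<T> \<Longrightarrow> L \<in> \<T> \<Longrightarrow> adjacent K L \<Longrightarrow> Im k = 0 \<longrightarrow> Re (\<tau> K) * Re (\<tau> L) > 0"
    and \<Lambda>: "\<Lambda> \<in> M_h c p \<Omega> \<T>"
  shows "(\<forall>\<eta>\<in>M_h c p \<Omega> \<T>. helmholtz_form k p c \<T> \<tau> \<Lambda> \<eta> = 0) \<longleftrightarrow> (\<forall>F\<in>mesh_faces \<T>. \<forall>x\<in>F. \<Lambda> F x = 0)"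
proof -
  note fin = meshD(2)[OF mesh] and pc = mesh_polycell[OF mesh]
  let ?n = "\<lambda>K F. cvec (outward_normal K F)"
  have \<Lambda>F: "\<Lambda> F \<in> face_poly c p F" if "K \<in> \<T>" "F \<in> faces K" for K F
    using \<Lambda> that unfolding M_h_def mesh_faces_def by blast
  have fc: "fcont K \<Lambda>" if "K \<in> \<T>" for K by (rule fcont_face_poly[OF \<Lambda>F[OF that]])
  define U where "U K = fst (helmholtz_sol k p c (\<tau> K) K \<Lambda>)" for K
  define \<phi> where "\<phi> K = snd (helmholtz_sol k p c (\<tau> K) K \<Lambda>)" for K
  have ex1: "\<exists>!X. X \<in> helmholtz_solutions k p c (\<tau> K) K \<Lambda> (\<lambda>x. 0)" if K: "K \<in> \<T>" for K
    by (rule helmholtz_local_unisolvent[OF pc[OF K] k stab[OF K] \<Lambda>F[OF K] square_integrable_zero])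
  have sol: "(U K, \<phi> K) \<in> helmholtz_solutions k p c (\<tau> K) K \<Lambda> (\<lambda>x. 0)" if K: "K \<in> \<T>" for K
    using theI'[OF ex1[OF K]] by (simp add: U_def \<phi>_def helmholtz_sol_def)
  have flux: "helmholtz_flux k p c (\<tau> K) K \<Lambda> = (\<lambda>F x. hdot (U K x) (?n K F) + \<tau> K * (\<phi> K x - \<Lambda> F x))" for K
    by (simp add: fun_eq_iff helmholtz_flux_def Let_def case_prod_unfold U_def \<phi>_def)
  let ?G = "\<lambda>K \<eta>. bip K (helmholtz_flux k p c (\<tau> K) K \<Lambda>) \<eta>"
  show ?thesis
  proof
    assume zero: "\<forall>F\<in>mesh_faces \<T>. \<forall>x\<in>F. \<Lambda> F x = 0"
    have \<Lambda>0: "\<Lambda> F x = 0" if "K \<in> \<T>" "F \<in> faces K" "x \<in> F" for K F x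
      using zero that unfolding mesh_faces_def by blast
    have G0: "?G K \<eta> = 0" if K: "K \<in> \<T>" for K \<eta>
    proof -
      have "bip K \<Lambda> v = bip K (\<lambda>F x. 0) v" for v
        unfolding bip_fint by (rule fint_cong, simp add: \<Lambda>0[OF K])
      then have "((\<lambda>x. 0), (\<lambda>x. 0)) \<in> helmholtz_solutions k p c (\<tau> K) K \<Lambda> (\<lambda>x. 0)"
        unfolding helmholtz_solutions_iff
        by (simp add: helmholtz_lhs_def helmholtz_rhs_def vip_zero ip_zero bip_zero divg_zero vpoly_0 poly_space_0)
      then have "U K = (\<lambda>x. 0) \<and> \<phi> K = (\<lambda>x. 0)" using ex1[OF K] sol[OF K] by blast
      then have "?G K \<eta> = bip K (\<lambda>F x. 0) \<eta>"
        unfolding bip_fint flux by (intro fint_cong) (simp add: \<Lambda>0[OF K])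
      then show ?thesis by (simp add: bip_zero)
    qed
    show "\<forall>\<eta>\<in>M_h c p \<Omega> \<T>. helmholtz_form k p c \<T> \<tau> \<Lambda> \<eta> = 0"
    proof
      fix \<eta>
      have "\<forall>K\<in>\<T>. ?G K \<eta> = 0" using G0 by (rule ballI)
      then show "helmholtz_form k p c \<T> \<tau> \<Lambda> \<eta> = 0" unfolding helmholtz_form_def by (rule sum.neutral)
    qed
  next
    assume form: "\<forall>\<eta>\<in>M_h c p \<Omega> \<T>. helmholtz_form k p c \<T> \<tau> \<Lambda> \<eta> = 0"
    define P where "P K \<alpha> \<beta> \<gamma> \<longleftrightarrow> 0 \<le> \<alpha> \<and> 0 \<le> \<beta> \<and> 0 \<le> \<gamma> \<and>
      \<i> * k * complex_of_real \<alpha> - \<i> * cnj k * complex_of_real \<beta> + \<tau> K * complex_of_real \<gamma> + ?G K \<Lambda> = 0 \<and>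
      (\<alpha> = 0 \<longrightarrow> \<phi> K = (\<lambda>x. 0)) \<and> (\<beta> = 0 \<longrightarrow> U K = (\<lambda>x. 0)) \<and>
      (\<gamma> = 0 \<longrightarrow> (\<forall>F\<in>faces K. \<forall>x\<in>F. \<phi> K x - \<Lambda> F x = 0))" for K \<alpha> \<beta> \<gamma>
    have "\<exists>\<alpha> \<beta> \<gamma>. P K \<alpha> \<beta> \<gamma>" if K: "K \<in> \<T>" for K
    proof (rule helmholtz_energy[OF pc[OF K] sol[OF K] fc[OF K]], intro exI)
      fix \<alpha> \<beta> \<gamma>
      assume "0 \<le> \<alpha>" "0 \<le> \<beta>" "0 \<le> \<gamma>" and "\<i> * k * complex_of_real \<alpha> - \<i> * cnj k * complex_of_real \<beta>
          + \<tau> K * complex_of_real \<gamma> + bip K (\<lambda>F x. hdot (U K x) (?n K F) + \<tau> K * (\<phi> K x - \<Lambda> F x)) \<Lambda> = 0"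
        and "\<alpha> = 0 \<Longrightarrow> \<phi> K = (\<lambda>x. 0)" "\<beta> = 0 \<Longrightarrow> U K = (\<lambda>x. 0)"
          "\<gamma> = 0 \<Longrightarrow> \<forall>F\<in>faces K. \<forall>x\<in>F. \<phi> K x - \<Lambda> F x = 0"
      then show "P K \<alpha> \<beta> \<gamma>" unfolding P_def flux by (intro conjI impI)
    qed
    then obtain \<alpha> \<beta> \<gamma> where P: "\<And>K. K \<in> \<T> \<Longrightarrow> P K (\<alpha> K) (\<beta> K) (\<gamma> K)" by metis
    have nn: "\<alpha> K \<ge> 0" "\<beta> K \<ge> 0" "\<gamma> K \<ge> 0"
      and id: "\<i> * k * complex_of_real (\<alpha> K) - \<i> * cnj k * complex_of_real (\<beta> K) + \<tau> K * complex_of_real (\<gamma> K) + ?G K \<Lambda> = 0"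
      and z: "\<alpha> K = 0 \<Longrightarrow> \<phi> K = (\<lambda>x. 0)" "\<beta> K = 0 \<Longrightarrow> U K = (\<lambda>x. 0)"
        "\<And>F x. \<gamma> K = 0 \<Longrightarrow> F \<in> faces K \<Longrightarrow> x \<in> F \<Longrightarrow> \<phi> K x - \<Lambda> F x = 0"
      if K: "K \<in> \<T>" for K
      using P[OF K] unfolding P_def by simp_all
    have re: "Re (?G K \<Lambda>) = Im k * (\<alpha> K + \<beta> K) - Re (\<tau> K) * \<gamma> K" if "K \<in> \<T>" for K
      using arg_cong[OF id[OF that], of Re] by (simp add: algebra_simps)
    show "\<forall>F\<in>mesh_faces \<T>. \<forall>x\<in>F. \<Lambda> F x = 0"
    proof (cases "Im k = 0")
      case True
      have \<gamma>0: "\<gamma> K = 0" if K: "K \<in> \<T>" for K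
      proof (rule sign_decoupling[where t = "\<lambda>K. Re (\<tau> K)" and G = ?G and \<Lambda> = \<Lambda> and \<T> = \<T>])
        show "?G L \<eta> = ?G L \<eta>'" if "\<And>F. F \<in> faces L \<Longrightarrow> \<eta> F = \<eta>' F" for L \<eta> \<eta>'
          unfolding bip_fint by (rule fint_cong) (simp add: that)
        show "(\<Sum>K\<in>\<T>. ?G K (cut A \<Lambda>)) = 0" for A
          using form cut_M_h[OF \<Lambda>, of "\<lambda>F. \<exists>K\<in>A. F \<in> faces K"] unfolding helmholtz_form_def cut_def[abs_def] by blast
      qed (use fin stab adj True re nn K in \<open>simp_all add: bip_zero stab_condition_def\<close>)
      show ?thesis
      proof (intro ballI)
        fix F x assume "F \<in> mesh_faces \<T>" and x: "x \<in> F"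
        then obtain K where K: "K \<in> \<T>" and F: "F \<in> faces K" by (auto simp: mesh_faces_def)
        have "U K = (\<lambda>x. 0) \<and> \<phi> K = (\<lambda>x. 0)"
          by (rule helmholtz_matching_trace_zero[OF pc[OF K] k sol[OF K]]) (rule z(3)[OF K \<gamma>0[OF K]])
        then show "\<Lambda> F x = 0" using z(3)[OF K \<gamma>0[OF K] F x] by simp
      qed
    next
      case False
      have "(\<Sum>K\<in>\<T>. Re (?G K \<Lambda>)) = 0"
        using form \<Lambda> unfolding helmholtz_form_def by (simp add: Re_sum[symmetric])
      then have "(\<Sum>K\<in>\<T>. - (Re (?G K \<Lambda>))) = 0" by (simp add: sum_negf)
      moreover have "(\<Sum>K\<in>\<T>. - (Re (?G K \<Lambda>))) = (\<Sum>K\<in>\<T>. - Im k * (\<alpha> K + \<beta> K) + Re (\<tau> K) * \<gamma> K)"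
        by (rule sum.cong) (simp_all add: re)
      ultimately have sum0: "(\<Sum>K\<in>\<T>. - Im k * (\<alpha> K + \<beta> K) + Re (\<tau> K) * \<gamma> K) = 0" by simp
      have U0: "\<phi> K = (\<lambda>x. 0)" "U K = (\<lambda>x. 0)" if K: "K \<in> \<T>" for K
        using damped_energies_vanish[OF fin False stab nn sum0 K] z(1,2)[OF K] by simp_all
      have orth: "bip K \<Lambda> (\<lambda>F x. hdot (v x) (?n K F)) = 0" if K: "K \<in> \<T>" and v: "v \<in> vpoly_space c p" for K v
        using helmholtz_solutionsD(3)[OF sol[OF K] v] by (simp add: U0[OF K] vip_zero ip_zero)
      \<comment> \<open>Cells with nonzero data on a side that is not parallel to the axis
        \<open>i\<close>. They will form a patch as in \<open>closed_patch_empty\<close>.\<close>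
      define B where "B i = {K \<in> \<T>. \<exists>F\<in>faces K. outward_normal K F $ i \<noteq> 0 \<and> (\<exists>x\<in>F. \<Lambda> F x \<noteq> 0)}" for i
      have "B i = {}" for i
      proof (rule closed_patch_empty[OF mesh])
        show "B i \<subseteq> \<T>" by (auto simp: B_def)
        fix K F assume "K \<in> B i" and F: "F \<in> faces K" and n: "outward_normal K F $ i \<noteq> 0"
        then obtain G y where K: "K \<in> \<T>" and G: "G \<in> faces K" "outward_normal K G $ i \<noteq> 0" "y \<in> G" "\<Lambda> G y \<noteq> 0"
          unfolding B_def by blast
        \<comment> \<open>If the data vanished on \<open>F\<close>, then
          \<open>orthogonal_traces_vanish\<close>, with \<open>G\<close> as the side in question and
          \<open>F\<close> as the side with zero data, would make them vanish on \<open>G\<close>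
          too.\<close>
        have F0: "\<exists>x\<in>F. \<Lambda> F x \<noteq> 0"
        proof (rule ccontr)
          assume "\<not> ?thesis"
          then have "\<Lambda> F x = 0" if "x \<in> F" for x using that by blast
          then have "\<Lambda> G y = 0"
            by (intro orthogonal_traces_vanish[OF meshD(3)[OF mesh K] G(1) F G(2) n \<Lambda>F[OF K G(1)] _ orth[OF K] G(3)])
          then show False using G(4) by simp
        qed
        have "F \<in> mesh_faces \<T>" using K F by (auto simp: mesh_faces_def)
        then have "\<not> F \<subseteq> frontier \<Omega>" using \<Lambda> F0 unfolding M_h_def by blast
        then obtain L where L: "L \<in> \<T>" "L \<noteq> K" "F \<in> faces L" by (rule mesh_neighbour[OF mesh K F])
        have "outward_normal L F $ i \<noteq> 0"
          using mesh_opposite_normal[OF mesh K L(1) _ F L(3)] L(2) n by simp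
        then have "L \<in> B i" using L F0 unfolding B_def by blast
        then show "\<exists>L\<in>B i. L \<noteq> K \<and> F \<in> faces L" using L by blast
      qed
      note B = this
      show ?thesis
      proof (intro ballI)
        fix F x assume "F \<in> mesh_faces \<T>" and x: "x \<in> F"
        then obtain K where K: "K \<in> \<T>" and F: "F \<in> faces K" by (auto simp: mesh_faces_def)
        \<comment> \<open>A nonzero normal has a nonzero component, so a side with nonzero data puts
          its cell into some \<open>B i\<close>.\<close>
        have "outward_normal K F \<noteq> 0" by (rule outward_normal_nonzero[OF pc[OF K] F])
        then obtain i where i: "outward_normal K F $ i \<noteq> 0" by (auto simp: vec_eq_iff)
        show "\<Lambda> F x = 0"
        proof (rule ccontr)
          assume "\<Lambda> F x \<noteq> 0"
          then have "K \<in> B i" unfolding B_def using K F i x by blast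
          then show False using B by simp
        qed
      qed
    qed
  qed
qed

theorem theorem1:
  fixes k :: complex and p :: nat
  assumes "k \<noteq> 0"
  shows
    "(\<forall>c (\<Omega> :: (real^3) set) \<T> (\<tau> :: (real^3) set \<Rightarrow> complex).
        is_mesh c \<Omega> \<T> \<and> (\<forall>K\<in>\<T>. stab_condition k (\<tau> K)) \<longrightarrow>
          (\<forall>K\<in>\<T>. \<forall>Eh J.
             (\<forall>F\<in>faces K. Eh F \<in> face_tpoly c p F) \<and> square_integrable K J \<longrightarrow>
             (\<exists>!X. X \<in> maxwell_solutions k p c (\<tau> K) K Eh J)) \<and>
          ((\<forall>K\<in>\<T>. \<forall>K'\<in>\<T>. adjacent K K' \<longrightarrow>
              (Im k = 0 \<longrightarrow> Re (\<tau> K) * Re (\<tau> K') > 0) \<and> (Im k \<noteq> 0 \<longrightarrow> \<tau> K + \<tau> K' \<noteq> 0)) \<longrightarrow>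
           (\<forall>Eh\<in>N_h c p \<Omega> \<T>.
              (\<forall>\<eta>\<in>N_h c p \<Omega> \<T>. maxwell_form k p c \<T> \<tau> Eh \<eta> = 0) \<longleftrightarrow>
              (\<forall>F\<in>mesh_faces \<T>. \<forall>x\<in>F. Eh F x = 0)))) \<and>
     (\<forall>c (\<Omega> :: (real^2) set) \<T> (\<tau> :: (real^2) set \<Rightarrow> complex).
        is_mesh c \<Omega> \<T> \<and> (\<forall>K\<in>\<T>. stab_condition k (\<tau> K)) \<longrightarrow>
          (\<forall>K\<in>\<T>. \<forall>\<phi>h f.
             (\<forall>F\<in>faces K. \<phi>h F \<in> face_poly c p F) \<and> square_integrable K f \<longrightarrow>
             (\<exists>!X. X \<in> helmholtz_solutions k p c (\<tau> K) K \<phi>h f)) \<and>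
          ((\<forall>K\<in>\<T>. \<forall>K'\<in>\<T>. adjacent K K' \<longrightarrow>
              (Im k = 0 \<longrightarrow> Re (\<tau> K) * Re (\<tau> K') > 0)) \<longrightarrow>
           (\<forall>\<phi>h\<in>M_h c p \<Omega> \<T>.
              (\<forall>\<eta>\<in>M_h c p \<Omega> \<T>. helmholtz_form k p c \<T> \<tau> \<phi>h \<eta> = 0) \<longleftrightarrow>
              (\<forall>F\<in>mesh_faces \<T>. \<forall>x\<in>F. \<phi>h F x = 0))))"
proof (rule conjI, goal_cases)
  case 1
  show ?case
  proof (rule allI, rule allI, rule allI, rule allI, rule impI, elim conjE, rule conjI)
    fix c and \<Omega> :: "(real^3) set" and \<T> and \<tau> :: "(real^3) set \<Rightarrow> complex"
    assume mesh: "is_mesh c \<Omega> \<T>" and stab: "\<forall>K\<in>\<T>. stab_condition k (\<tau> K)"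
    show "\<forall>K\<in>\<T>. \<forall>Eh J. (\<forall>F\<in>faces K. Eh F \<in> face_tpoly c p F) \<and> square_integrable K J \<longrightarrow>
        (\<exists>!X. X \<in> maxwell_solutions k p c (\<tau> K) K Eh J)"
    proof (rule ballI, rule allI, rule allI, rule impI, elim conjE)
      fix K Eh and J :: "real^3 \<Rightarrow> complex^3" assume K: "K \<in> \<T>" and Eh: "\<forall>F\<in>faces K. Eh F \<in> face_tpoly c p F" and J: "square_integrable K J"
      show "\<exists>!X. X \<in> maxwell_solutions k p c (\<tau> K) K Eh J"
        by (rule maxwell_local_unisolvent[OF mesh_polycell[OF mesh K] assms bspec[OF stab K] bspec[OF Eh] J])
    qed
    show "(\<forall>K\<in>\<T>. \<forall>K'\<in>\<T>. adjacent K K' \<longrightarrow>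
          (Im k = 0 \<longrightarrow> Re (\<tau> K) * Re (\<tau> K') > 0) \<and> (Im k \<noteq> 0 \<longrightarrow> \<tau> K + \<tau> K' \<noteq> 0)) \<longrightarrow>
        (\<forall>Eh\<in>N_h c p \<Omega> \<T>. (\<forall>\<eta>\<in>N_h c p \<Omega> \<T>. maxwell_form k p c \<T> \<tau> Eh \<eta> = 0) \<longleftrightarrow>
          (\<forall>F\<in>mesh_faces \<T>. \<forall>x\<in>F. Eh F x = 0))"
    proof (rule impI, rule ballI)
      fix Eh assume adj: "\<forall>K\<in>\<T>. \<forall>K'\<in>\<T>. adjacent K K' \<longrightarrow>
          (Im k = 0 \<longrightarrow> Re (\<tau> K) * Re (\<tau> K') > 0) \<and> (Im k \<noteq> 0 \<longrightarrow> \<tau> K + \<tau> K' \<noteq> 0)"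
        and Eh: "Eh \<in> N_h c p \<Omega> \<T>"
      show "(\<forall>\<eta>\<in>N_h c p \<Omega> \<T>. maxwell_form k p c \<T> \<tau> Eh \<eta> = 0) \<longleftrightarrow> (\<forall>F\<in>mesh_faces \<T>. \<forall>x\<in>F. Eh F x = 0)"
        by (rule maxwell_global_unisolvent[OF assms mesh bspec[OF stab] adj[rule_format] Eh])
    qed
  qed
next
  case 2
  show ?case
  proof (rule allI, rule allI, rule allI, rule allI, rule impI, elim conjE, rule conjI)
    fix c and \<Omega> :: "(real^2) set" and \<T> and \<tau> :: "(real^2) set \<Rightarrow> complex"
    assume mesh: "is_mesh c \<Omega> \<T>" and stab: "\<forall>K\<in>\<T>. stab_condition k (\<tau> K)"
    show "\<forall>K\<in>\<T>. \<forall>\<phi>h f. (\<forall>F\<in>faces K. \<phi>h F \<in> face_poly c p F) \<and> square_integrable K f \<longrightarrow>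
        (\<exists>!X. X \<in> helmholtz_solutions k p c (\<tau> K) K \<phi>h f)"
    proof (rule ballI, rule allI, rule allI, rule impI, elim conjE)
      fix K \<phi>h and f :: "real^2 \<Rightarrow> complex" assume K: "K \<in> \<T>" and \<phi>h: "\<forall>F\<in>faces K. \<phi>h F \<in> face_poly c p F" and f: "square_integrable K f"
      show "\<exists>!X. X \<in> helmholtz_solutions k p c (\<tau> K) K \<phi>h f"
        by (rule helmholtz_local_unisolvent[OF mesh_polycell[OF mesh K] assms bspec[OF stab K] bspec[OF \<phi>h] f])
    qed
    show "(\<forall>K\<in>\<T>. \<forall>K'\<in>\<T>. adjacent K K' \<longrightarrow> (Im k = 0 \<longrightarrow> Re (\<tau> K) * Re (\<tau> K') > 0)) \<longrightarrow>
        (\<forall>\<phi>h\<in>M_h c p \<Omega> \<T>. (\<forall>\<eta>\<in>M_h c p \<Omega> \<T>. helmholtz_form k p c \<T> \<tau> \<phi>h \<eta> = 0) \<longleftrightarrow>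
          (\<forall>F\<in>mesh_faces \<T>. \<forall>x\<in>F. \<phi>h F x = 0))"
    proof (rule impI, rule ballI)
      fix \<phi>h assume adj: "\<forall>K\<in>\<T>. \<forall>K'\<in>\<T>. adjacent K K' \<longrightarrow> (Im k = 0 \<longrightarrow> Re (\<tau> K) * Re (\<tau> K') > 0)"
        and \<phi>h: "\<phi>h \<in> M_h c p \<Omega> \<T>"
      have adj': "Im k = 0 \<longrightarrow> Re (\<tau> K) * Re (\<tau> L) > 0" if "K \<in> \<T>" "L \<in> \<T>" "adjacent K L" for K L
        using adj that by blast
      show "(\<forall>\<eta>\<in>M_h c p \<Omega> \<T>. helmholtz_form k p c \<T> \<tau> \<phi>h \<eta> = 0) \<longleftrightarrow> (\<forall>F\<in>mesh_faces \<T>. \<forall>x\<in>F. \<phi>h F x = 0)"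
        by (rule helmholtz_global_unisolvent[OF assms mesh bspec[OF stab] adj' \<phi>h])
    qed
  qed
qed

end
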